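(* Let $V$ be a model of set theory, $\kappa$ an infinite ordinal, $X\in V$ an infinite set, $\mathscr{L}\in V$ a relational language. Let $\mu\in V$ be a probability $\kappa$-measure on $[\mathrm{Str}^\kappa_{\mathscr{L}}(X)]^V$, and suppose $G$ is a $\mu$-random generic filter over $V$. Let $G_b$ be the set of basic $\kappa$-Borel codes belonging to $G$. Then the following hold. (a) $V[G]\models\bigl|\bigcap_{g\in G}\mathrm{Int}(g)\bigr|=1$. (b) $V[G]\models\bigcap_{g\in G}\mathrm{Int}(g)=\bigcap_{g\in G_b}\mathrm{Int}(g)$. (c) If $V[G]\models\{\mathcal{M}_G\}=\bigcap_{g\in G_b}\mathrm{Int}(g)$ then $$G=\{\zeta\in[\mathcal{O}^+(\mu)]^V : V[G]\models\mathcal{M}_G\in\mathrm{Int}(\zeta)\}.$$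
   Context: A model of set theory is a transitive model of ZFC. Structures and measures: $\mathrm{Str}_{\mathscr{L}}(X)$ is the set of $\mathscr{L}$-structures with underlying set $X$. An $\mathscr{L}$-literal is an atomic formula or a (possibly iterated) negation of one. $\sigma_\kappa(\mathrm{Str}_{\mathscr{L}}(X))$ is the smallest family of subsets of $\mathrm{Str}_{\mathscr{L}}(X)$ closed under complements and under unions of size $\le\kappa$ and containing all sets $\{\mathcal{M}:\mathcal{M}\models\varphi(\bar a)\}$ for $\varphi$ a literal and $\bar a$ a tuple from $X$. $\mathrm{Str}^\kappa_{\mathscr{L}}(X)$ is $\mathrm{Str}_{\mathscr{L}}(X)$ with this family of measurable sets. A probability $\kappa$-measure on it is a probability measure $\mu$ with $\mu(\bigcup_{i\in\kappa}A_i)=\sum_{i\in\kappa}\mu(A_i)$ for pairwise disjoint measurable $A_i$. Codes: the set $\mathbb{B}^\kappa_{\mathscr{L}:X}$ of $\kappa$-Borel codes is the smallest set containing the basic codes $\langle 0,\varphi,\bar a\rangle$ ($\varphi$ a finite conjunction of $\mathscr{L}$-literals, $\bar a$ a tuple from $X$ of length the arity of $\varphi$) and closed under formal negation $\neg\gamma$ and formal $\bigvee\Gamma$, $\bigwedge\Gamma$ for $\Gamma=\{\gamma_i\}_{i\in\kappa}$. The interpretation $\mathrm{Int}(\gamma)\subseteq\mathrm{Str}_{\mathscr{L}}(X)$, computed in a given model, interprets basic codes as $\{\mathcal{M}:\mathcal{M}\models\varphi(\bar a)\}$ and $\neg,\bigvee,\bigwedge$ as complement, union, intersection. $\mu(\gamma)=\mu(\mathrm{Int}(\gamma))$.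 Forcing: $\gamma\preceq_\mu\zeta$ means $\mu(\gamma\wedge\neg\zeta)=0$, and $\mathcal{O}^+(\mu)=(\{\gamma\in\mathbb{B}^\kappa_{\mathscr{L}:X}:\mu(\gamma)>0\},\preceq_\mu)$, a pre-order (smaller is stronger), computed in $V$. A $\mu$-random generic filter over $V$ is a filter on $\mathcal{O}^+(\mu)$ generic over $V$. *)

theory Defs
  imports "HOL-Analysis.Infinite_Sum"
begin

section \<open>A type of sets\<close>

text \<open>
  HOL has no type of all sets, so the ambient universe is the type \<open>'k hset\<close> of all sets
  hereditarily of size at most \<open>|nat + 'k|\<close>: well-founded trees with branching indexed by
  \<open>nat + 'k\<close>, up to bisimilarity.  Membership is extensional and well-founded, and every
  HOL set of size at most \<open>|nat + 'k|\<close> is the extension of an element.  Since \<open>'k\<close> is arbitrary,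
  every transitive set occurs as a subset of some \<open>'k hset\<close>.
\<close>

datatype 'k tree = Leaf | Node "nat + 'k \<Rightarrow> 'k tree"

primrec kids :: "'k tree \<Rightarrow> 'k tree set" where
  "kids Leaf = {}"
| "kids (Node f) = range f"

inductive tree_eq :: "'k tree \<Rightarrow> 'k tree \<Rightarrow> bool" where
  "\<lbrakk>\<forall>s'\<in>kids s. \<exists>t'\<in>kids t. tree_eq s' t'; \<forall>t'\<in>kids t. \<exists>s'\<in>kids s. tree_eq s' t'\<rbrakk>
    \<Longrightarrow> tree_eq s t"

lemma tree_eqD:
  assumes "tree_eq s t"
  shows "s' \<in> kids s \<Longrightarrow> \<exists>t'\<in>kids t. tree_eq s' t'"
    and "t' \<in> kids t \<Longrightarrow> \<exists>s'\<in>kids s. tree_eq s' t'"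
  using assms by (simp_all only: tree_eq.simps[of s t]) blast+

lemma tree_eq_refl: "tree_eq t t"
proof (induction t)
  case Leaf
  show ?case by (rule tree_eq.intros) simp_all
next
  case (Node f)
  then have "\<forall>s\<in>kids (Node f). tree_eq s s" by simp
  then show ?case by (intro tree_eq.intros) blast+
qed

lemma tree_eq_sym: "tree_eq s t \<Longrightarrow> tree_eq t s"
proof (induction s arbitrary: t)
  case Leaf
  then have "kids t = {}" using tree_eqD(2)[OF Leaf] by auto
  then show ?case by (intro tree_eq.intros) simp_all
next
  case (Node f)
  have IH: "tree_eq t' s'" if "s' \<in> kids (Node f)" "tree_eq s' t'" for s' t'
    by (rule Node.IH) (use that in simp_all)
  show ?case
    using tree_eqD(1)[OF Node.prems] tree_eqD(2)[OF Node.prems] IH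
    by (intro tree_eq.intros ballI) meson+
qed

lemma tree_eq_trans: "tree_eq s t \<Longrightarrow> tree_eq t u \<Longrightarrow> tree_eq s u"
proof (induction s arbitrary: t u)
  case Leaf
  have "kids t = {}" using tree_eqD(2)[OF Leaf(1)] by auto
  then have "kids u = {}" using tree_eqD(2)[OF Leaf(2)] by blast
  then show ?case by (intro tree_eq.intros) simp_all
next
  case (Node f)
  have IH: "tree_eq s' u'" if "s' \<in> kids (Node f)" "tree_eq s' t'" "tree_eq t' u'" for s' t' u'
    by (rule Node.IH) (use that in simp_all)
  show ?case
    using tree_eqD[OF Node.prems(1)] tree_eqD[OF Node.prems(2)] IH
    by (intro tree_eq.intros ballI) meson+
qed

quotient_type 'k hset = "'k tree" / tree_eq
proof (intro equivpI reflpI sympI transpI)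
  show "tree_eq t t" for t :: "'k tree" by (rule tree_eq_refl)
  show "tree_eq s t \<Longrightarrow> tree_eq t s" for s t :: "'k tree" by (rule tree_eq_sym)
  show "tree_eq s t \<Longrightarrow> tree_eq t u \<Longrightarrow> tree_eq s u" for s t u :: "'k tree"
    by (rule tree_eq_trans)
qed

definition elts :: "'k hset \<Rightarrow> 'k hset set" where
  "elts x = abs_hset ` kids (rep_hset x)"

text \<open>The set with a given extension (unspecified if that extension is too large).\<close>

definition mk :: "'k hset set \<Rightarrow> 'k hset" where
  "mk A = (THE x. elts x = A)"

lemma abs_hset_eq_iff: "abs_hset s = abs_hset t \<longleftrightarrow> tree_eq s t"
  by (rule hset.abs_eq_iff)

lemma abs_rep_hset: "abs_hset (rep_hset x) = x"
  by (rule Quotient_abs_rep[OF Quotient_hset])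

lemma elts_abs: "elts (abs_hset t) = abs_hset ` kids t"
proof -
  have sub: "abs_hset ` kids s \<subseteq> abs_hset ` kids u" if "tree_eq s u" for s u :: "'a tree"
  proof
    fix z assume "z \<in> abs_hset ` kids s"
    then obtain s' where s': "s' \<in> kids s" "z = abs_hset s'" by blast
    from tree_eqD(1)[OF that s'(1)] obtain u' where u': "u' \<in> kids u" "tree_eq s' u'" by blast
    have "z = abs_hset u'" using s'(2) u'(2) by (simp only: abs_hset_eq_iff)
    then show "z \<in> abs_hset ` kids u" using u'(1) by (rule image_eqI)
  qed
  have "tree_eq (rep_hset (abs_hset t)) t"
    by (rule abs_hset_eq_iff[THEN iffD1]) (rule abs_rep_hset)
  from sub[OF this] sub[OF tree_eq_sym[OF this]] show ?thesis
    unfolding elts_def by (rule equalityI)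
qed

lemma elts_inject: "elts x = elts y \<longleftrightarrow> x = y"
proof
  assume eq: "elts x = elts y"
  have tree_eq: "tree_eq s' t'" if "abs_hset s' = abs_hset t'" for s' t' :: "'a tree"
    by (rule abs_hset_eq_iff[THEN iffD1, OF that])
  have img: "abs_hset ` kids (rep_hset x) = abs_hset ` kids (rep_hset y)"
    using eq unfolding elts_def .
  have "tree_eq (rep_hset x) (rep_hset y)"
  proof (rule tree_eq.intros; intro ballI)
    fix s' assume "s' \<in> kids (rep_hset x)"
    then have "abs_hset s' \<in> abs_hset ` kids (rep_hset y)"
      unfolding img[symmetric] by (rule imageI)
    then show "\<exists>t'\<in>kids (rep_hset y). tree_eq s' t'"
      by (rule imageE) (rule bexI, rule tree_eq)
  next
    fix t' assume "t' \<in> kids (rep_hset y)"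
    then have "abs_hset t' \<in> abs_hset ` kids (rep_hset x)"
      unfolding img by (rule imageI)
    then show "\<exists>s'\<in>kids (rep_hset x). tree_eq s' t'"
      by (rule imageE) (rule bexI, rule tree_eq, rule sym)
  qed
  then have "abs_hset (rep_hset x) = abs_hset (rep_hset y)"
    by (rule abs_hset_eq_iff[THEN iffD2])
  then show "x = y" unfolding abs_rep_hset .
next
  show "x = y \<Longrightarrow> elts x = elts y" by (rule arg_cong)
qed

lemma wf_elts: "wf {(x, y). x \<in> elts y}"
proof (rule wfUNIVI)
  fix P :: "'a hset \<Rightarrow> bool" and x
  assume *: "\<forall>x. (\<forall>y. (y, x) \<in> {(x, y). x \<in> elts y} \<longrightarrow> P y) \<longrightarrow> P x"
  have step: "P x" if "\<And>y. y \<in> elts x \<Longrightarrow> P y" for x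
    using *[THEN spec, of x] that by simp
  have "P (abs_hset t)" for t
  proof (induction t)
    case Leaf
    show ?case by (rule step) (simp add: elts_abs)
  next
    case (Node f)
    show ?case
    proof (rule step)
      fix y assume "y \<in> elts (abs_hset (Node f))"
      then obtain i where "y = abs_hset (f i)" by (auto simp: elts_abs)
      then show "P y" using Node[of "f i"] by simp
    qed
  qed
  from this[of "rep_hset x"] show "P x" by (simp only: abs_rep_hset)
qed

lemma ex_elts:
  assumes "A \<subseteq> range (f :: nat + 'k \<Rightarrow> 'k hset)"
  shows "\<exists>x :: 'k hset. elts x = A"
proof (cases "A = {}")
  case True
  then have "elts (abs_hset Leaf) = A" by (simp add: elts_abs)
  then show ?thesis by blast
next
  case False
  then obtain a where a: "a \<in> A" by blast
  let ?g = "\<lambda>i. if f i \<in> A then f i else a"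
  have "range ?g = A"
  proof
    show "range ?g \<subseteq> A" using a by auto
    show "A \<subseteq> range ?g"
    proof
      fix z assume z: "z \<in> A"
      with assms obtain i where "z = f i" by blast
      with z have "z = ?g i" by simp
      then show "z \<in> range ?g" by (rule range_eqI)
    qed
  qed
  moreover have "elts (abs_hset (Node (\<lambda>i. rep_hset (?g i)))) = range ?g"
    unfolding elts_abs kids.simps image_image abs_rep_hset ..
  ultimately show ?thesis by (intro exI) (rule trans)
qed

lemma elts_small:
  obtains f :: "nat + 'k \<Rightarrow> 'k hset" where "elts (x :: 'k hset) \<subseteq> range f"
proof (cases "rep_hset x")
  case Leaf
  then have "elts x \<subseteq> range (\<lambda>_. x)" unfolding elts_def by simp
  then show thesis by (rule that)
next
  case (Node f)
  have "elts x \<subseteq> range (\<lambda>i. abs_hset (f i))"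
    unfolding elts_def Node kids.simps image_image ..
  then show thesis by (rule that)
qed

lemma mk_elts [simp]: "mk (elts x) = x"
  unfolding mk_def by (simp add: elts_inject)

lemma elts_mk:
  assumes "A \<subseteq> range (f :: nat + 'k \<Rightarrow> 'k hset)"
  shows "elts (mk A) = A"
  using ex_elts[OF assms] by (rule exE) (metis mk_elts)

lemma range_case_sum: "range (case_sum f g) = range f \<union> range g"
proof -
  have "case_sum f g (Inl i) \<in> range (case_sum f g)" "case_sum f g (Inr j) \<in> range (case_sum f g)"
    for i j by (rule rangeI)+
  then show ?thesis by (auto split: sum.splits)
qed

lemma elts_mk_countable:
  assumes "countable A"
  shows "elts (mk A) = A"
proof -
  obtain g :: "nat \<Rightarrow> 'a hset" where "A \<subseteq> range g"
    using assms by (metis empty_subsetI range_from_nat_into subset_refl)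
  then have "A \<subseteq> range (case_sum g (\<lambda>_. g 0))" by (auto simp: range_case_sum)
  then show ?thesis by (rule elts_mk)
qed

lemma elts_mk_finite: "finite A \<Longrightarrow> elts (mk A) = A"
  by (rule elts_mk_countable[OF countable_finite])


section \<open>Ordered pairs, functions, natural numbers\<close>

definition opair :: "'k hset \<Rightarrow> 'k hset \<Rightarrow> 'k hset" where
  "opair x y = mk {mk {x}, mk {x, y}}"

lemma opair_inject [simp]: "opair x y = opair x' y' \<longleftrightarrow> x = x' \<and> y = y'"
proof
  assume "opair x y = opair x' y'"
  then have "{mk {x}, mk {x, y}} = {mk {x'}, mk {x', y'}}"
    unfolding opair_def by (metis elts_mk_finite finite.emptyI finite.insertI)
  then have "elts ` {mk {x}, mk {x, y}} = elts ` {mk {x'}, mk {x', y'}}" by (rule arg_cong)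
  then have "{{x}, {x, y}} = {{x'}, {x', y'}}" by (simp add: elts_mk_finite)
  then show "x = x' \<and> y = y'" by (auto simp: doubleton_eq_iff)
qed simp

definition osnd :: "'k hset \<Rightarrow> 'k hset" where
  "osnd z = (THE y. \<exists>x. z = opair x y)"

lemma osnd_opair [simp]: "osnd (opair x y) = y"
  by (auto simp: osnd_def)

definition fdom :: "'k hset \<Rightarrow> 'k hset set" where
  "fdom f = {x. \<exists>y. opair x y \<in> elts f}"

definition app :: "'k hset \<Rightarrow> 'k hset \<Rightarrow> 'k hset" where
  "app f x = (THE y. opair x y \<in> elts f)"

definition is_fun :: "'k hset \<Rightarrow> bool" where
  "is_fun f \<longleftrightarrow> (\<forall>z\<in>elts f. \<exists>x y. z = opair x y)
     \<and> (\<forall>x y y'. opair x y \<in> elts f \<longrightarrow> opair x y' \<in> elts f \<longrightarrow> y = y')"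

primrec von :: "nat \<Rightarrow> 'k hset" where
  "von 0 = mk {}"
| "von (Suc n) = mk (insert (von n) (elts (von n)))"

lemma elts_von: "elts (von n) = von ` {..<n}"
  by (induction n) (simp_all add: elts_mk_finite lessThan_Suc)

lemma von_inject [simp]: "von m = von n \<longleftrightarrow> m = n"
proof -
  have irrefl: "x \<notin> elts x" for x :: "'a hset"
    using wf_not_refl[OF wf_elts, of x] by simp
  have "(von m :: 'a hset) \<noteq> von n" if "m < n" for m n
  proof
    assume "von m = (von n :: 'a hset)"
    moreover have "von m \<in> elts (von n :: 'a hset)" using that by (simp add: elts_von)
    ultimately show False using irrefl[of "von n"] by simp
  qed
  then show ?thesis by (metis linorder_neqE_nat)
qed

definition omega :: "'k hset" where
  "omega = mk (range von)"

lemma elts_omega: "elts omega = range von"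
  unfolding omega_def
  by (rule elts_mk[where f = "case_sum von (\<lambda>_. von 0)"]) (simp only: range_case_sum Un_upper1)

definition ordinal :: "'k hset \<Rightarrow> bool" where
  "ordinal x \<longleftrightarrow> (\<forall>y\<in>elts x. elts y \<subseteq> elts x \<and> (\<forall>z\<in>elts y. elts z \<subseteq> elts y))"

text \<open>The finite sequence \<open>xs\<close> as a function on its length.\<close>

definition seq :: "'k hset list \<Rightarrow> 'k hset" where
  "seq xs = mk {opair (von i) (xs ! i) | i. i < length xs}"

lemma elts_seq: "elts (seq xs) = {opair (von i) (xs ! i) | i. i < length xs}"
  unfolding seq_def by (rule elts_mk_finite) simp

lemma seq_inject [simp]: "seq xs = seq ys \<longleftrightarrow> xs = ys"
proof
  assume "seq xs = seq ys"
  then have *: "{opair (von i) (xs ! i) | i. i < length xs} =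
      {opair (von i) (ys ! i) | i. i < length ys}" (is "?A = ?B")
    by (metis elts_seq)
  have 1: "i < length ys \<and> xs ! i = ys ! i" if "i < length xs" for i
  proof -
    have "opair (von i) (xs ! i) \<in> ?B" using that by (subst *[symmetric]) blast
    then show ?thesis by auto
  qed
  have 2: "i < length xs" if "i < length ys" for i
  proof -
    have "opair (von i) (ys ! i) \<in> ?A" using that by (subst *) blast
    then show ?thesis by auto
  qed
  have "\<not> length xs < length ys" "\<not> length ys < length xs"
    using 1[of "length ys"] 2[of "length xs"] by auto
  then show "xs = ys" using 1 by (intro nth_equalityI) auto
qed simp


section \<open>Transitive models of ZFC\<close>

text \<open>First-order formulas in the language of set theory, with de Bruijn indices.\<close>

datatype fm = FMem nat nat | FEq nat nat | FNot fm | FAnd fm fm | FAll fm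

primrec sat :: "'k hset set \<Rightarrow> (nat \<Rightarrow> 'k hset) \<Rightarrow> fm \<Rightarrow> bool" where
  "sat V e (FMem i j) \<longleftrightarrow> e i \<in> elts (e j)"
| "sat V e (FEq i j) \<longleftrightarrow> e i = e j"
| "sat V e (FNot p) \<longleftrightarrow> \<not> sat V e p"
| "sat V e (FAnd p q) \<longleftrightarrow> sat V e p \<and> sat V e q"
| "sat V e (FAll p) \<longleftrightarrow> (\<forall>x\<in>V. sat V (case_nat x e) p)"

text \<open>
  Each axiom is given by its relativization to \<open>V\<close>, that is, by what its satisfaction in
  \<open>(V, \<in>)\<close> unfolds to.  The schemas range over all formulas; the environment \<open>e\<close> supplies
  the parameters.
\<close>

definition ax_extensionality :: "'k hset set \<Rightarrow> bool" where
  "ax_extensionality V \<longleftrightarrow>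
    (\<forall>x\<in>V. \<forall>y\<in>V. (\<forall>z\<in>V. z \<in> elts x \<longleftrightarrow> z \<in> elts y) \<longrightarrow> x = y)"

definition ax_foundation :: "'k hset set \<Rightarrow> bool" where
  "ax_foundation V \<longleftrightarrow>
    (\<forall>x\<in>V. (\<exists>y\<in>V. y \<in> elts x) \<longrightarrow>
       (\<exists>y\<in>V. y \<in> elts x \<and> \<not> (\<exists>z\<in>V. z \<in> elts x \<and> z \<in> elts y)))"

definition ax_pairing :: "'k hset set \<Rightarrow> bool" where
  "ax_pairing V \<longleftrightarrow>
    (\<forall>x\<in>V. \<forall>y\<in>V. \<exists>z\<in>V. \<forall>w\<in>V. w \<in> elts z \<longleftrightarrow> w = x \<or> w = y)"

definition ax_union :: "'k hset set \<Rightarrow> bool" where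
  "ax_union V \<longleftrightarrow>
    (\<forall>x\<in>V. \<exists>u\<in>V. \<forall>z\<in>V. z \<in> elts u \<longleftrightarrow> (\<exists>y\<in>V. y \<in> elts x \<and> z \<in> elts y))"

definition ax_power_set :: "'k hset set \<Rightarrow> bool" where
  "ax_power_set V \<longleftrightarrow>
    (\<forall>x\<in>V. \<exists>p\<in>V. \<forall>y\<in>V. y \<in> elts p \<longleftrightarrow> (\<forall>z\<in>V. z \<in> elts y \<longrightarrow> z \<in> elts x))"

definition ax_infinity :: "'k hset set \<Rightarrow> bool" where
  "ax_infinity V \<longleftrightarrow>
    (\<exists>x\<in>V. (\<exists>y\<in>V. y \<in> elts x \<and> \<not> (\<exists>z\<in>V. z \<in> elts y)) \<and>
       (\<forall>y\<in>V. y \<in> elts x \<longrightarrow>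
         (\<exists>s\<in>V. s \<in> elts x \<and> (\<forall>w\<in>V. w \<in> elts s \<longleftrightarrow> w \<in> elts y \<or> w = y))))"

definition ax_separation :: "'k hset set \<Rightarrow> bool" where
  "ax_separation V \<longleftrightarrow>
    (\<forall>p e. range e \<subseteq> V \<longrightarrow>
       (\<forall>a\<in>V. \<exists>b\<in>V. \<forall>x\<in>V. x \<in> elts b \<longleftrightarrow> x \<in> elts a \<and> sat V (case_nat x e) p))"

definition ax_replacement :: "'k hset set \<Rightarrow> bool" where
  "ax_replacement V \<longleftrightarrow>
    (\<forall>p e. range e \<subseteq> V \<longrightarrow>
       (\<forall>a\<in>V. (\<forall>x\<in>V. x \<in> elts a \<longrightarrow>
             (\<exists>!y. y \<in> V \<and> sat V (case_nat x (case_nat y e)) p)) \<longrightarrow>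
          (\<exists>b\<in>V. \<forall>y\<in>V. y \<in> elts b \<longleftrightarrow>
             (\<exists>x\<in>V. x \<in> elts a \<and> sat V (case_nat x (case_nat y e)) p))))"

definition ax_choice :: "'k hset set \<Rightarrow> bool" where
  "ax_choice V \<longleftrightarrow>
    (\<forall>a\<in>V. (\<forall>x\<in>V. x \<in> elts a \<longrightarrow> (\<exists>z\<in>V. z \<in> elts x)) \<and>
        (\<forall>x\<in>V. \<forall>y\<in>V. x \<in> elts a \<longrightarrow> y \<in> elts a \<longrightarrow> x \<noteq> y \<longrightarrow>
           \<not> (\<exists>z\<in>V. z \<in> elts x \<and> z \<in> elts y)) \<longrightarrow>
       (\<exists>c\<in>V. \<forall>x\<in>V. x \<in> elts a \<longrightarrow> (\<exists>!z. z \<in> V \<and> z \<in> elts x \<and> z \<in> elts c)))"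

definition ZFC_model :: "'k hset set \<Rightarrow> bool" where
  "ZFC_model V \<longleftrightarrow> ax_extensionality V \<and> ax_foundation V \<and> ax_pairing V \<and> ax_union V \<and>
     ax_power_set V \<and> ax_infinity V \<and> ax_separation V \<and> ax_replacement V \<and> ax_choice V"

definition transitive_model :: "'k hset set \<Rightarrow> bool" where
  "transitive_model V \<longleftrightarrow> (\<forall>x\<in>V. elts x \<subseteq> V) \<and> ZFC_model V"


section \<open>Generic filters and generic extensions\<close>

text \<open>\<open>le p q\<close> says that \<open>p\<close> is stronger than \<open>q\<close>.\<close>

definition dense_in :: "'k hset set \<Rightarrow> ('k hset \<Rightarrow> 'k hset \<Rightarrow> bool) \<Rightarrow> 'k hset set \<Rightarrow> bool" where
  "dense_in P le D \<longleftrightarrow> D \<subseteq> P \<and> (\<forall>p\<in>P. \<exists>d\<in>D. le d p)"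

definition filter_on :: "'k hset set \<Rightarrow> ('k hset \<Rightarrow> 'k hset \<Rightarrow> bool) \<Rightarrow> 'k hset set \<Rightarrow> bool" where
  "filter_on P le G \<longleftrightarrow> G \<subseteq> P \<and> G \<noteq> {}
     \<and> (\<forall>p\<in>G. \<forall>q\<in>P. le p q \<longrightarrow> q \<in> G)
     \<and> (\<forall>p\<in>G. \<forall>q\<in>G. \<exists>r\<in>G. le r p \<and> le r q)"

definition generic_filter ::
  "'k hset set \<Rightarrow> 'k hset set \<Rightarrow> ('k hset \<Rightarrow> 'k hset \<Rightarrow> bool) \<Rightarrow> 'k hset set \<Rightarrow> bool" where
  "generic_filter V P le G \<longleftrightarrow> filter_on P le G
     \<and> (\<forall>D\<in>V. dense_in P le (elts D) \<longrightarrow> G \<inter> elts D \<noteq> {})"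

inductive name :: "'k hset set \<Rightarrow> 'k hset \<Rightarrow> bool" for P where
  "(\<forall>z\<in>elts t. \<exists>s p. z = opair s p \<and> p \<in> P \<and> name P s) \<Longrightarrow> name P t"

lemma opair_trancl:
  "opair x y \<in> elts z \<Longrightarrow> (x, z) \<in> {(x, y). x \<in> elts y}\<^sup>+"
  "(y, opair x y) \<in> {(x, y). x \<in> elts y}\<^sup>+"
proof -
  let ?r = "{(x, y). x \<in> elts y} :: ('a hset \<times> 'a hset) set"
  have 1: "(x, mk {x}) \<in> ?r" "(mk {x}, opair x y) \<in> ?r"
    "(y, mk {x, y}) \<in> ?r" "(mk {x, y}, opair x y) \<in> ?r"
    by (simp_all add: opair_def elts_mk_finite)
  show "(y, opair x y) \<in> ?r\<^sup>+"
    by (rule trancl_into_trancl[OF r_into_trancl[OF 1(3)] 1(4)])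
  assume "opair x y \<in> elts z"
  then have "(opair x y, z) \<in> ?r" by simp
  then show "(x, z) \<in> ?r\<^sup>+"
    by (rule trancl_into_trancl[OF trancl_into_trancl[OF r_into_trancl[OF 1(1)] 1(2)]])
qed

lemma opair_trancl_elts:
  assumes "x \<in> elts y"
  shows "(x, opair z y) \<in> {(x, y). x \<in> elts y}\<^sup>+"
proof -
  have "(x, y) \<in> {(x, y). x \<in> elts y}" using assms by simp
  then show ?thesis by (rule trancl_into_trancl2) (rule opair_trancl(2))
qed

function val :: "'k hset set \<Rightarrow> 'k hset \<Rightarrow> 'k hset" where
  "val G t = mk (val G ` {s. \<exists>p\<in>G. opair s p \<in> elts t})"
  by pat_completeness auto
termination
proof (relation "inv_image ({(x, y). x \<in> elts y}\<^sup>+) snd", goal_cases)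
  case 1
  show ?case by (intro wf_inv_image wf_trancl wf_elts)
next
  case (2 G t s)
  then obtain p where "opair s p \<in> elts t" by blast
  then show ?case by (simp add: opair_trancl(1))
qed

declare val.simps [simp del]

text \<open>The collection of which \<open>val G t\<close> is formed is small enough to be a set.\<close>

lemma elts_val: "elts (val G t) = val G ` {s. \<exists>p\<in>G. opair s p \<in> elts t}"
proof -
  obtain f :: "nat + 'a \<Rightarrow> 'a hset" where f: "elts t \<subseteq> range f" by (rule elts_small)
  let ?g = "\<lambda>i. val G (SOME s. \<exists>p. f i = opair s p)"
  have "val G ` {s. \<exists>p\<in>G. opair s p \<in> elts t} \<subseteq> range ?g"
  proof
    fix z assume "z \<in> val G ` {s. \<exists>p\<in>G. opair s p \<in> elts t}"
    then obtain s p where z: "z = val G s" and "opair s p \<in> elts t" by blast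
    with f obtain i where i: "opair s p = f i" by blast
    have "(SOME s. \<exists>p. f i = opair s p) = s"
      unfolding i[symmetric] by simp
    then have "z = ?g i" using z by simp
    then show "z \<in> range ?g" by (rule range_eqI)
  qed
  then show ?thesis by (subst val.simps) (rule elts_mk)
qed

definition generic_extension :: "'k hset set \<Rightarrow> 'k hset set \<Rightarrow> 'k hset set \<Rightarrow> 'k hset set" where
  "generic_extension V P G = {val G t | t. t \<in> V \<and> name P t}"


section \<open>Structures and literals\<close>

text \<open>
  A relational language is a function from its relation symbols to arities in \<open>\<omega>\<close>.
  A structure on \<open>X\<close> is a pair of \<open>X\<close> and a function sending each \<open>n\<close>-ary relation symbol to
  a subset of \<open>X\<^sup>n\<close>.
\<close>

definition relational_language :: "'k hset \<Rightarrow> bool" where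
  "relational_language L \<longleftrightarrow> is_fun L \<and> (\<forall>R\<in>fdom L. app L R \<in> elts omega)"

definition Str :: "'k hset set \<Rightarrow> 'k hset \<Rightarrow> 'k hset \<Rightarrow> 'k hset set" where
  "Str W L X = {M \<in> W. \<exists>I. M = opair X I \<and> is_fun I \<and> fdom I = fdom L \<and>
     (\<forall>R n. opair R (von n) \<in> elts L \<longrightarrow>
        elts (app I R) \<subseteq> {seq xs | xs. length xs = n \<and> set xs \<subseteq> elts X})}"

text \<open>Variables are natural numbers.\<close>

datatype 'k literal = Rel "'k hset" "nat list" | Equal nat nat | Neg "'k literal"

primrec literal_in :: "'k hset \<Rightarrow> 'k literal \<Rightarrow> bool" where
  "literal_in L (Rel R vs) \<longleftrightarrow> opair R (von (length vs)) \<in> elts L"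
| "literal_in L (Equal i j) \<longleftrightarrow> True"
| "literal_in L (Neg l) \<longleftrightarrow> literal_in L l"

primrec vars :: "'k literal \<Rightarrow> nat set" where
  "vars (Rel R vs) = set vs"
| "vars (Equal i j) = {i, j}"
| "vars (Neg l) = vars l"

primrec literal_sat :: "'k hset \<Rightarrow> 'k hset list \<Rightarrow> 'k literal \<Rightarrow> bool" where
  "literal_sat M xs (Rel R vs) \<longleftrightarrow> seq (map (\<lambda>v. xs ! v) vs) \<in> elts (app (osnd M) R)"
| "literal_sat M xs (Equal i j) \<longleftrightarrow> xs ! i = xs ! j"
| "literal_sat M xs (Neg l) \<longleftrightarrow> \<not> literal_sat M xs l"

primrec literal_code :: "'k literal \<Rightarrow> 'k hset" where
  "literal_code (Rel R vs) = opair (von 0) (opair R (seq (map von vs)))"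
| "literal_code (Equal i j) = opair (von 1) (opair (von i) (von j))"
| "literal_code (Neg l) = opair (von 2) (literal_code l)"

lemma literal_code_inject [simp]: "literal_code l = literal_code l' \<longleftrightarrow> l = l'"
proof (induction l arbitrary: l')
  case (Rel R vs)
  have "map von vs = (map von vs' :: 'a hset list) \<longleftrightarrow> vs = vs'" for vs'
    by (rule inj_map_eq_map) (simp add: inj_def)
  then show ?case by (cases l') (auto simp del: von.simps)
next
  case (Equal i j)
  show ?case by (cases l') (auto simp del: von.simps)
next
  case (Neg l)
  then show ?case by (cases l') (auto simp del: von.simps)
qed

text \<open>
  A finite conjunction of literals is a list of literals.  Its arity is the least \<open>n\<close> such that all
  its variables are among the first \<open>n\<close>; a tuple of that length instantiates them.
\<close>

definition arity :: "'k literal list \<Rightarrow> nat" where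
  "arity \<phi> = (LEAST n. \<forall>l\<in>set \<phi>. \<forall>v\<in>vars l. v < n)"

definition conj_instance ::
  "'k hset \<Rightarrow> 'k hset \<Rightarrow> 'k literal list \<Rightarrow> 'k hset list \<Rightarrow> bool" where
  "conj_instance L X \<phi> xs \<longleftrightarrow>
     (\<forall>l\<in>set \<phi>. literal_in L l) \<and> length xs = arity \<phi> \<and> set xs \<subseteq> elts X"

definition conj_sat :: "'k hset \<Rightarrow> 'k hset list \<Rightarrow> 'k literal list \<Rightarrow> bool" where
  "conj_sat M xs \<phi> \<longleftrightarrow> (\<forall>l\<in>set \<phi>. literal_sat M xs l)"


section \<open>Measurable sets and probability measures, relative to a model\<close>

text \<open>\<open>|C| \<le> \<kappa>\<close> in the sense of \<open>V\<close>.\<close>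

definition card_le :: "'k hset set \<Rightarrow> 'k hset \<Rightarrow> 'k hset \<Rightarrow> bool" where
  "card_le V C \<kappa> \<longleftrightarrow> (\<exists>f\<in>V. is_fun f \<and> fdom f = elts C
     \<and> app f ` elts C \<subseteq> elts \<kappa> \<and> inj_on (app f) (elts C))"

text \<open>
  The \<open>\<kappa>\<close>-algebra of measurable sets, computed in \<open>V\<close>: unions are taken over families that belong
  to \<open>V\<close> and have size at most \<open>\<kappa>\<close> there.  Here and for \<open>borel_codes\<close>, the least collection
  closed under the operations as computed in \<open>V\<close> is the same as the least such set in \<open>V\<close>, because
  codes are well-founded and \<open>V\<close> is a transitive model of ZFC.
\<close>

inductive_set sigma_alg :: "'k hset set \<Rightarrow> 'k hset \<Rightarrow> 'k hset \<Rightarrow> 'k hset \<Rightarrow> 'k hset set"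
  for V \<kappa> L X where
  basic: "conj_instance L X [l] xs \<Longrightarrow>
    mk {M \<in> Str V L X. literal_sat M xs l} \<in> sigma_alg V \<kappa> L X"
| compl: "A \<in> sigma_alg V \<kappa> L X \<Longrightarrow> mk (Str V L X - elts A) \<in> sigma_alg V \<kappa> L X"
| union: "\<lbrakk>C \<in> V; card_le V C \<kappa>; \<forall>A\<in>elts C. A \<in> sigma_alg V \<kappa> L X\<rbrakk> \<Longrightarrow>
    mk (\<Union> (elts ` elts C)) \<in> sigma_alg V \<kappa> L X"

text \<open>A nonnegative real number as a set: its left Dedekind cut of fractions \<open>m / n\<close>.\<close>

definition real_code :: "real \<Rightarrow> 'k hset" where
  "real_code r = mk {opair (von m) (von n) | m n. 0 < n \<and> real m / real n < r}"

lemma elts_real_code: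
  "elts (real_code r) = {opair (von m) (von n) | m n. 0 < n \<and> real m / real n < r}"
  unfolding real_code_def
proof (rule elts_mk_countable)
  have "{opair (von m) (von n) | m n. 0 < n \<and> real m / real n < r}
      \<subseteq> (\<lambda>(m, n). opair (von m) (von n)) ` UNIV" by auto
  then show "countable {opair (von m) (von n) | m n. 0 < n \<and> real m / real n < r}"
    by (rule countable_subset) simp
qed

lemma real_code_inject:
  assumes "0 \<le> r" "0 \<le> s"
  shows "real_code r = real_code s \<longleftrightarrow> r = s"
proof -
  have "real_code u \<noteq> real_code v" if "0 \<le> u" "u < v" for u v
  proof -
    obtain q where q: "q \<in> \<rat>" "u < q" "q < v" using Rats_dense_in_real[OF \<open>u < v\<close>] by blast
    then obtain m n where n: "n \<noteq> 0" "\<bar>q\<bar> = real m / real n"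
      by (auto elim: Rats_abs_nat_div_natE)
    then have "opair (von m) (von n) \<in> elts (real_code v)"
      "opair (von m) (von n) \<notin> elts (real_code u)"
      using q that by (auto simp: elts_real_code)
    then show ?thesis by metis
  qed
  then show ?thesis using assms by (metis linorder_neqE)
qed

definition measure_of_set :: "'k hset \<Rightarrow> 'k hset set \<Rightarrow> real" where
  "measure_of_set \<mu> A = (THE r. 0 \<le> r \<and> app \<mu> (mk A) = real_code r)"

definition model_additive ::
  "'k hset set \<Rightarrow> 'k hset set \<Rightarrow> 'k hset \<Rightarrow> 'k hset \<Rightarrow> bool" where
  "model_additive V S J \<mu> \<longleftrightarrow>
    (\<forall>A\<in>V. is_fun A \<and> fdom A = elts J \<and> (\<forall>i\<in>elts J. app A i \<in> S) \<and>
        disjoint_family_on (\<lambda>i. elts (app A i)) (elts J) \<longrightarrow>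
      ((\<lambda>i. measure_of_set \<mu> (elts (app A i))) has_sum
         measure_of_set \<mu> (\<Union>i\<in>elts J. elts (app A i))) (elts J))"

definition prob_kappa_measure ::
  "'k hset set \<Rightarrow> 'k hset \<Rightarrow> 'k hset \<Rightarrow> 'k hset \<Rightarrow> 'k hset \<Rightarrow> bool" where
  "prob_kappa_measure V \<kappa> L X \<mu> \<longleftrightarrow>
     is_fun \<mu> \<and> fdom \<mu> = sigma_alg V \<kappa> L X \<and>
     (\<forall>A\<in>sigma_alg V \<kappa> L X. \<exists>r. 0 \<le> r \<and> r \<le> 1 \<and> app \<mu> A = real_code r) \<and>
     measure_of_set \<mu> {} = 0 \<and> measure_of_set \<mu> (Str V L X) = 1 \<and>
     model_additive V (sigma_alg V \<kappa> L X) omega \<mu> \<and>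
     model_additive V (sigma_alg V \<kappa> L X) \<kappa> \<mu>"


section \<open>Borel codes\<close>

definition code_basic :: "'k literal list \<Rightarrow> 'k hset list \<Rightarrow> 'k hset" where
  "code_basic \<phi> xs = opair (von 0) (opair (seq (map literal_code \<phi>)) (seq xs))"

definition code_neg :: "'k hset \<Rightarrow> 'k hset" where
  "code_neg \<gamma> = opair (von 1) \<gamma>"

definition code_join :: "'k hset \<Rightarrow> 'k hset" where
  "code_join \<Gamma> = opair (von 2) \<Gamma>"

definition code_meet :: "'k hset \<Rightarrow> 'k hset" where
  "code_meet \<Gamma> = opair (von 3) \<Gamma>"

text \<open>\<open>\<Gamma> = {\<gamma>\<^sub>i}\<^sub>i\<^sub>\<in>\<^sub>\<kappa>\<close> for some enumeration in \<open>V\<close>.\<close>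

definition indexed_by :: "'k hset set \<Rightarrow> 'k hset \<Rightarrow> 'k hset \<Rightarrow> bool" where
  "indexed_by V \<kappa> \<Gamma> \<longleftrightarrow>
     (\<exists>f\<in>V. is_fun f \<and> fdom f = elts \<kappa> \<and> app f ` elts \<kappa> = elts \<Gamma>)"

definition basic_codes :: "'k hset set \<Rightarrow> 'k hset \<Rightarrow> 'k hset \<Rightarrow> 'k hset set" where
  "basic_codes V L X = {code_basic \<phi> xs | \<phi> xs. conj_instance L X \<phi> xs} \<inter> V"

inductive_set borel_codes :: "'k hset set \<Rightarrow> 'k hset \<Rightarrow> 'k hset \<Rightarrow> 'k hset \<Rightarrow> 'k hset set"
  for V \<kappa> L X where
  basic: "\<gamma> \<in> basic_codes V L X \<Longrightarrow> \<gamma> \<in> borel_codes V \<kappa> L X"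
| neg: "\<gamma> \<in> borel_codes V \<kappa> L X \<Longrightarrow> code_neg \<gamma> \<in> borel_codes V \<kappa> L X"
| join: "\<lbrakk>\<Gamma> \<in> V; indexed_by V \<kappa> \<Gamma>; \<forall>\<gamma>\<in>elts \<Gamma>. \<gamma> \<in> borel_codes V \<kappa> L X\<rbrakk> \<Longrightarrow>
    code_join \<Gamma> \<in> borel_codes V \<kappa> L X"
| meet: "\<lbrakk>\<Gamma> \<in> V; indexed_by V \<kappa> \<Gamma>; \<forall>\<gamma>\<in>elts \<Gamma>. \<gamma> \<in> borel_codes V \<kappa> L X\<rbrakk> \<Longrightarrow>
    code_meet \<Gamma> \<in> borel_codes V \<kappa> L X"

text \<open>
  The interpretation of a code in a transitive model \<open>W\<close>, by recursion on the code; see the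
  equations \<open>interp_basic\<close>, \<open>interp_neg\<close>, \<open>interp_join\<close>, \<open>interp_meet\<close> below.
\<close>

function interp :: "'k hset set \<Rightarrow> 'k hset \<Rightarrow> 'k hset \<Rightarrow> 'k hset \<Rightarrow> 'k hset set" where
  "interp W L X \<gamma> =
    (if \<exists>\<delta>. \<gamma> = code_neg \<delta> then Str W L X - interp W L X (osnd \<gamma>)
     else if \<exists>\<Gamma>. \<gamma> = code_join \<Gamma> then \<Union> (interp W L X ` elts (osnd \<gamma>))
     else if \<exists>\<Gamma>. \<gamma> = code_meet \<Gamma> then Str W L X \<inter> \<Inter> (interp W L X ` elts (osnd \<gamma>))
     else {M \<in> Str W L X. \<exists>\<phi> xs. \<gamma> = code_basic \<phi> xs \<and> conj_sat M xs \<phi>})"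
  by pat_completeness auto
termination
proof (relation "inv_image ({(x, y). x \<in> elts y}\<^sup>+) (\<lambda>(_, _, _, \<gamma>). \<gamma>)", goal_cases)
  case 1
  show ?case by (intro wf_inv_image wf_trancl wf_elts)
next
  case (2 W L X \<gamma>)
  then obtain \<delta> where "\<gamma> = code_neg \<delta>" by blast
  then show ?case by (simp add: code_neg_def opair_trancl(2) del: von.simps)
next
  case (3 W L X \<gamma> \<delta>)
  then obtain \<Gamma> where "\<gamma> = code_join \<Gamma>" by blast
  with 3 show ?case by (simp add: code_join_def opair_trancl_elts del: von.simps)
next
  case (4 W L X \<gamma> \<delta>)
  then obtain \<Gamma> where "\<gamma> = code_meet \<Gamma>" by blast
  with 4 show ?case by (simp add: code_meet_def opair_trancl_elts del: von.simps)
qed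

declare interp.simps [simp del]

lemmas code_defs = code_basic_def code_neg_def code_join_def code_meet_def

lemma code_basic_inject: "code_basic \<phi> xs = code_basic \<psi> ys \<longleftrightarrow> \<phi> = \<psi> \<and> xs = ys"
proof -
  have "inj (literal_code :: 'a literal \<Rightarrow> 'a hset)" by (simp add: inj_def)
  then show ?thesis by (simp add: code_basic_def inj_map_eq_map)
qed

lemma interp_basic: "interp W L X (code_basic \<phi> xs) = {M \<in> Str W L X. conj_sat M xs \<phi>}"
proof -
  have "code_basic \<phi> xs \<noteq> code_neg \<delta>" "code_basic \<phi> xs \<noteq> code_join \<delta>"
    "code_basic \<phi> xs \<noteq> code_meet \<delta>" for \<delta>
    by (simp_all add: code_defs del: von.simps)
  then show ?thesis by (subst interp.simps) (auto simp: code_basic_inject)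
qed

lemma interp_neg: "interp W L X (code_neg \<gamma>) = Str W L X - interp W L X \<gamma>"
  by (subst interp.simps) (simp add: code_defs del: von.simps)

lemma interp_join: "interp W L X (code_join \<Gamma>) = (\<Union>\<gamma>\<in>elts \<Gamma>. interp W L X \<gamma>)"
  by (subst interp.simps) (simp add: code_defs del: von.simps)

lemma interp_meet:
  "interp W L X (code_meet \<Gamma>) = Str W L X \<inter> (\<Inter>\<gamma>\<in>elts \<Gamma>. interp W L X \<gamma>)"
  by (subst interp.simps) (simp add: code_defs del: von.simps)


section \<open>Random forcing\<close>

definition code_measure :: "'k hset set \<Rightarrow> 'k hset \<Rightarrow> 'k hset \<Rightarrow> 'k hset \<Rightarrow> 'k hset \<Rightarrow> real" where
  "code_measure V L X \<mu> \<gamma> = measure_of_set \<mu> (interp V L X \<gamma>)"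

definition forcing_le ::
  "'k hset set \<Rightarrow> 'k hset \<Rightarrow> 'k hset \<Rightarrow> 'k hset \<Rightarrow> 'k hset \<Rightarrow> 'k hset \<Rightarrow> bool" where
  "forcing_le V L X \<mu> \<gamma> \<zeta> \<longleftrightarrow> code_measure V L X \<mu> (code_meet (mk {\<gamma>, code_neg \<zeta>})) = 0"

definition O_plus ::
  "'k hset set \<Rightarrow> 'k hset \<Rightarrow> 'k hset \<Rightarrow> 'k hset \<Rightarrow> 'k hset \<Rightarrow> 'k hset set" where
  "O_plus V \<kappa> L X \<mu> = {\<gamma> \<in> borel_codes V \<kappa> L X. code_measure V L X \<mu> \<gamma> > 0}"

definition random_generic ::
  "'k hset set \<Rightarrow> 'k hset \<Rightarrow> 'k hset \<Rightarrow> 'k hset \<Rightarrow> 'k hset \<Rightarrow> 'k hset set \<Rightarrow> bool" where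
  "random_generic V \<kappa> L X \<mu> G \<longleftrightarrow>
     generic_filter V (O_plus V \<kappa> L X \<mu>) (forcing_le V L X \<mu>) G"

definition random_extension ::
  "'k hset set \<Rightarrow> 'k hset \<Rightarrow> 'k hset \<Rightarrow> 'k hset \<Rightarrow> 'k hset \<Rightarrow> 'k hset set \<Rightarrow> 'k hset set" where
  "random_extension V \<kappa> L X \<mu> G = generic_extension V (O_plus V \<kappa> L X \<mu>) G"

end

theory Submission
  imports Defs
begin

text \<open>
  No forcing theorem is needed, because the generic structure is read off from \<open>G\<close>: a tuple belongs
  to a relation of \<open>M\<^sub>G\<close> iff the corresponding atomic code belongs to \<open>G\<close>.  By genericity, \<open>G\<close>
  contains exactly one of \<open>\<gamma>\<close> and its negation, and a join (meet) of \<open>\<Gamma>\<close> iff it contains some (every)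
  member of \<open>\<Gamma>\<close>, since \<open>\<kappa>\<close>-additivity makes a \<open>\<kappa>\<close>-union of null sets null.  Induction on codes
  then gives that \<open>M\<^sub>G\<close> belongs to the interpretation of \<open>\<gamma>\<close> iff \<open>\<gamma>\<close> belongs to \<open>G\<close>, and the literals
  in \<open>G\<close> leave no other structure.  What remains is that the dense sets and a name for \<open>M\<^sub>G\<close>
  belong to \<open>V\<close>; this rests on transfinite recursion inside \<open>V\<close>.
\<close>

section \<open>Definability over a transitive model\<close>

text \<open>Separation and replacement in \<open>V\<close> speak about formulas, while codes,
  literals and interpretations are HOL objects. So each set whose membership in \<open>V\<close>
  matters (the set of structures, the dense sets, the name) has to be shown definable. A calculus of
  definable predicates and operations turns this into syntax-directed rule application, and
  recursion on membership is proved once, in a form that takes a function given in HOL and shows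
  that it is definable over \<open>V\<close>. Real numbers stay outside this calculus: sums are
  computed in HOL, and the one fact about values of the measure that is expressed in
  \<open>V\<close> is whether they are 0, that is, whether their Dedekind cut is empty. About the
  generic extension one only has to know that it contains \<open>M_G\<close>: whether
  \<open>M_G\<close> lies in the interpretation of a code is then computed from \<open>G\<close>
  alone.\<close>

lemma elts_mk_subset: "A \<subseteq> elts a \<Longrightarrow> elts (mk A) = A"
  by (metis elts_mk elts_small subset_trans)

lemma elts_mk_image:
  fixes f :: "'k hset \<Rightarrow> 'k hset"
  shows "elts (mk (f ` elts a)) = f ` elts a"
proof -
  obtain g :: "nat + 'k \<Rightarrow> 'k hset" where "elts a \<subseteq> range g" by (rule elts_small)
  then have "f ` elts a \<subseteq> range (\<lambda>i. f (g i))" by auto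
  then show ?thesis by (rule elts_mk)
qed

lemma elts_mk_insert [simp]:
  fixes x :: "'k hset"
  shows "elts (mk (insert x (elts a))) = insert x (elts a)"
proof -
  obtain g :: "nat + 'k \<Rightarrow> 'k hset" where g: "elts a \<subseteq> range g" by (rule elts_small)
  \<comment> \<open>The \<open>nat\<close> summand of the index type makes room: \<open>x\<close>
    takes the index \<open>Inl 0\<close> and the old indices on that side move up by one.\<close>
  define h where "h = case_sum (case_nat x (\<lambda>n. g (Inl n))) (\<lambda>k. g (Inr k))"
  have "insert x (elts a) \<subseteq> range h"
  proof
    fix y assume "y \<in> insert x (elts a)"
    then consider "y = x" | i where "y = g i" using g by auto
    then show "y \<in> range h"
    proof cases
      case 1
      then have "y = h (Inl 0)" by (simp add: h_def)
      then show ?thesis by (rule range_eqI)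
    next
      case 2
      have "g i = h (case i of Inl n \<Rightarrow> Inl (Suc n) | Inr k \<Rightarrow> Inr k)"
        by (simp add: h_def split: sum.split)
      then show ?thesis unfolding 2 by (rule range_eqI)
    qed
  qed
  then show ?thesis by (rule elts_mk)
qed

lemma elts_mk_empty [simp]: "elts (mk {}) = {}"
  by (simp add: elts_mk_finite)

lemma elts_mk_single [simp]: "elts (mk {x}) = {x}"
  by (simp add: elts_mk_finite)

lemma elts_mk_pair [simp]: "elts (mk {x, y}) = {x, y}"
  by (simp add: elts_mk_finite)

lemma hset_eqI: "(\<And>z. z \<in> elts x \<longleftrightarrow> z \<in> elts y) \<Longrightarrow> x = y"
  by (simp add: elts_inject[symmetric] set_eq_iff)

lemma elts_empty_iff: "elts x = {} \<longleftrightarrow> x = mk {}"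
  by (metis elts_mk_empty mk_elts)

section \<open>Renaming of variables in formulas\<close>

primrec ren :: "(nat \<Rightarrow> nat) \<Rightarrow> fm \<Rightarrow> fm" where
  "ren r (FMem i j) = FMem (r i) (r j)"
| "ren r (FEq i j) = FEq (r i) (r j)"
| "ren r (FNot p) = FNot (ren r p)"
| "ren r (FAnd p q) = FAnd (ren r p) (ren r q)"
| "ren r (FAll p) = FAll (ren (case_nat 0 (\<lambda>i. Suc (r i))) p)"

lemma sat_ren: "sat V e (ren r p) \<longleftrightarrow> sat V (\<lambda>i. e (r i)) p"
proof (induction p arbitrary: r e)
  case (FAll p)
  have "(\<lambda>i. (case_nat x e) (case_nat 0 (\<lambda>i. Suc (r i)) i)) = case_nat x (\<lambda>i. e (r i))" for x
    by (auto simp: fun_eq_iff split: nat.split)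
  then show ?case by (simp add: FAll.IH)
qed simp_all

definition inst :: "(nat \<Rightarrow> nat + 'k hset) \<Rightarrow> (nat \<Rightarrow> 'k hset) \<Rightarrow> nat \<Rightarrow> 'k hset" where
  "inst s e i = (case s i of Inl j \<Rightarrow> e j | Inr c \<Rightarrow> c)"

locale set_model =
  fixes V :: "'k hset set"
  assumes transitive_model: "transitive_model V"
begin

abbreviation env :: "(nat \<Rightarrow> 'k hset) \<Rightarrow> bool" where
  "env e \<equiv> (\<forall>i. e i \<in> V)"

text \<open>Definability of predicates (\<open>D\<close>) and operations (\<open>T\<close>) on environments over \<open>V\<close>.
  Parameters from \<open>V\<close> are allowed: \<open>inst s\<close> maps a variable of the formula either to an
  entry of the environment or to a constant.  In \<open>\<lambda>e. \<forall>x\<in>V. Q x e\<close> the body is itself a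
  predicate on environments, namely \<open>\<lambda>e. Q (e 0) (\<lambda>i. e (Suc i))\<close>, so that de Bruijn indices stay
  hidden behind HOL binders.\<close>

definition D :: "((nat \<Rightarrow> 'k hset) \<Rightarrow> bool) \<Rightarrow> bool" where
  "D Q \<longleftrightarrow> (\<exists>p s. (\<forall>i c. s i = Inr c \<longrightarrow> c \<in> V) \<and> (\<forall>e. env e \<longrightarrow> (sat V (inst s e) p \<longleftrightarrow> Q e)))"

definition T :: "((nat \<Rightarrow> 'k hset) \<Rightarrow> 'k hset) \<Rightarrow> bool" where
  "T t \<longleftrightarrow> (\<forall>e. env e \<longrightarrow> t e \<in> V) \<and> D (\<lambda>e. e 0 = t (\<lambda>i. e (Suc i)))"

lemma env_case: "x \<in> V \<Longrightarrow> env e \<Longrightarrow> env (case_nat x e)"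
  by (simp split: nat.split)

lemma D_cong: "(\<And>e. env e \<Longrightarrow> Q e \<longleftrightarrow> Q' e) \<Longrightarrow> D Q' \<Longrightarrow> D Q"
  unfolding D_def by meson

text \<open>The defining formula does not change: the substitution is absorbed by composing the two
  maps from variables to entries or constants.\<close>

lemma D_inst:
  assumes "D Q" "\<And>i c. \<rho> i = Inr c \<Longrightarrow> c \<in> V"
  shows "D (\<lambda>e. Q (inst \<rho> e))"
proof -
  obtain p s where s: "\<And>i c. s i = Inr c \<Longrightarrow> c \<in> V" and
    p: "\<And>e. env e \<Longrightarrow> sat V (inst s e) p \<longleftrightarrow> Q e"
    using assms(1) unfolding D_def by blast
  define s' where "s' = (\<lambda>i. case s i of Inl j \<Rightarrow> \<rho> j | Inr c \<Rightarrow> Inr c)"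
  have "c \<in> V" if "s' i = Inr c" for i c
    using that s assms(2) unfolding s'_def by (auto split: sum.splits)
  moreover have "sat V (inst s' e) p \<longleftrightarrow> Q (inst \<rho> e)" if "env e" for e
  proof -
    have "inst s' e = inst s (inst \<rho> e)" by (auto simp: inst_def s'_def fun_eq_iff split: sum.split)
    moreover have "env (inst \<rho> e)" using that assms(2) by (auto simp: inst_def split: sum.split)
    ultimately show ?thesis using p by simp
  qed
  ultimately show ?thesis unfolding D_def by blast
qed

lemma D_ren: "D Q \<Longrightarrow> D (\<lambda>e. Q (\<lambda>i. e (r i)))"
  using D_inst[of Q "\<lambda>i. Inl (r i)"] by (simp add: inst_def[abs_def])

lemma D_not: assumes "D Q" shows "D (\<lambda>e. \<not> Q e)"
proof -
  obtain p s where "\<forall>i c. s i = Inr c \<longrightarrow> c \<in> V" "\<forall>e. env e \<longrightarrow> (sat V (inst s e) p \<longleftrightarrow> Q e)"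
    using assms unfolding D_def by blast
  then have "\<forall>e. env e \<longrightarrow> (sat V (inst s e) (FNot p) \<longleftrightarrow> \<not> Q e)" by simp
  with \<open>\<forall>i c. s i = Inr c \<longrightarrow> c \<in> V\<close> show ?thesis unfolding D_def by blast
qed

lemma D_and: assumes "D Q" "D R" shows "D (\<lambda>e. Q e \<and> R e)"
proof -
  obtain p s where s: "\<And>i c. s i = Inr c \<Longrightarrow> c \<in> V" and
    p: "\<And>e. env e \<Longrightarrow> sat V (inst s e) p \<longleftrightarrow> Q e"
    using assms(1) unfolding D_def by blast
  obtain q t where t: "\<And>i c. t i = Inr c \<Longrightarrow> c \<in> V" and
    q: "\<And>e. env e \<Longrightarrow> sat V (inst t e) q \<longleftrightarrow> R e"
    using assms(2) unfolding D_def by blast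
  \<comment> \<open>The two formulas come with unrelated assignments of their variables; even
    variables now serve the first formula and odd ones the second.\<close>
  define u where "u = (\<lambda>i. if even i then s (i div 2) else t (i div 2))"
  have "(\<lambda>i. inst u e (2 * i)) = inst s e" "(\<lambda>i. inst u e (2 * i + 1)) = inst t e" for e
    by (auto simp: inst_def u_def fun_eq_iff)
  then have "\<forall>e. env e \<longrightarrow>
    (sat V (inst u e) (FAnd (ren (\<lambda>i. 2 * i) p) (ren (\<lambda>i. 2 * i + 1) q)) \<longleftrightarrow> Q e \<and> R e)"
    using p q by (simp add: sat_ren)
  moreover have "\<forall>i c. u i = Inr c \<longrightarrow> c \<in> V" using s t by (simp add: u_def)
  ultimately show ?thesis unfolding D_def by blast
qed

text \<open>Brings a definable predicate into the shape required by \<open>FAll\<close> and by the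
  axiom schemas, where the distinguished element is variable 0 and everything else comes from an
  environment.\<close>

lemma D_code1:
  assumes "D Q"
  obtains p s where "\<forall>i c. s i = Inr c \<longrightarrow> c \<in> V"
    "\<forall>x\<in>V. \<forall>e. env e \<longrightarrow> (sat V (case_nat x (inst s e)) p \<longleftrightarrow> Q (case_nat x e))"
proof -
  obtain p s where s: "\<And>i c. s i = Inr c \<Longrightarrow> c \<in> V" and
    p: "\<And>e. env e \<Longrightarrow> sat V (inst s e) p \<longleftrightarrow> Q e"
    using assms unfolding D_def by blast
  \<comment> \<open>Every variable that reads entry 0 becomes variable 0 itself and the others shift
    up. The head of the environment is split off, so entry \<open>j\<close> becomes
    \<open>j - 1\<close>; the truncated value at \<open>j = 0\<close> is never read.\<close>
  define r where "r = (\<lambda>i. if s i = Inl 0 then 0 else Suc i)"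
  define s' where "s' = (\<lambda>i. case s i of Inl j \<Rightarrow> Inl (j - 1) | Inr c \<Rightarrow> Inr c)"
  have "(\<lambda>i. case_nat x (inst s' e) (r i)) = inst s (case_nat x e)" for x e
    by (auto simp: inst_def r_def s'_def fun_eq_iff split: sum.split nat.split)
  then have "sat V (case_nat x (inst s' e)) (ren r p) \<longleftrightarrow> Q (case_nat x e)"
    if "x \<in> V" "env e" for x e
    using p env_case[OF that] by (simp add: sat_ren)
  then have "\<forall>x\<in>V. \<forall>e. env e \<longrightarrow>
      (sat V (case_nat x (inst s' e)) (ren r p) \<longleftrightarrow> Q (case_nat x e))" by blast
  moreover have "\<forall>i c. s' i = Inr c \<longrightarrow> c \<in> V"
    using s unfolding s'_def by (auto split: sum.splits)
  ultimately show thesis by (rule that[rotated])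
qed

lemma D_all_V: assumes "D (\<lambda>e. Q (e 0) (\<lambda>i. e (Suc i)))" shows "D (\<lambda>e. \<forall>x\<in>V. Q x e)"
proof -
  obtain p s where s: "\<forall>i c. s i = Inr c \<longrightarrow> c \<in> V"
    and p: "\<forall>x\<in>V. \<forall>e. env e \<longrightarrow> (sat V (case_nat x (inst s e)) p \<longleftrightarrow> Q x e)"
    by (rule D_code1[OF assms, simplified])
  then have "\<forall>e. env e \<longrightarrow> (sat V (inst s e) (FAll p) \<longleftrightarrow> (\<forall>x\<in>V. Q x e))" by simp
  with s show ?thesis unfolding D_def by blast
qed

lemma D_var_mem: "D (\<lambda>e. e i \<in> elts (e j))"
  unfolding D_def by (rule exI[of _ "FMem i j"], rule exI[of _ Inl]) (simp add: inst_def)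

lemma D_var_eq: "D (\<lambda>e. e i = e j)"
  unfolding D_def by (rule exI[of _ "FEq i j"], rule exI[of _ Inl]) (simp add: inst_def)

lemma D_or: assumes "D Q" "D R" shows "D (\<lambda>e. Q e \<or> R e)"
proof -
  have "D (\<lambda>e. \<not> (\<not> Q e \<and> \<not> R e))" using assms by (intro D_not D_and)
  then show ?thesis by simp
qed

lemma D_imp: assumes "D Q" "D R" shows "D (\<lambda>e. Q e \<longrightarrow> R e)"
proof -
  have "D (\<lambda>e. \<not> (Q e \<and> \<not> R e))" using assms by (intro D_not D_and)
  then show ?thesis by simp
qed

lemma D_iff: assumes "D Q" "D R" shows "D (\<lambda>e. Q e \<longleftrightarrow> R e)"
  unfolding iff_conv_conj_imp using assms by (intro D_and D_imp)

lemma D_True: "D (\<lambda>e. True)"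
  using D_var_eq[of 0 0] by simp

lemma D_const: "D (\<lambda>e. b)"
  using D_True D_not[OF D_True] by (cases b) simp_all

lemma D_ex_V: assumes "D (\<lambda>e. Q (e 0) (\<lambda>i. e (Suc i)))" shows "D (\<lambda>e. \<exists>x\<in>V. Q x e)"
  using D_not[OF D_all_V[where Q = "\<lambda>x e. \<not> Q x e", OF D_not[OF assms]]] by simp

section \<open>Definable operations and substitution\<close>

lemma T_in_V: "T t \<Longrightarrow> env e \<Longrightarrow> t e \<in> V"
  by (simp add: T_def)

lemma T_I: "(\<And>e. env e \<Longrightarrow> t e \<in> V) \<Longrightarrow> D (\<lambda>e. e 0 = t (\<lambda>i. e (Suc i))) \<Longrightarrow> T t"
  by (simp add: T_def)

lemma T_var: "T (\<lambda>e. e i)"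
  by (rule T_I) (simp, rule D_var_eq)

lemma T_const: assumes "c \<in> V" shows "T (\<lambda>e. c)"
proof (rule T_I)
  have "D (\<lambda>e. inst (\<lambda>i. if i = 0 then Inl 0 else Inr c) e 0 = inst (\<lambda>i. if i = 0 then Inl 0 else Inr c) e 1)"
    using assms by (intro D_inst D_var_eq) (simp split: if_splits)
  then show "D (\<lambda>e. e 0 = c)" by (simp add: inst_def)
qed (use assms in simp)

lemma T_ren: "T t \<Longrightarrow> T (\<lambda>e. t (\<lambda>i. e (r i)))"
proof (rule T_I)
  assume "T t"
  then show "t (\<lambda>i. e (r i)) \<in> V" if "env e" for e using that by (simp add: T_in_V)
  have "D (\<lambda>e. e 0 = t (\<lambda>i. e (Suc i)))" using \<open>T t\<close> by (simp add: T_def)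
  from D_ren[OF this, of "case_nat 0 (\<lambda>i. Suc (r i))"]
  show "D (\<lambda>e. e 0 = t (\<lambda>i. e (Suc (r i))))" by simp
qed

text \<open>The operation is replaced by its graph: some \<open>x\<close> in \<open>V\<close> equals
  \<open>t e\<close> and satisfies \<open>Q\<close>. Such an \<open>x\<close> exists because
  \<open>T\<close> includes that values lie in \<open>V\<close>.\<close>

lemma D_subst:
  assumes Q: "D (\<lambda>e. Q (e 0) (\<lambda>i. e (Suc i)))" and t: "T t"
  shows "D (\<lambda>e. Q (t e) e)"
proof -
  have "D (\<lambda>e. \<exists>x\<in>V. x = t e \<and> Q x e)"
    using Q t by (intro D_ex_V D_and) (simp_all add: T_def)
  then show ?thesis by (rule D_cong[rotated]) (simp add: T_in_V[OF t])
qed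

lemma T_subst:
  assumes u: "T (\<lambda>e. u (e 0) (\<lambda>i. e (Suc i)))" and t: "T t"
  shows "T (\<lambda>e. u (t e) e)"
proof (rule T_I)
  show "u (t e) e \<in> V" if "env e" for e
    using T_in_V[OF u env_case[OF T_in_V[OF t that] that]] by simp
  have *: "D (\<lambda>e. e 0 = u (e 1) (\<lambda>i. e (Suc (Suc i))))" using u by (simp add: T_def)
  have "D (\<lambda>e. e (Suc 0) = u (e 0) (\<lambda>i. e (Suc (Suc i))))"
    using D_ren[OF *, of "case_nat 1 (case_nat 0 (\<lambda>i. Suc (Suc i)))"] by simp
  then show "D (\<lambda>e. e 0 = u (t (\<lambda>i. e (Suc i))) (\<lambda>i. e (Suc i)))"
    by (rule D_subst[where t = "\<lambda>e. t (\<lambda>i. e (Suc i))" and Q = "\<lambda>x e. e 0 = u x (\<lambda>i. e (Suc i))", OF _ T_ren[OF t]])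
qed

lemma D_mem: assumes t: "T t" and u: "T u" shows "D (\<lambda>e. t e \<in> elts (u e))"
proof (rule D_subst[where Q = "\<lambda>x e. x \<in> elts (u e)", OF _ t])
  show "D (\<lambda>e. e 0 \<in> elts (u (\<lambda>i. e (Suc i))))"
    by (rule D_subst[where Q = "\<lambda>x e. e 0 \<in> elts x", OF D_var_mem T_ren[OF u]])
qed

lemma D_eq: assumes t: "T t" and u: "T u" shows "D (\<lambda>e. t e = u e)"
proof (rule D_subst[where Q = "\<lambda>x e. x = u e", OF _ t])
  show "D (\<lambda>e. e 0 = u (\<lambda>i. e (Suc i)))" using u by (simp add: T_def)
qed

lemma V_elts: "x \<in> V \<Longrightarrow> y \<in> elts x \<Longrightarrow> y \<in> V"
  using transitive_model unfolding transitive_model_def by blast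

lemma D_all: assumes t: "T t" and Q: "D (\<lambda>e. Q (e 0) (\<lambda>i. e (Suc i)))"
  shows "D (\<lambda>e. \<forall>x\<in>elts (t e). Q x e)"
proof (rule D_cong)
  show "D (\<lambda>e. \<forall>x\<in>V. x \<in> elts (t e) \<longrightarrow> Q x e)"
    by (intro D_all_V D_imp D_mem T_var T_ren[OF t] Q)
qed (use V_elts[OF T_in_V[OF t]] in blast)

lemma D_ex: assumes t: "T t" and Q: "D (\<lambda>e. Q (e 0) (\<lambda>i. e (Suc i)))"
  shows "D (\<lambda>e. \<exists>x\<in>elts (t e). Q x e)"
  using D_not[OF D_all[where Q = "\<lambda>x e. \<not> Q x e", OF t D_not[OF Q]]] by simp

text \<open>By transitivity of \<open>V\<close>, a value is determined by its members in
  \<open>V\<close>; so definability of membership in the value gives definability of the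
  graph.\<close>

lemma T_ext:
  assumes V: "\<And>e. env e \<Longrightarrow> t e \<in> V" and D: "D (\<lambda>e. e 0 \<in> elts (t (\<lambda>i. e (Suc i))))"
  shows "T t"
proof (rule T_I[OF V])
  show "D (\<lambda>e. e 0 = t (\<lambda>i. e (Suc i)))"
  proof (rule D_cong)
    have "D (\<lambda>e. e 0 \<in> elts (t (\<lambda>i. e (Suc (Suc i)))))"
      using D_ren[OF D, of "case_nat 0 (\<lambda>i. Suc (Suc i))"] by simp
    then show "D (\<lambda>e. \<forall>z\<in>V. z \<in> elts (e 0) \<longleftrightarrow> z \<in> elts (t (\<lambda>i. e (Suc i))))"
      by (intro D_all_V D_iff D_var_mem)
    show "e 0 = t (\<lambda>i. e (Suc i)) \<longleftrightarrow> (\<forall>z\<in>V. z \<in> elts (e 0) \<longleftrightarrow> z \<in> elts (t (\<lambda>i. e (Suc i))))"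
      if "env e" for e
    proof -
      have "t (\<lambda>i. e (Suc i)) \<in> V" "e 0 \<in> V" using that V by auto
      then show ?thesis by (metis V_elts hset_eqI)
    qed
  qed
qed

text \<open>These rules follow the syntax of a HOL term, so that \<open>intro def_intros\<close>
  proves definability by decomposing the term.\<close>

named_theorems def_intros

lemmas [def_intros] = D_not D_and D_or D_imp D_iff D_const D_all D_ex D_all_V D_ex_V D_mem D_eq
  T_var

subsection \<open>Axioms of the model as closure properties\<close>

lemma ZFC: "ax_pairing V" "ax_union V" "ax_power_set V" "ax_infinity V" "ax_separation V"
  "ax_replacement V"
  using transitive_model unfolding transitive_model_def ZFC_model_def by blast+

lemma sep_ex:
  assumes Q: "D (\<lambda>e. Q (e 0) (\<lambda>i. e (Suc i)))" and a: "a \<in> V" and e: "env e"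
  shows "mk {x \<in> elts a. Q x e} \<in> V"
proof -
  obtain p s where s: "\<forall>i c. s i = Inr c \<longrightarrow> c \<in> V"
    and p: "\<forall>x\<in>V. \<forall>e. env e \<longrightarrow> (sat V (case_nat x (inst s e)) p \<longleftrightarrow> Q x e)"
    by (rule D_code1[OF Q, simplified])
  have "range (inst s e) \<subseteq> V" using s e by (auto simp: inst_def split: sum.split)
  then obtain b where b: "b \<in> V"
    "\<forall>x\<in>V. x \<in> elts b \<longleftrightarrow> x \<in> elts a \<and> sat V (case_nat x (inst s e)) p"
    using ZFC(5) a unfolding ax_separation_def by blast
  then have "elts b = {x \<in> elts a. Q x e}" using p e V_elts[OF a] V_elts[OF b(1)] by blast
  then show ?thesis using b(1) by (metis mk_elts)
qed

lemma pair_in_V: assumes "x \<in> V" "y \<in> V" shows "mk {x, y} \<in> V"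
proof -
  obtain z where z: "z \<in> V" "\<forall>w\<in>V. w \<in> elts z \<longleftrightarrow> w = x \<or> w = y"
    using ZFC(1)[unfolded ax_pairing_def, THEN bspec, THEN bspec, OF assms] by (rule bexE)
  then have "elts z = {x, y}" using V_elts[OF z(1)] assms by blast
  then show ?thesis using z(1) by (metis mk_elts)
qed

lemma Union_in_V:
  assumes "x \<in> V"
  shows "mk (\<Union> (elts ` elts x)) \<in> V" "elts (mk (\<Union> (elts ` elts x))) = \<Union> (elts ` elts x)"
proof -
  obtain z where z: "z \<in> V" "\<forall>w\<in>V. w \<in> elts z \<longleftrightarrow> (\<exists>y\<in>V. y \<in> elts x \<and> w \<in> elts y)"
    using ZFC(2)[unfolded ax_union_def, THEN bspec, OF assms] by (rule bexE)
  have "elts z = \<Union> (elts ` elts x)"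
  proof (intro equalityI subsetI)
    fix w assume "w \<in> elts z"
    then show "w \<in> \<Union> (elts ` elts x)" using z(2) V_elts[OF z(1)] by blast
  next
    fix w assume "w \<in> \<Union> (elts ` elts x)"
    then obtain y where y: "y \<in> elts x" "w \<in> elts y" by blast
    have "y \<in> V" by (rule V_elts[OF assms y(1)])
    then show "w \<in> elts z" using z(2) V_elts[OF _ y(2)] y by blast
  qed
  then show "mk (\<Union> (elts ` elts x)) \<in> V" "elts (mk (\<Union> (elts ` elts x))) = \<Union> (elts ` elts x)"
    using z(1) by (metis mk_elts)+
qed

definition Pow_V :: "'k hset \<Rightarrow> 'k hset" where
  "Pow_V x = mk {y \<in> V. elts y \<subseteq> elts x}"

lemma Pow_in_V:
  assumes "x \<in> V"
  shows "Pow_V x \<in> V" "elts (Pow_V x) = {y \<in> V. elts y \<subseteq> elts x}"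
proof -
  obtain z where z: "z \<in> V" "\<forall>y\<in>V. y \<in> elts z \<longleftrightarrow> (\<forall>w\<in>V. w \<in> elts y \<longrightarrow> w \<in> elts x)"
    using ZFC(3)[unfolded ax_power_set_def, THEN bspec, OF assms] by (rule bexE)
  moreover have "(\<forall>w\<in>V. w \<in> elts y \<longrightarrow> w \<in> elts x) \<longleftrightarrow> elts y \<subseteq> elts x" if "y \<in> V" for y
    using V_elts[OF that] by blast
  ultimately have "elts z = {y \<in> V. elts y \<subseteq> elts x}"
    using V_elts[OF z(1)] by blast
  then show "Pow_V x \<in> V" "elts (Pow_V x) = {y \<in> V. elts y \<subseteq> elts x}"
    unfolding Pow_V_def using z(1) by (metis mk_elts)+
qed

lemma image_in_V:
  assumes u: "T (\<lambda>e. u (e 0) (\<lambda>i. e (Suc i)))" and a: "a \<in> V" and e: "env e"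
  shows "mk ((\<lambda>x. u x e) ` elts a) \<in> V"
proof -
  have uV: "u x e \<in> V" if "x \<in> V" for x
    using T_in_V[OF u env_case[OF that e]] by simp
  have *: "D (\<lambda>e. e 0 = u (e 1) (\<lambda>i. e (Suc (Suc i))))" using u by (simp add: T_def)
  have "D (\<lambda>e. e (Suc 0) = u (e 0) (\<lambda>i. e (Suc (Suc i))))"
    using D_ren[OF *, of "case_nat 1 (case_nat 0 (\<lambda>i. Suc (Suc i)))"] by simp
  then obtain p s where s: "\<And>i c. s i = Inr c \<Longrightarrow> c \<in> V"
    and p: "\<And>e. env e \<Longrightarrow> sat V (inst s e) p \<longleftrightarrow> e (Suc 0) = u (e 0) (\<lambda>i. e (Suc (Suc i)))"
    unfolding D_def by blast
  \<comment> \<open>Two variables are distinguished here, 0 for the argument and 1 for the value of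
    \<open>u\<close>; all other variables shift by two, and the entries they read move down by
    two.\<close>
  define r where "r = (\<lambda>i. if s i = Inl 0 then 0 else if s i = Inl 1 then 1 else Suc (Suc i))"
  define s' where "s' = (\<lambda>i. case s i of Inl j \<Rightarrow> Inl (j - 2) | Inr c \<Rightarrow> Inr c)"
  have "(\<lambda>i. case_nat x (case_nat y (inst s' e)) (r i)) = inst s (case_nat x (case_nat y e))" for x y
    by (auto simp: inst_def r_def s'_def fun_eq_iff numeral_2_eq_2 split: sum.split nat.split)
  then have q: "sat V (case_nat x (case_nat y (inst s' e))) (ren r p) \<longleftrightarrow> y = u x e"
    if "x \<in> V" "y \<in> V" for x y
    using p[OF env_case[OF that(1) env_case[OF that(2) e]]] by (simp add: sat_ren)
  have "range (inst s' e) \<subseteq> V" using s e by (auto simp: inst_def s'_def split: sum.split)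
  moreover have "\<exists>!y. y \<in> V \<and> sat V (case_nat x (case_nat y (inst s' e))) (ren r p)"
    if "x \<in> V" for x
    using q[OF that] uV[OF that] by (intro ex1I[of _ "u x e"]) auto
  then have "\<forall>x\<in>V. x \<in> elts a \<longrightarrow>
      (\<exists>!y. y \<in> V \<and> sat V (case_nat x (case_nat y (inst s' e))) (ren r p))" by blast
  ultimately obtain b where b: "b \<in> V" "\<forall>y\<in>V. y \<in> elts b \<longleftrightarrow>
      (\<exists>x\<in>V. x \<in> elts a \<and> sat V (case_nat x (case_nat y (inst s' e))) (ren r p))"
    using ZFC(6)[unfolded ax_replacement_def, rule_format, OF _ a, of "inst s' e" "ren r p"]
    by metis
  have "elts b = (\<lambda>x. u x e) ` elts a"
  proof (intro equalityI subsetI)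
    fix y assume "y \<in> elts b"
    moreover from this have "y \<in> V" by (rule V_elts[OF b(1)])
    ultimately obtain x where "x \<in> V" "x \<in> elts a"
      "sat V (case_nat x (case_nat y (inst s' e))) (ren r p)"
      using b(2) by blast
    then show "y \<in> (\<lambda>x. u x e) ` elts a" using q \<open>y \<in> V\<close> by blast
  next
    fix y assume "y \<in> (\<lambda>x. u x e) ` elts a"
    then obtain x where x: "x \<in> elts a" "y = u x e" by blast
    then have "x \<in> V" "y \<in> V" using V_elts[OF a] uV by blast+
    then show "y \<in> elts b" using b(2) q x by blast
  qed
  then show ?thesis using b(1) by (metis mk_elts)
qed

section \<open>Set-forming operations as definable terms\<close>

lemma T_sep [def_intros]:
  assumes t: "T t" and Q: "D (\<lambda>e. Q (e 0) (\<lambda>i. e (Suc i)))"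
  shows "T (\<lambda>e. mk {x \<in> elts (t e). Q x e})"
proof (rule T_ext)
  show "mk {x \<in> elts (t e). Q x e} \<in> V" if "env e" for e
    by (rule sep_ex[OF Q T_in_V[OF t that] that])
  have "elts (mk {x \<in> elts (t e). Q x e}) = {x \<in> elts (t e). Q x e}" for e
    by (rule elts_mk_subset) blast
  then show "D (\<lambda>e. e 0 \<in> elts (mk {x \<in> elts (t (\<lambda>i. e (Suc i))). Q x (\<lambda>i. e (Suc i))}))"
    using Q by (simp, intro D_and D_mem T_var T_ren[OF t])
qed

lemma T_image [def_intros]:
  assumes t: "T t" and u: "T (\<lambda>e. u (e 0) (\<lambda>i. e (Suc i)))"
  shows "T (\<lambda>e. mk ((\<lambda>x. u x e) ` elts (t e)))"
proof (rule T_ext)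
  show "mk ((\<lambda>x. u x e) ` elts (t e)) \<in> V" if "env e" for e
    by (rule image_in_V[OF u T_in_V[OF t that] that])
  have "T (\<lambda>e. u (e 0) (\<lambda>i. e (Suc (Suc i))))"
    using T_ren[OF u, of "case_nat 0 (\<lambda>i. Suc (Suc i))"] by simp
  then have "D (\<lambda>e. \<exists>x\<in>elts (t (\<lambda>i. e (Suc i))). e 0 = u x (\<lambda>i. e (Suc i)))"
    by (intro D_ex D_eq T_var T_ren[OF t])
  then show "D (\<lambda>e. e 0 \<in> elts (mk ((\<lambda>x. u x (\<lambda>i. e (Suc i))) ` elts (t (\<lambda>i. e (Suc i))))))"
    by (simp add: elts_mk_image image_iff)
qed

lemma T_Union [def_intros]:
  assumes t: "T t"
  shows "T (\<lambda>e. mk (\<Union> (elts ` elts (t e))))"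
proof (rule T_ext)
  show "mk (\<Union> (elts ` elts (t e))) \<in> V" if "env e" for e
    by (rule Union_in_V[OF T_in_V[OF t that]])
  show "D (\<lambda>e. e 0 \<in> elts (mk (\<Union> (elts ` elts (t (\<lambda>i. e (Suc i)))))))"
  proof (rule D_cong)
    show "D (\<lambda>e. \<exists>y\<in>elts (t (\<lambda>i. e (Suc i))). e 0 \<in> elts y)"
      by (intro D_ex D_mem T_var T_ren[OF t])
    fix e assume "env e"
    then have "t (\<lambda>i. e (Suc i)) \<in> V" using T_in_V[OF t] by simp
    from Union_in_V(2)[OF this]
    show "e 0 \<in> elts (mk (\<Union> (elts ` elts (t (\<lambda>i. e (Suc i)))))) \<longleftrightarrow>
        (\<exists>y\<in>elts (t (\<lambda>i. e (Suc i))). e 0 \<in> elts y)" by simp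
  qed
qed

lemma T_UN [def_intros]:
  assumes t: "T t" and u: "T (\<lambda>e. u (e 0) (\<lambda>i. e (Suc i)))"
  shows "T (\<lambda>e. mk (\<Union>x\<in>elts (t e). elts (u x e)))"
proof -
  have "T (\<lambda>e. mk (\<Union> (elts ` elts (mk ((\<lambda>x. u x e) ` elts (t e))))))"
    by (rule T_Union, rule T_image[where u = u], rule t, rule u)
  then show ?thesis unfolding elts_mk_image image_image .
qed

text \<open>\<open>mk\<close> yields the intended set only if the extension is small; here smallness
  comes from replacement and union in \<open>V\<close>.\<close>

lemma elts_mk_UN:
  assumes t: "a \<in> V" and u: "T (\<lambda>e. u (e 0))"
  shows "elts (mk (\<Union>x\<in>elts a. elts (u x))) = (\<Union>x\<in>elts a. elts (u x))"
proof -
  have "mk (u ` elts a) \<in> V" by (rule image_in_V[where u = "\<lambda>x e. u x" and e = "\<lambda>_. a"]) (simp_all add: t u)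
  from Union_in_V(2)[OF this] show ?thesis by (simp add: elts_mk_image image_image)
qed

lemma T_Pow [def_intros]:
  assumes t: "T t"
  shows "T (\<lambda>e. Pow_V (t e))"
proof (rule T_ext)
  show "Pow_V (t e) \<in> V" if "env e" for e
    by (rule Pow_in_V[OF T_in_V[OF t that]])
  show "D (\<lambda>e. e 0 \<in> elts (Pow_V (t (\<lambda>i. e (Suc i)))))"
  proof (rule D_cong)
    show "D (\<lambda>e. \<forall>z\<in>elts (e 0). z \<in> elts (t (\<lambda>i. e (Suc i))))"
      by (intro D_all D_mem T_var T_ren[OF t])
    fix e assume e: "env e"
    then have "t (\<lambda>i. e (Suc i)) \<in> V" using T_in_V[OF t] by simp
    from Pow_in_V(2)[OF this]
    show "e 0 \<in> elts (Pow_V (t (\<lambda>i. e (Suc i)))) \<longleftrightarrow> (\<forall>z\<in>elts (e 0). z \<in> elts (t (\<lambda>i. e (Suc i))))"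
      using e by auto
  qed
qed

lemma T_pair [def_intros]:
  assumes t: "T t" and u: "T u"
  shows "T (\<lambda>e. mk {t e, u e})"
proof (rule T_ext)
  show "mk {t e, u e} \<in> V" if "env e" for e
    using that by (intro pair_in_V T_in_V[OF t] T_in_V[OF u])
  show "D (\<lambda>e. e 0 \<in> elts (mk {t (\<lambda>i. e (Suc i)), u (\<lambda>i. e (Suc i))}))"
    by (simp, intro D_or D_eq T_var T_ren[OF t] T_ren[OF u])
qed

lemma T_single [def_intros]: "T t \<Longrightarrow> T (\<lambda>e. mk {t e})"
  using T_pair[of t t] by simp

lemma T_opair [def_intros]: "T t \<Longrightarrow> T u \<Longrightarrow> T (\<lambda>e. opair (t e) (u e))"
  unfolding opair_def by (intro T_pair T_single)

lemma T_Un [def_intros]: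
  assumes t: "T t" and u: "T u"
  shows "T (\<lambda>e. mk (elts (t e) \<union> elts (u e)))"
  using T_Union[OF T_pair[OF t u]] by simp

lemma elts_mk_Un: "x \<in> V \<Longrightarrow> y \<in> V \<Longrightarrow> elts (mk (elts x \<union> elts y)) = elts x \<union> elts y"
  using Union_in_V(2)[OF pair_in_V] by simp

lemma T_insert [def_intros]:
  assumes t: "T t" and u: "T u"
  shows "T (\<lambda>e. mk (insert (t e) (elts (u e))))"
  using T_Un[OF T_single[OF t] u] by simp

lemma T_if [def_intros]:
  assumes Q: "D Q" and t: "T t" and u: "T u"
  shows "T (\<lambda>e. if Q e then t e else u e)"
proof (rule T_ext)
  show "(if Q e then t e else u e) \<in> V" if "env e" for e
    using T_in_V[OF t that] T_in_V[OF u that] by simp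
  show "D (\<lambda>e. e 0 \<in> elts (if Q (\<lambda>i. e (Suc i)) then t (\<lambda>i. e (Suc i)) else u (\<lambda>i. e (Suc i))))"
  proof (rule D_cong)
    show "D (\<lambda>e. (Q (\<lambda>i. e (Suc i)) \<longrightarrow> e 0 \<in> elts (t (\<lambda>i. e (Suc i)))) \<and>
        (\<not> Q (\<lambda>i. e (Suc i)) \<longrightarrow> e 0 \<in> elts (u (\<lambda>i. e (Suc i)))))"
      by (intro D_and D_imp D_not D_mem T_var D_ren[OF Q] T_ren[OF t] T_ren[OF u])
  qed simp
qed

lemma D_subset [def_intros]:
  assumes t: "T t" and u: "T u"
  shows "D (\<lambda>e. elts (t e) \<subseteq> elts (u e))"
  unfolding subset_iff Ball_def[symmetric] by (intro D_all D_mem T_var T_ren[OF u] t)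

lemma empty_in_V: "mk {} \<in> V"
proof -
  obtain x where "x \<in> V" using ZFC(4) unfolding ax_infinity_def by blast
  then have "mk {y \<in> elts x. False} \<in> V"
    by (intro sep_ex[where Q = "\<lambda>_ _. False" and e = "\<lambda>_. x"] D_const) simp_all
  then show ?thesis by simp
qed

lemma opair_in_V_iff [simp]: "opair x y \<in> V \<longleftrightarrow> x \<in> V \<and> y \<in> V"
proof
  assume "opair x y \<in> V"
  then have "mk {x, y} \<in> V" unfolding opair_def by (metis V_elts elts_mk_pair insertCI)
  then show "x \<in> V \<and> y \<in> V" by (metis V_elts elts_mk_pair insertCI)
next
  assume "x \<in> V \<and> y \<in> V"
  then show "opair x y \<in> V" unfolding opair_def using pair_in_V by (metis insert_absorb2)
qed

subsection \<open>Functions and recursion\<close>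

text \<open>Reading a closed term as a constant operation makes \<open>def_intros\<close> a prover
  of membership in \<open>V\<close>.\<close>

lemma T_constD: "T (\<lambda>e. c) \<Longrightarrow> c \<in> V"
  using T_in_V[of "\<lambda>e. c" "\<lambda>_. mk {}"] empty_in_V by simp

lemma T_subst1: "T (\<lambda>e. h (e 0)) \<Longrightarrow> T t \<Longrightarrow> T (\<lambda>e. h (t e))"
  by (rule T_subst[where u = "\<lambda>x e. h x"])

lemma D_subst1: "D (\<lambda>e. Q (e 0)) \<Longrightarrow> T t \<Longrightarrow> D (\<lambda>e. Q (t e))"
  by (rule D_subst[where Q = "\<lambda>x e. Q x"])

lemma T_in_V1: "T (\<lambda>e. h (e 0)) \<Longrightarrow> x \<in> V \<Longrightarrow> h x \<in> V"
  by (rule T_constD) (rule T_subst1[OF _ T_const])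

lemma T_subst2:
  assumes h: "T (\<lambda>e. h (e 0) (e 1))" and t: "T t" and u: "T u"
  shows "T (\<lambda>e. h (t e) (u e))"
proof (rule T_subst[where u = "\<lambda>x e. h x (u e)", OF _ t])
  have "T (\<lambda>e. h (e (Suc 0)) (e 0))"
    using T_ren[OF h, of "case_nat 1 (\<lambda>_. 0)"] by simp
  then show "T (\<lambda>e. h (e 0) (u (\<lambda>i. e (Suc i))))"
    by (rule T_subst[where u = "\<lambda>x e. h (e 0) x", OF _ T_ren[OF u]])
qed

lemma D_subst2:
  assumes h: "D (\<lambda>e. h (e 0) (e 1))" and t: "T t" and u: "T u"
  shows "D (\<lambda>e. h (t e) (u e))"
proof (rule D_subst[where Q = "\<lambda>x e. h x (u e)", OF _ t])
  have "D (\<lambda>e. h (e (Suc 0)) (e 0))"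
    using D_ren[OF h, of "case_nat 1 (\<lambda>_. 0)"] by simp
  then show "D (\<lambda>e. h (e 0) (u (\<lambda>i. e (Suc i))))"
    by (rule D_subst[where Q = "\<lambda>x e. h (e 0) x", OF _ T_ren[OF u]])
qed

lemmas T_empty [def_intros] = T_const[OF empty_in_V]

lemma T_in_V2: "T (\<lambda>e. h (e 0) (e 1)) \<Longrightarrow> x \<in> V \<Longrightarrow> y \<in> V \<Longrightarrow> h x y \<in> V"
  by (rule T_constD) (rule T_subst2[OF _ T_const T_const])

text \<open>The double union of \<open>f\<close> contains both coordinates of every Kuratowski pair
  in \<open>f\<close>, so that quantifiers over arguments and values can be bounded.\<close>

definition field_of :: "'k hset \<Rightarrow> 'k hset" where
  "field_of f = mk (\<Union> (elts ` elts (mk (\<Union> (elts ` elts f)))))"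

definition dom_of :: "'k hset \<Rightarrow> 'k hset" where
  "dom_of f = mk {x \<in> elts (field_of f). \<exists>y\<in>elts (field_of f). opair x y \<in> elts f}"

text \<open>Unlike \<open>app\<close>, the value outside the domain is the empty set and hence belongs to \<open>V\<close>.\<close>

definition ap :: "'k hset \<Rightarrow> 'k hset \<Rightarrow> 'k hset" where
  "ap f x = mk (\<Union> (elts ` elts (mk {y \<in> elts (field_of f). opair x y \<in> elts f})))"

lemma T_field_of [def_intros]: "T t \<Longrightarrow> T (\<lambda>e. field_of (t e))"
  unfolding field_of_def by (intro def_intros)

lemma T_dom_of [def_intros]:
  assumes t: "T t"
  shows "T (\<lambda>e. dom_of (t e))"
proof -
  have "T (\<lambda>e. dom_of (e 0))" unfolding dom_of_def by (intro def_intros)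
  then show ?thesis by (rule T_subst1[OF _ t])
qed

lemma T_ap [def_intros]:
  assumes t: "T t" and u: "T u"
  shows "T (\<lambda>e. ap (t e) (u e))"
proof -
  have "T (\<lambda>e. ap (e 0) (e 1))" unfolding ap_def by (intro def_intros)
  then show ?thesis by (rule T_subst2[OF _ t u])
qed

lemmas dom_of_in_V = T_in_V1[where h = dom_of, OF T_dom_of[OF T_var]]
lemmas ap_in_V = T_in_V2[where h = ap, OF T_ap[OF T_var T_var]]

lemma elts_field_of:
  assumes "f \<in> V" "opair x y \<in> elts f"
  shows "x \<in> elts (field_of f)" "y \<in> elts (field_of f)"
proof -
  have 1: "elts (mk (\<Union> (elts ` elts f))) = \<Union> (elts ` elts f)"
    "mk (\<Union> (elts ` elts f)) \<in> V" using Union_in_V[OF assms(1)] by auto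
  have "mk {x, y} \<in> \<Union> (elts ` elts f)"
    using assms(2) by (rule UN_I) (simp add: opair_def)
  then have "{x, y} \<subseteq> elts (field_of f)"
    unfolding field_of_def Union_in_V(2)[OF 1(2)] using 1(1) elts_mk_pair by blast
  then show "x \<in> elts (field_of f)" "y \<in> elts (field_of f)" by auto
qed

lemma elts_dom_of: "f \<in> V \<Longrightarrow> elts (dom_of f) = fdom f"
proof -
  assume f: "f \<in> V"
  have "elts (dom_of f) = {x \<in> elts (field_of f). \<exists>y\<in>elts (field_of f). opair x y \<in> elts f}"
    unfolding dom_of_def by (rule elts_mk_subset) blast
  then show ?thesis using elts_field_of[OF f] by (auto simp: fdom_def)
qed

lemma ap_eq: assumes "f \<in> V" "is_fun f" "opair x y \<in> elts f" shows "ap f x = y"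
proof -
  have "elts (mk {z \<in> elts (field_of f). opair x z \<in> elts f}) = {z \<in> elts (field_of f). opair x z \<in> elts f}"
    by (rule elts_mk_subset) blast
  also have "\<dots> = {y}"
    using assms(2,3) elts_field_of[OF assms(1)] by (auto simp: is_fun_def)
  finally show ?thesis by (simp add: ap_def)
qed

lemma app_eq: "is_fun f \<Longrightarrow> opair x y \<in> elts f \<Longrightarrow> app f x = y"
  by (auto simp: is_fun_def app_def)

lemma ap_app: "f \<in> V \<Longrightarrow> is_fun f \<Longrightarrow> x \<in> fdom f \<Longrightarrow> ap f x = app f x"
  by (auto simp: fdom_def ap_eq app_eq)

lemma opair_app: "is_fun f \<Longrightarrow> x \<in> fdom f \<Longrightarrow> opair x (app f x) \<in> elts f"
  by (auto simp: fdom_def app_eq)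

lemma fun_eqI:
  fixes f g :: "'k hset"
  assumes "is_fun f" "is_fun g" "fdom f = fdom g" "\<And>x. x \<in> fdom f \<Longrightarrow> app f x = app g x"
  shows "f = g"
proof -
  have sub: "elts f \<subseteq> elts g"
    if f: "is_fun f" and g: "is_fun g" and dom: "fdom f = fdom g"
      and eq: "\<And>x. x \<in> fdom f \<Longrightarrow> app f x = app g x" for f g :: "'k hset"
  proof
    fix z assume z: "z \<in> elts f"
    then obtain x y where xy: "z = opair x y" using f unfolding is_fun_def by blast
    then have "x \<in> fdom f" using z by (auto simp: fdom_def)
    moreover have "y = app f x" using app_eq[OF f] z xy by simp
    ultimately show "z \<in> elts g" using opair_app[OF g, of x] dom eq xy by simp
  qed
  have "elts f = elts g"
    using sub[OF assms(1,2)] sub[OF assms(2,1)] assms(3,4) by simp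
  then show ?thesis by (simp add: elts_inject)
qed

lemma D_is_fun [def_intros]:
  assumes t: "T t"
  shows "D (\<lambda>e. is_fun (t e))"
proof (rule D_subst1[OF _ t])
  show "D (\<lambda>e. is_fun (e 0))"
  proof (rule D_cong)
    show "D (\<lambda>e. (\<forall>z\<in>elts (e 0). \<exists>x\<in>elts (field_of (e 0)). \<exists>y\<in>elts (field_of (e 0)). z = opair x y) \<and>
      (\<forall>x\<in>elts (field_of (e 0)). \<forall>y\<in>elts (field_of (e 0)). \<forall>y'\<in>elts (field_of (e 0)).
        opair x y \<in> elts (e 0) \<longrightarrow> opair x y' \<in> elts (e 0) \<longrightarrow> y = y'))"
      by (intro def_intros)
    fix e :: "nat \<Rightarrow> 'k hset" assume "env e"
    then have *: "e 0 \<in> V" by simp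
    show "is_fun (e 0) \<longleftrightarrow> (\<forall>z\<in>elts (e 0). \<exists>x\<in>elts (field_of (e 0)). \<exists>y\<in>elts (field_of (e 0)). z = opair x y) \<and>
      (\<forall>x\<in>elts (field_of (e 0)). \<forall>y\<in>elts (field_of (e 0)). \<forall>y'\<in>elts (field_of (e 0)).
        opair x y \<in> elts (e 0) \<longrightarrow> opair x y' \<in> elts (e 0) \<longrightarrow> y = y')"
      unfolding is_fun_def
    proof (intro arg_cong2[where f = "(\<and>)"] ball_cong refl)
      fix z assume "z \<in> elts (e 0)"
      then show "(\<exists>x y. z = opair x y) \<longleftrightarrow>
          (\<exists>x\<in>elts (field_of (e 0)). \<exists>y\<in>elts (field_of (e 0)). z = opair x y)"
        using elts_field_of[OF *] by blast
    next
      show "(\<forall>x y y'. opair x y \<in> elts (e 0) \<longrightarrow> opair x y' \<in> elts (e 0) \<longrightarrow> y = y') \<longleftrightarrow>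
        (\<forall>x\<in>elts (field_of (e 0)). \<forall>y\<in>elts (field_of (e 0)). \<forall>y'\<in>elts (field_of (e 0)).
        opair x y \<in> elts (e 0) \<longrightarrow> opair x y' \<in> elts (e 0) \<longrightarrow> y = y')"
        using elts_field_of[OF *] by blast
    qed
  qed
qed

definition graph :: "('k hset \<Rightarrow> 'k hset) \<Rightarrow> 'k hset \<Rightarrow> 'k hset" where
  "graph F a = mk ((\<lambda>x. opair x (F x)) ` elts a)"

lemma elts_graph: "elts (graph F a) = (\<lambda>x. opair x (F x)) ` elts a"
  unfolding graph_def by (rule elts_mk_image)

lemma graph_fun: "is_fun (graph F a)" "fdom (graph F a) = elts a"
  by (auto simp: is_fun_def fdom_def elts_graph)

lemma app_graph: "x \<in> elts a \<Longrightarrow> app (graph F a) x = F x"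
  by (rule app_eq[OF graph_fun(1)]) (auto simp: elts_graph)

lemma graph_in_V: "T (\<lambda>e. F (e 0)) \<Longrightarrow> a \<in> V \<Longrightarrow> graph F a \<in> V"
  unfolding graph_def
  by (rule T_in_V1[where h = "\<lambda>a. mk ((\<lambda>x. opair x (F x)) ` elts a)"]) (intro def_intros)

text \<open>Transfinite recursion over \<open>V\<close> for a function \<open>h\<close> that already
  exists in HOL. Attempts at the recursion in \<open>V\<close> agree with \<open>h\<close>, and by
  induction on membership there is one at every \<open>x\<close>; hence \<open>y = h x\<close> is
  definable as: some attempt sends \<open>x\<close> to \<open>y\<close>. In \<open>step\<close>,
  agreement of \<open>f\<close> with \<open>h\<close> is granted along the transitive closure of
  membership, because codes hide their subcodes inside ordered pairs.\<close>

lemma T_rec: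
  assumes Phi: "T (\<lambda>e. \<Phi> (e 0) (e 1))"
    and step: "\<And>x f. x \<in> V \<Longrightarrow> f \<in> V \<Longrightarrow>
      (\<And>z. (z, x) \<in> {(x, y). x \<in> elts y}\<^sup>+ \<Longrightarrow> ap f z = h z) \<Longrightarrow> h x = \<Phi> x f"
  shows "T (\<lambda>e. h (e 0))"
proof -
  let ?r = "{(x, y). x \<in> elts y}\<^sup>+ :: ('k hset \<times> 'k hset) set"
  \<comment> \<open>An attempt has a transitive domain and satisfies the recursion equation there.
    The whole of \<open>f\<close> is passed to \<open>\<Phi>\<close>; this is harmless, as
    \<open>step\<close> only asks for agreement below the argument.\<close>
  define good where "good f \<longleftrightarrow> is_fun f \<and> (\<forall>z\<in>elts (dom_of f). elts z \<subseteq> elts (dom_of f)) \<and>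
    (\<forall>z\<in>elts (dom_of f). ap f z = \<Phi> z f)" for f
  have D_good: "D (\<lambda>e. good (t e))" if t: "T t" for t
  proof (rule D_subst1[OF _ t])
    show "D (\<lambda>e. good (e 0))" unfolding good_def by (intro def_intros T_subst2[OF Phi])
  qed
  have down: "w \<in> elts (dom_of f)"
    if "\<forall>z\<in>elts (dom_of f). elts z \<subseteq> elts (dom_of f)" "z \<in> elts (dom_of f)" "(w, z) \<in> ?r" for f z w
    using that(3,2) by (induction rule: trancl_induct) (use that(1) in blast)+
  have agree: "ap f z = h z" if "f \<in> V" "good f" "z \<in> elts (dom_of f)" for f z
    using that(3)
  proof (induction z rule: wf_induct[OF wf_trancl[OF wf_elts]])
    case (1 z)
    have "dom_of f \<in> V" using that(1) by (rule dom_of_in_V)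
    then have "z \<in> V" using 1(2) V_elts by blast
    have "ap f w = h w" if w: "(w, z) \<in> ?r" for w
    proof -
      have "w \<in> elts (dom_of f)"
        using \<open>good f\<close> unfolding good_def by (intro down[OF _ 1(2) w]) blast
      then show ?thesis using 1(1) w by blast
    qed
    then have "h z = \<Phi> z f" by (rule step[OF \<open>z \<in> V\<close> that(1)])
    then show ?case using that(2) 1(2) by (simp add: good_def)
  qed
  have goodI: "good f \<and> (\<forall>z\<in>elts (dom_of f). ap f z = h z)"
    if f: "f \<in> V" and tr: "\<forall>z\<in>elts (dom_of f). elts z \<subseteq> elts (dom_of f)"
    and h: "\<forall>p\<in>elts f. \<exists>z. p = opair z (h z)" for f
  proof -
    have val: "y = h x" if "opair x y \<in> elts f" for x y
      using bspec[OF h that] by auto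
    have is_fun: "is_fun f" unfolding is_fun_def using h val by blast
    have ap: "ap f z = h z" if z: "z \<in> elts (dom_of f)" for z
    proof -
      obtain y where "opair z y \<in> elts f"
        using z unfolding elts_dom_of[OF f] fdom_def by blast
      then show ?thesis using ap_eq[OF f is_fun] val by simp
    qed
    have "dom_of f \<in> V" using f by (rule dom_of_in_V)
    then have "h z = \<Phi> z f" if "z \<in> elts (dom_of f)" for z
      using step[OF V_elts[OF _ that] f] ap down[OF tr that] by blast
    then show ?thesis unfolding good_def using is_fun tr ap by simp
  qed
  \<comment> \<open>Attempts at \<open>x\<close> are not unique as sets, since their domains vary.
    The intersection of all of them is definable from \<open>x\<close>, so that replacement can
    collect these intersections without choosing attempts. Where no attempt exists the value is
    empty, which keeps the operation total.\<close>
  define mn where "mn x = mk {p \<in> V. (\<exists>f\<in>V. good f \<and> x \<in> elts (dom_of f)) \<and>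
    (\<forall>f\<in>V. good f \<and> x \<in> elts (dom_of f) \<longrightarrow> p \<in> elts f)}" for x
  have D_mn: "D (\<lambda>e. (\<exists>f\<in>V. good f \<and> e 1 \<in> elts (dom_of f)) \<and>
    (\<forall>f\<in>V. good f \<and> e 1 \<in> elts (dom_of f) \<longrightarrow> e 0 \<in> elts f))"
    by (intro def_intros D_good)
  have mn: "mn x \<in> V \<and> elts (mn x) = {p \<in> V. (\<exists>f\<in>V. good f \<and> x \<in> elts (dom_of f)) \<and>
    (\<forall>f\<in>V. good f \<and> x \<in> elts (dom_of f) \<longrightarrow> p \<in> elts f)}" (is "_ \<and> _ = ?A") if x: "x \<in> V" for x
  proof (cases "\<exists>f\<in>V. good f \<and> x \<in> elts (dom_of f)")
    case True
    then obtain f where f: "f \<in> V" "good f" "x \<in> elts (dom_of f)" by blast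
    have A: "?A = {p \<in> elts f. (\<exists>f\<in>V. good f \<and> x \<in> elts (dom_of f)) \<and>
       (\<forall>f\<in>V. good f \<and> x \<in> elts (dom_of f) \<longrightarrow> p \<in> elts f)}"
      using f V_elts[OF f(1)] by blast
    have "mk \<dots> \<in> V"
      by (rule sep_ex[where e = "\<lambda>_. x" and Q = "\<lambda>p e. (\<exists>f\<in>V. good f \<and> e 0 \<in> elts (dom_of f)) \<and>
          (\<forall>f\<in>V. good f \<and> e 0 \<in> elts (dom_of f) \<longrightarrow> p \<in> elts f)"])
        (use D_mn f x in simp_all)
    moreover have "elts (mk ?A) = ?A" by (rule elts_mk_subset[of _ f]) (use f in blast)
    ultimately show ?thesis unfolding mn_def A by simp
  next
    case False
    then have A: "?A = {}" by blast
    show ?thesis unfolding mn_def A using empty_in_V by simp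
  qed
  have T_mn: "T (\<lambda>e. mn (e 0))"
  proof (rule T_ext)
    show "mn (e 0) \<in> V" if "env e" for e using that mn by blast
    show "D (\<lambda>e. e 0 \<in> elts (mn (e (Suc 0))))"
      by (rule D_cong[OF _ D_mn]) (use mn in auto)
  qed
  have ex: "\<exists>f\<in>V. good f \<and> x \<in> elts (dom_of f)" if "x \<in> V" for x
    using that
  proof (induction x rule: wf_induct[OF wf_elts])
    case (1 x)
    then have IH: "\<exists>f\<in>V. good f \<and> x' \<in> elts (dom_of f)" if "x' \<in> elts x" for x'
      using that V_elts[OF \<open>x \<in> V\<close>] by simp
    \<comment> \<open>Gluing the intersections for all members of \<open>x\<close> gives a piece of
      the graph of \<open>h\<close> whose domain is transitive and includes all members of
      \<open>x\<close>.\<close>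
    define F where "F = mk (\<Union>x'\<in>elts x. elts (mn x'))"
    have F_V: "F \<in> V" unfolding F_def
      by (rule T_in_V1[where h = "\<lambda>x. mk (\<Union>x'\<in>elts x. elts (mn x'))", OF _ 1(2)])
        (intro def_intros T_mn)
    have F: "elts F = (\<Union>x'\<in>elts x. elts (mn x'))"
      unfolding F_def by (rule elts_mk_UN[OF 1(2) T_mn])
    have memF: "p \<in> elts F \<longleftrightarrow> p \<in> V \<and>
        (\<exists>x'\<in>elts x. \<forall>f\<in>V. good f \<and> x' \<in> elts (dom_of f) \<longrightarrow> p \<in> elts f)" for p
    proof -
      have "p \<in> elts (mn x') \<longleftrightarrow> p \<in> V \<and>
          (\<forall>f\<in>V. good f \<and> x' \<in> elts (dom_of f) \<longrightarrow> p \<in> elts f)" if "x' \<in> elts x" for x'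
        using mn[OF V_elts[OF 1(2) that]] IH[OF that] by simp
      then show ?thesis unfolding F by blast
    qed
    have graph: "\<exists>z. p = opair z (h z)" if pF: "p \<in> elts F" for p
    proof -
      obtain x' where x': "x' \<in> elts x" "\<forall>f\<in>V. good f \<and> x' \<in> elts (dom_of f) \<longrightarrow> p \<in> elts f"
        using pF memF by blast
      obtain f where f: "f \<in> V" "good f" "x' \<in> elts (dom_of f)" using IH[OF x'(1)] by blast
      then have "p \<in> elts f" using x' by blast
      then obtain z y where p: "p = opair z y" using f(2) unfolding good_def is_fun_def by blast
      then have "z \<in> elts (dom_of f)" using \<open>p \<in> elts f\<close> elts_dom_of[OF f(1)] by (auto simp: fdom_def)
      then have "h z = y" using agree[OF f(1,2)] ap_eq[OF f(1)] f(2) \<open>p \<in> elts f\<close> p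
        by (metis good_def)
      then show ?thesis using p by blast
    qed
    have inF: "opair w (h w) \<in> elts F"
      if x': "x' \<in> elts x" and w: "\<And>f. f \<in> V \<Longrightarrow> good f \<Longrightarrow> x' \<in> elts (dom_of f) \<Longrightarrow> w \<in> elts (dom_of f)"
      for x' w
    proof -
      have *: "opair w (h w) \<in> elts f" if f: "f \<in> V" "good f" "x' \<in> elts (dom_of f)" for f
      proof -
        have "w \<in> elts (dom_of f)" using w f by blast
        moreover from this have "ap f w = h w" by (rule agree[OF f(1,2)])
        moreover have "is_fun f" using f(2) good_def by blast
        ultimately show ?thesis using ap_app[OF f(1)] opair_app elts_dom_of[OF f(1)] by metis
      qed
      moreover obtain f where "f \<in> V" "good f" "x' \<in> elts (dom_of f)" using IH[OF x'] by blast
      ultimately have "opair w (h w) \<in> V" using V_elts by metis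
      then show ?thesis unfolding memF using x' * by blast
    qed
    have xF: "elts x \<subseteq> elts (dom_of F)"
      using inF unfolding elts_dom_of[OF F_V] fdom_def by blast
    have trF: "\<forall>z\<in>elts (dom_of F). elts z \<subseteq> elts (dom_of F)"
    proof (intro ballI subsetI)
      fix z w assume "z \<in> elts (dom_of F)" and w: "w \<in> elts z"
      then obtain y where "opair z y \<in> elts F" unfolding elts_dom_of[OF F_V] fdom_def by blast
      then obtain x' where x': "x' \<in> elts x"
        "\<forall>f\<in>V. good f \<and> x' \<in> elts (dom_of f) \<longrightarrow> opair z y \<in> elts f" using memF by blast
      have "opair w (h w) \<in> elts F"
      proof (rule inF[OF x'(1)])
        fix f assume f: "f \<in> V" "good f" "x' \<in> elts (dom_of f)"
        then have "opair z y \<in> elts f" using x'(2) by blast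
        then have "z \<in> elts (dom_of f)" unfolding elts_dom_of[OF f(1)] fdom_def by blast
        then show "w \<in> elts (dom_of f)" using f(2) w unfolding good_def by blast
      qed
      then show "w \<in> elts (dom_of F)" unfolding elts_dom_of[OF F_V] fdom_def by blast
    qed
    have apF: "ap F z = h z" if "z \<in> elts (dom_of F)" for z
      using goodI[OF F_V trF] graph that by blast
    have "h x = \<Phi> x F"
    proof (rule step[OF 1(2) F_V])
      fix z assume "(z, x) \<in> ?r"
      then consider "z \<in> elts x" | x' where "(z, x') \<in> ?r" "x' \<in> elts x"
        by (cases rule: trancl.cases) auto
      then show "ap F z = h z"
        using xF apF down[OF trF] by cases blast+
    qed
    then have hx: "h x \<in> V" using T_in_V2[OF Phi 1(2) F_V] by simp
    \<comment> \<open>One more pair extends the glued function to \<open>x\<close> itself; the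
      domain stays transitive because it already includes the members of \<open>x\<close>.\<close>
    define f where "f = mk (insert (opair x (h x)) (elts F))"
    have "opair x (h x) \<in> V" using 1(2) hx by simp
    have f_V: "f \<in> V" unfolding f_def
      by (rule T_in_V2[where h = "\<lambda>p F. mk (insert p (elts F))", OF _ \<open>opair x (h x) \<in> V\<close> F_V])
        (intro def_intros)
    have ef: "elts f = insert (opair x (h x)) (elts F)" by (simp add: f_def)
    have df: "elts (dom_of f) = insert x (elts (dom_of F))"
      unfolding elts_dom_of[OF f_V] elts_dom_of[OF F_V] by (auto simp: fdom_def ef)
    have "good f"
      using goodI[OF f_V] graph trF xF unfolding df ef by blast
    then show ?case using f_V df by blast
  qed
  have h_V: "h x \<in> V" if "x \<in> V" for x
  proof -
    obtain f where f: "f \<in> V" "good f" "x \<in> elts (dom_of f)" using ex[OF \<open>x \<in> V\<close>] by blast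
    have "ap f x \<in> V" by (rule ap_in_V[OF f(1) that])
    then show ?thesis using agree[OF f] by simp
  qed
  show ?thesis
  proof (rule T_I)
    show "h (e 0) \<in> V" if "env e" for e using that h_V by simp
    show "D (\<lambda>e. e 0 = h (e (Suc 0)))"
    proof (rule D_cong)
      show "D (\<lambda>e. \<exists>f\<in>V. good f \<and> e 1 \<in> elts (dom_of f) \<and> ap f (e 1) = e 0)"
        by (intro def_intros D_good)
      show "e 0 = h (e (Suc 0)) \<longleftrightarrow> (\<exists>f\<in>V. good f \<and> e 1 \<in> elts (dom_of f) \<and> ap f (e 1) = e 0)"
        if "env e" for e using ex[of "e 1"] agree that by auto
    qed
  qed
qed

subsection \<open>Natural numbers and finite sequences\<close>

lemma von_in_V: "von n \<in> V"
proof (induction n)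
  case 0
  show ?case using empty_in_V by simp
next
  case (Suc n)
  have "mk (insert (von n) (elts (von n))) \<in> V"
    by (rule T_in_V1[where h = "\<lambda>x. mk (insert x (elts x))", OF _ Suc]) (intro def_intros)
  then show ?case by simp
qed

lemmas T_von [def_intros] = T_const[OF von_in_V]

lemma omega_in_V: "omega \<in> V"
proof -
  define succ where "succ z w \<longleftrightarrow> (\<forall>u\<in>elts z. u \<in> elts w \<or> u = w) \<and> (\<forall>u\<in>elts w. u \<in> elts z) \<and> w \<in> elts z"
    for z w :: "'k hset"
  have succ: "succ z w \<longleftrightarrow> z = mk (insert w (elts w))" for z w
  proof -
    have "succ z w \<longleftrightarrow> elts z = insert w (elts w)" unfolding succ_def by blast
    then show ?thesis by (metis elts_mk_insert mk_elts)
  qed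
  obtain x where x: "x \<in> V" "\<exists>y\<in>V. y \<in> elts x \<and> \<not> (\<exists>z\<in>V. z \<in> elts y)"
    "\<forall>y\<in>V. y \<in> elts x \<longrightarrow>
         (\<exists>s\<in>V. s \<in> elts x \<and> (\<forall>w\<in>V. w \<in> elts s \<longleftrightarrow> w \<in> elts y \<or> w = y))"
    using ZFC(4) unfolding ax_infinity_def by auto
  have von_x: "von n \<in> elts x" for n
  proof (induction n)
    case 0
    obtain y where y: "y \<in> V" "y \<in> elts x" "\<not> (\<exists>z\<in>V. z \<in> elts y)" using x(2) by blast
    then have "elts y = {}" using V_elts[OF y(1)] by blast
    then have "y = mk {}" by (simp only: elts_empty_iff)
    then show ?case using y(2) by simp
  next
    case (Suc n)
    obtain s where s: "s \<in> V" "s \<in> elts x" "\<forall>w\<in>V. w \<in> elts s \<longleftrightarrow> w \<in> elts (von n) \<or> w = von n"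
      using x(3) Suc von_in_V by blast
    have "elts s = insert (von n) (elts (von n))"
      using s(3) V_elts[OF s(1)] V_elts[OF von_in_V] von_in_V by blast
    then have "s = von (Suc n)" by (metis mk_elts von.simps(2))
    then show ?case using s(2) by simp
  qed
  \<comment> \<open>The axiom of infinity only provides some inductive set \<open>x\<close>, which
    may have foreign members. Kept are those \<open>y\<close> for which each element of
    \<open>insert y (elts y)\<close> is empty or the successor of a member of \<open>y\<close>; by
    well-foundedness these are exactly the \<open>von n\<close>.\<close>
  define N where "N = mk {y \<in> elts x. \<forall>z\<in>elts (mk (insert y (elts y))).
     z = mk {} \<or> (\<exists>w\<in>elts y. succ z w)}"
  have "N \<in> V" unfolding N_def succ_def
    by (rule T_in_V1[where h = "\<lambda>x. mk {y \<in> elts x. \<forall>z\<in>elts (mk (insert y (elts y))).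
     z = mk {} \<or> (\<exists>w\<in>elts y. (\<forall>u\<in>elts z. u \<in> elts w \<or> u = w) \<and> (\<forall>u\<in>elts w. u \<in> elts z) \<and> w \<in> elts z)}", OF _ x(1)])
      (intro def_intros)
  have N: "elts N = {y \<in> elts x. \<forall>z\<in>elts (mk (insert y (elts y))). z = mk {} \<or> (\<exists>w\<in>elts y. succ z w)}"
    unfolding N_def by (rule elts_mk_subset) blast
  have "elts N = range von"
  proof (intro equalityI subsetI)
    fix y assume y: "y \<in> elts N"
    have "z \<in> range von" if "z \<in> insert y (elts y)" for z
      using that
    proof (induction z rule: wf_induct[OF wf_elts])
      case (1 z)
      then consider "z = mk {}" | w where "w \<in> elts y" "z = mk (insert w (elts w))"
        using y unfolding N succ by auto
      then show ?case
      proof cases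
        case 1
        then have "z = von 0" by simp
        then show ?thesis by (rule range_eqI)
      next
        case (2 w)
        then have "w \<in> range von" using 1(1) by simp
        then obtain n where "w = von n" by blast
        then have "z = von (Suc n)" using 2 by simp
        then show ?thesis by (rule range_eqI)
      qed
    qed
    then show "y \<in> range von" by blast
  next
    fix y :: "'k hset" assume "y \<in> range von"
    then obtain n where n: "y = von n" by blast
    have *: "von m = mk {} \<or> (\<exists>w\<in>elts (von n). succ (von m) w)" if "m \<le> n" for m
    proof (cases m)
      case (Suc k)
      then have "von k \<in> elts (von n)" using that by (simp add: elts_von)
      then show ?thesis using Suc unfolding succ by auto
    qed simp
    moreover have "\<exists>m\<le>n. z = von m" if "z \<in> insert (von n) (elts (von n))" for z :: "'k hset"
      using that by (auto simp: elts_von simp del: von.simps intro: less_imp_le)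
    ultimately show "y \<in> elts N" unfolding N n elts_mk_insert
      using von_x[of n] by blast
  qed
  then have "N = omega" by (metis elts_omega mk_elts)
  with \<open>N \<in> V\<close> show ?thesis by simp
qed

lemmas T_omega [def_intros] = T_const[OF omega_in_V]

definition cprod :: "'k hset \<Rightarrow> 'k hset \<Rightarrow> 'k hset" where
  "cprod a b = mk (\<Union>x\<in>elts a. elts (mk ((\<lambda>y. opair x y) ` elts b)))"

lemma T_cprod [def_intros]: "T t \<Longrightarrow> T u \<Longrightarrow> T (\<lambda>e. cprod (t e) (u e))"
proof (rule T_subst2[where h = cprod])
  show "T (\<lambda>e. cprod (e 0) (e 1))" unfolding cprod_def by (intro def_intros)
qed

lemmas cprod_in_V = T_in_V2[where h = cprod, OF T_cprod[OF T_var T_var]]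

lemma elts_cprod:
  assumes "a \<in> V" "b \<in> V"
  shows "elts (cprod a b) = {opair x y | x y. x \<in> elts a \<and> y \<in> elts b}"
proof -
  have "T (\<lambda>e. mk ((\<lambda>y. opair (e 0) y) ` elts b))" by (intro def_intros T_const assms)
  from elts_mk_UN[OF assms(1) this] show ?thesis
    unfolding cprod_def elts_mk_image by auto
qed

lemma elts_seq_image: "elts (seq xs) = (\<lambda>i. opair (von i) (xs ! i)) ` {..<length xs}"
  by (auto simp: elts_seq)

lemma seq_in_V: "set xs \<subseteq> V \<Longrightarrow> seq xs \<in> V"
proof (induction xs rule: rev_induct)
  case Nil
  have "seq [] = (mk {} :: 'k hset)" unfolding seq_def by simp
  then show ?case using empty_in_V by simp
next
  case (snoc x xs)
  have "elts (seq (xs @ [x])) = insert (opair (von (length xs)) x) (elts (seq xs))"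
    unfolding elts_seq_image by (auto simp: lessThan_Suc nth_append)
  then have "seq (xs @ [x]) = mk (insert (opair (von (length xs)) x) (elts (seq xs)))"
    by (metis mk_elts)
  moreover have V: "opair (von (length xs)) x \<in> V" "seq xs \<in> V" using snoc von_in_V by simp_all
  have "mk (insert (opair (von (length xs)) x) (elts (seq xs))) \<in> V"
    by (rule T_in_V2[where h = "\<lambda>p F. mk (insert p (elts F))", OF _ V]) (intro def_intros)
  ultimately show ?case by simp
qed

lemma seq_fun: "is_fun (seq xs)" "fdom (seq xs) = elts (von (length xs))"
  by (auto simp: is_fun_def fdom_def elts_seq elts_von simp del: von.simps)

lemma app_seq: "i < length xs \<Longrightarrow> app (seq xs) (von i) = xs ! i"
  by (rule app_eq[OF seq_fun(1)]) (auto simp: elts_seq)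

lemma dom_of_seq: "set xs \<subseteq> V \<Longrightarrow> dom_of (seq xs) = von (length xs)"
  using elts_dom_of[OF seq_in_V, of xs] by (simp add: seq_fun elts_inject)

lemma ap_seq: "set xs \<subseteq> V \<Longrightarrow> i < length xs \<Longrightarrow> ap (seq xs) (von i) = xs ! i"
  using ap_app[OF seq_in_V seq_fun(1)] app_seq by (simp add: seq_fun elts_von)

lemma seq_exI:
  fixes s :: "'k hset"
  assumes "is_fun s" "fdom s = elts (von n)" "\<And>x. x \<in> fdom s \<Longrightarrow> P (app s x)"
  shows "\<exists>xs. s = seq xs \<and> length xs = n \<and> (\<forall>x\<in>set xs. P x)"
proof (intro exI conjI)
  let ?xs = "map (\<lambda>i. app s (von i)) [0..<n]"
  show "s = seq ?xs"
    by (rule fun_eqI[OF assms(1) seq_fun(1)])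
      (auto simp: seq_fun assms(2) elts_von app_seq)
  show "length ?xs = n" by simp
  show "\<forall>x\<in>set ?xs. P x" using assms(2,3) by (auto simp: elts_von)
qed

definition fin_seqs :: "'k hset \<Rightarrow> 'k hset" where
  "fin_seqs X = mk {seq xs | xs. set xs \<subseteq> elts X}"

text \<open>Every HOL list of elements of \<open>X\<close> is represented by a sequence in
  \<open>V\<close>, so taking the power set inside \<open>V\<close> loses none: a finite sequence is
  a function in that power set whose domain is a natural number.\<close>

lemma fin_seqs:
  assumes X: "X \<in> V"
  shows "fin_seqs X \<in> V" "elts (fin_seqs X) = {seq xs | xs. set xs \<subseteq> elts X}"
proof -
  have T: "T (\<lambda>e. mk {s \<in> elts (Pow_V (cprod omega (e 0))). is_fun s \<and> dom_of s \<in> elts omega})"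
    by (intro def_intros)
  have "elts (mk {s \<in> elts (Pow_V (cprod omega X)). is_fun s \<and> dom_of s \<in> elts omega}) =
      {s \<in> elts (Pow_V (cprod omega X)). is_fun s \<and> dom_of s \<in> elts omega}"
    by (rule elts_mk_subset) blast
  also have "\<dots> = {seq xs | xs. set xs \<subseteq> elts X}" (is "?A = ?B")
  proof (intro equalityI subsetI)
    fix s assume "s \<in> ?A"
    then have s: "s \<in> V" "elts s \<subseteq> elts (cprod omega X)" "is_fun s" "dom_of s \<in> elts omega"
      unfolding Pow_in_V(2)[OF cprod_in_V[OF omega_in_V X]] by auto
    obtain n where n: "dom_of s = von n" using s(4) by (auto simp: elts_omega)
    have "app s x \<in> elts X" if "x \<in> fdom s" for x
      using opair_app[OF s(3) that] s(2) by (auto simp: elts_cprod[OF omega_in_V X])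
    then have "\<exists>xs. s = seq xs \<and> length xs = n \<and> (\<forall>x\<in>set xs. x \<in> elts X)"
      using n elts_dom_of[OF s(1)] by (intro seq_exI[OF s(3)]) simp_all
    then show "s \<in> ?B" by blast
  next
    fix s assume "s \<in> ?B"
    then obtain xs where xs: "s = seq xs" "set xs \<subseteq> elts X" by blast
    then have V: "set xs \<subseteq> V" using V_elts[OF X] by blast
    have "elts (seq xs) \<subseteq> elts (cprod omega X)"
      using xs(2) nth_mem[of _ xs]
      by (auto simp: elts_seq elts_cprod[OF omega_in_V X] elts_omega simp del: nth_mem)
    then show "s \<in> ?A"
      using xs V seq_in_V[OF V] seq_fun(1) Pow_in_V(2)[OF cprod_in_V[OF omega_in_V X]]
      by (simp add: dom_of_seq elts_omega)
  qed
  finally have "fin_seqs X = mk {s \<in> elts (Pow_V (cprod omega X)). is_fun s \<and> dom_of s \<in> elts omega}"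
    and e: "elts (mk {s \<in> elts (Pow_V (cprod omega X)). is_fun s \<and> dom_of s \<in> elts omega}) =
      {seq xs | xs. set xs \<subseteq> elts X}"
    unfolding fin_seqs_def by (metis mk_elts)+
  then show "fin_seqs X \<in> V" "elts (fin_seqs X) = {seq xs | xs. set xs \<subseteq> elts X}"
    using T_in_V1[OF T X] by simp_all
qed

subsection \<open>Collection\<close>

text \<open>For \<open>x\<close> in \<open>V\<close> this is the stage of the cumulative hierarchy
  of \<open>V\<close> just above the rank of \<open>x\<close>: \<open>y \<in> elts (lev x)\<close>
  says that \<open>y\<close> has rank at most that of \<open>x\<close>. Ranks are thus compared
  without introducing ordinals for them.\<close>

function lev :: "'k hset \<Rightarrow> 'k hset" where
  "lev x = Pow_V (mk (\<Union>y\<in>elts x. elts (lev y)))"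
  by pat_completeness auto
termination
  by (relation "{(x, y). x \<in> elts y}") (auto intro: wf_elts)

declare lev.simps [simp del]

lemma T_lev: "T (\<lambda>e. lev (e 0))"
proof (rule T_rec)
  show "T (\<lambda>e. Pow_V (mk (\<Union>y\<in>elts (e 0). elts (ap (e 1) y))))" by (intro def_intros)
  fix x f :: "'k hset"
  assume "\<And>z. (z, x) \<in> {(x, y). x \<in> elts y}\<^sup>+ \<Longrightarrow> ap f z = lev z"
  then have "ap f z = lev z" if "z \<in> elts x" for z using that by blast
  then show "lev x = Pow_V (mk (\<Union>y\<in>elts x. elts (ap f y)))" by (subst lev.simps) simp
qed

lemma lev_iff:
  assumes "x \<in> V"
  shows "y \<in> elts (lev x) \<longleftrightarrow> y \<in> V \<and> (\<forall>w\<in>elts y. \<exists>z\<in>elts x. w \<in> elts (lev z))"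
proof -
  have "mk (\<Union>y\<in>elts x. elts (lev y)) \<in> V"
    by (rule T_in_V1[where h = "\<lambda>x. mk (\<Union>y\<in>elts x. elts (lev y))", OF _ assms])
      (intro def_intros T_lev)
  then show ?thesis
    by (subst lev.simps) (auto simp: Pow_in_V(2) elts_mk_UN[OF assms T_lev])
qed

lemma lev_mono: "z \<in> V \<Longrightarrow> y \<in> elts (lev z) \<Longrightarrow> elts (lev y) \<subseteq> elts (lev z)"
proof (induction z arbitrary: y rule: wf_induct[OF wf_elts])
  case (1 z)
  have y: "y \<in> V" using 1(3) lev_iff[OF 1(2)] by blast
  show ?case
  proof
    fix u assume "u \<in> elts (lev y)"
    then have u: "u \<in> V" "\<forall>w\<in>elts u. \<exists>y'\<in>elts y. w \<in> elts (lev y')" using lev_iff[OF y] by blast+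
    have "\<exists>z'\<in>elts z. w \<in> elts (lev z')" if w: "w \<in> elts u" for w
    proof -
      obtain y' where y': "y' \<in> elts y" "w \<in> elts (lev y')" using u w by blast
      obtain z' where z': "z' \<in> elts z" "y' \<in> elts (lev z')" using 1(3) lev_iff[OF 1(2)] y' by blast
      have "elts (lev y') \<subseteq> elts (lev z')" using 1(1) z' V_elts[OF 1(2)] by simp
      then show ?thesis using z' y' by blast
    qed
    then show "u \<in> elts (lev z)" using lev_iff[OF 1(2)] u(1) by blast
  qed
qed

text \<open>Totality of the comparison of ranks, where having rank below \<open>y\<close> is
  expressed as having rank at most that of some member of \<open>y\<close>.\<close>

lemma lev_linear: "y \<in> V \<Longrightarrow> z \<in> V \<Longrightarrow> y \<notin> elts (lev z) \<Longrightarrow> \<exists>w\<in>elts y. z \<in> elts (lev w)"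
proof (induction y arbitrary: z rule: wf_induct[OF wf_elts])
  case (1 y)
  obtain w where w: "w \<in> elts y" "\<forall>z'\<in>elts z. w \<notin> elts (lev z')"
    using 1 lev_iff by blast
  have "w \<in> V" by (rule V_elts[OF 1(2) w(1)])
  then have "\<exists>u\<in>elts w. z' \<in> elts (lev u)" if "z' \<in> elts z" for z'
    using 1(1) w that V_elts[OF 1(3)] by simp
  then have "z \<in> elts (lev w)" using lev_iff[OF \<open>w \<in> V\<close>] 1(3) by blast
  then show ?case using w(1) by blast
qed

lemma lev_min:
  assumes "z \<in> V" "y \<in> V" "P y" "y \<in> elts (lev z)"
  shows "\<exists>y\<in>V. P y \<and> (\<forall>y'\<in>V. P y' \<longrightarrow> y \<in> elts (lev y'))"
  using assms
proof (induction z arbitrary: y rule: wf_induct[OF wf_elts])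
  case (1 z)
  show ?case
  proof (cases "\<exists>z'\<in>elts z. \<exists>y\<in>V. P y \<and> y \<in> elts (lev z')")
    case True
    then obtain z' y1 where "z' \<in> elts z" "y1 \<in> V" "P y1" "y1 \<in> elts (lev z')" by blast
    then show ?thesis using 1(1) V_elts[OF 1(2)] by blast
  next
    \<comment> \<open>No witness of \<open>P\<close> has rank at most that of a member of
      \<open>z\<close>. By linearity every witness then outranks all members of \<open>z\<close>, so
      its rank is at least that of \<open>z\<close> and hence at least that of
      \<open>y\<close>.\<close>
    case False
    have "y \<in> elts (lev y')" if y': "y' \<in> V" "P y'" for y'
    proof -
      have *: "\<exists>w\<in>elts y'. z' \<in> elts (lev w)" if z': "z' \<in> elts z" for z'
        using lev_linear[OF y'(1) V_elts[OF 1(2) z']] False y' z' by blast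
      have "\<exists>w\<in>elts y'. u \<in> elts (lev w)" if u: "u \<in> elts y" for u
      proof -
        obtain z' where z': "z' \<in> elts z" "u \<in> elts (lev z')" using 1(5) lev_iff[OF 1(2)] u by blast
        obtain w where w: "w \<in> elts y'" "z' \<in> elts (lev w)" using * z' by blast
        show ?thesis using lev_mono[OF V_elts[OF y'(1) w(1)] w(2)] z' w by blast
      qed
      then show ?thesis using lev_iff[OF y'(1)] 1(3) by blast
    qed
    then show ?thesis using 1 by blast
  qed
qed

lemma lev_self: "y \<in> V \<Longrightarrow> y \<in> elts (lev y)"
proof (induction y rule: wf_induct[OF wf_elts])
  case (1 y)
  then have "w \<in> elts (lev w)" if "w \<in> elts y" for w using that V_elts[OF 1(2)] by simp
  then show ?case using lev_iff[OF 1(2)] 1(2) by blast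
qed

text \<open>Scott's trick: only witnesses of least rank are collected.\<close>

lemma collection:
  assumes Q: "D (\<lambda>e. Q (e 0) (e 1))" and a: "a \<in> V"
  obtains b where "b \<in> V" "\<forall>x\<in>elts a. (\<exists>y\<in>V. Q x y) \<longrightarrow> (\<exists>y\<in>elts b. Q x y)"
proof -
  define R where "R x y \<longleftrightarrow> Q x y \<and> (\<forall>y'\<in>V. Q x y' \<longrightarrow> y \<in> elts (lev y'))" for x y
  have D_R: "D (\<lambda>e. R (e 0) (e 1))"
    unfolding R_def by (intro def_intros D_subst2[OF Q] T_subst1[OF T_lev])
  define M where "M x = mk {y \<in> V. R x y}" for x
  have M: "M x \<in> V \<and> elts (M x) = {y \<in> V. R x y}" if "x \<in> V" for x
  proof (cases "\<exists>y0\<in>V. Q x y0")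
    case False
    then have "{y \<in> V. R x y} = {}" unfolding R_def by blast
    then show ?thesis unfolding M_def using empty_in_V by (simp only: elts_mk_empty)
  next
    case True
    then obtain y0 where y0: "y0 \<in> V" "Q x y0" by blast
    have sub: "{y \<in> V. R x y} \<subseteq> elts (lev y0)" using y0 by (auto simp: R_def)
    then have eq: "{y \<in> V. R x y} = {y \<in> elts (lev y0). R x y}"
      using V_elts[OF T_in_V1[OF T_lev y0(1)]] by blast
    have "mk {y \<in> elts (lev y0). R x y} \<in> V"
    proof (rule sep_ex[where Q = "\<lambda>y e. R (e 0) y" and e = "\<lambda>_. x"])
      show "D (\<lambda>e. R (e (Suc 0)) (e 0))" by (intro D_subst2[OF D_R] def_intros)
    qed (simp_all add: T_in_V1[OF T_lev y0(1)] \<open>x \<in> V\<close>)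
    then show ?thesis unfolding M_def eq[symmetric] using elts_mk_subset[OF sub] by blast
  qed
  have T_M: "T (\<lambda>e. M (e 0))"
  proof (rule T_ext)
    show "M (e 0) \<in> V" if "env e" for e using that M by blast
    show "D (\<lambda>e. e 0 \<in> elts (M (e (Suc 0))))"
    proof (rule D_cong)
      show "D (\<lambda>e. R (e (Suc 0)) (e 0))" by (intro D_subst2[OF D_R] def_intros)
    qed (use M in auto)
  qed
  show thesis
  proof (rule that)
    show "mk (\<Union>x\<in>elts a. elts (M x)) \<in> V"
      by (rule T_in_V1[where h = "\<lambda>a. mk (\<Union>x\<in>elts a. elts (M x))", OF _ a]) (intro def_intros T_M)
    show "\<forall>x\<in>elts a. (\<exists>y\<in>V. Q x y) \<longrightarrow> (\<exists>y\<in>elts (mk (\<Union>x\<in>elts a. elts (M x))). Q x y)"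
    proof (intro ballI impI)
      fix x assume x: "x \<in> elts a" "\<exists>y\<in>V. Q x y"
      then obtain y where "y \<in> V" "R x y"
        using lev_min[where P = "Q x"] lev_self unfolding R_def by metis
      then have "y \<in> elts (M x)" using M V_elts[OF a x(1)] by blast
      then show "\<exists>y\<in>elts (mk (\<Union>x\<in>elts a. elts (M x))). Q x y"
        using \<open>R x y\<close> x(1) unfolding elts_mk_UN[OF a T_M] R_def by blast
    qed
  qed
qed

end

section \<open>Codes and their interpretation inside the model\<close>

locale code_model = set_model V for V :: "'k hset set" +
  fixes \<kappa> L X :: "'k hset"
  assumes kappa: "\<kappa> \<in> V" "ordinal \<kappa>" "infinite (elts \<kappa>)"
    and X: "X \<in> V" "infinite (elts X)"
    and L: "L \<in> V" "relational_language L"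
    and Str_nonempty: "Str V L X \<noteq> {}"
begin

abbreviation FS :: "'k hset" where "FS \<equiv> fin_seqs X"

lemma FS: "FS \<in> V" "elts FS = {seq xs | xs. set xs \<subseteq> elts X}"
  using fin_seqs[OF X(1)] by auto

lemma fin_seqs_omega: "fin_seqs omega \<in> V" "elts (fin_seqs omega) = {seq (map von vs) | vs. True}"
proof -
  show "fin_seqs omega \<in> V" by (rule fin_seqs[OF omega_in_V])
  have "set xs \<subseteq> range von \<longleftrightarrow> (\<exists>vs. xs = map von vs)" for xs :: "'k hset list"
    by (subst ex_map_conv) auto
  then show "elts (fin_seqs omega) = {seq (map von vs) | vs. True}"
    unfolding fin_seqs(2)[OF omega_in_V] elts_omega by auto
qed

lemma elts_X_V: "set xs \<subseteq> elts X \<Longrightarrow> set xs \<subseteq> V"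
  using V_elts[OF X(1)] by blast

lemma von_vs_V: "set (map von vs) \<subseteq> V"
  using von_in_V by auto

lemma arity_ex: "R \<in> fdom L \<Longrightarrow> \<exists>n. opair R (von n) \<in> elts L \<and> ap L R = von n"
proof -
  assume R: "R \<in> fdom L"
  have fL: "is_fun L" using L(2) by (simp add: relational_language_def)
  have "app L R \<in> range von" using L(2) R by (simp add: relational_language_def elts_omega)
  then obtain n where n: "app L R = von n" by blast
  have "opair R (von n) \<in> elts L" using opair_app[OF fL R] n by simp
  then show ?thesis using ap_eq[OF L(1) fL] by blast
qed

lemma arity_iff: "opair R (von n) \<in> elts L \<longleftrightarrow> R \<in> fdom L \<and> ap L R = von n"
proof
  have fL: "is_fun L" using L(2) by (simp add: relational_language_def)
  show "R \<in> fdom L \<and> ap L R = von n" if "opair R (von n) \<in> elts L"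
    using ap_eq[OF L(1) fL that] that by (auto simp: fdom_def)
  show "opair R (von n) \<in> elts L" if "R \<in> fdom L \<and> ap L R = von n"
    using arity_ex[of R] that by auto
qed

definition Sg :: "'k hset" where "Sg = mk (Str V L X)"

lemma Sg: "Sg \<in> V" "elts Sg = Str V L X"
proof -
  \<comment> \<open>Membership in \<open>Str\<close> rephrased by operations of \<open>V\<close>:
    the length of a tuple becomes its domain, which is compared with the arity
    \<open>ap L R\<close>.\<close>
  let ?P = "\<lambda>M. \<exists>I\<in>V. M = opair X I \<and> is_fun I \<and> dom_of I = dom_of L \<and>
    (\<forall>R\<in>elts (dom_of L). \<forall>s\<in>elts (ap I R). s \<in> elts FS \<and> dom_of s = ap L R)"
  \<comment> \<open>A set of \<open>V\<close> large enough to contain all structures, for separation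
    to cut down: the interpretation part is a set of pairs of a symbol and a set of finite
    sequences.\<close>
  let ?B = "cprod (mk {X}) (Pow_V (cprod (dom_of L) (Pow_V FS)))"
  note cst = T_const[OF X(1)] T_const[OF L(1)] T_const[OF FS(1)]
  have Str: "M \<in> Str V L X \<longleftrightarrow> M \<in> V \<and> ?P M" for M
  proof -
    define J K where "J I \<longleftrightarrow> is_fun I \<and> fdom I = fdom L \<and> (\<forall>R n. opair R (von n) \<in> elts L \<longrightarrow>
          elts (app I R) \<subseteq> {seq xs | xs. length xs = n \<and> set xs \<subseteq> elts X})"
      and "K I \<longleftrightarrow> is_fun I \<and> dom_of I = dom_of L \<and>
        (\<forall>R\<in>elts (dom_of L). \<forall>s\<in>elts (ap I R). s \<in> elts FS \<and> dom_of s = ap L R)" for I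
    have JK: "J I \<longleftrightarrow> K I" if I: "I \<in> V" for I
    proof -
      have dom: "dom_of I = dom_of L \<longleftrightarrow> fdom I = fdom L"
        using elts_dom_of[OF I] elts_dom_of[OF L(1)] by (metis mk_elts)
      have *: "(\<forall>n. opair R (von n) \<in> elts L \<longrightarrow>
          elts (app I R) \<subseteq> {seq xs | xs. length xs = n \<and> set xs \<subseteq> elts X}) \<longleftrightarrow>
          (\<forall>s\<in>elts (ap I R). s \<in> elts FS \<and> dom_of s = ap L R)"
        if R: "is_fun I" "fdom I = fdom L" "R \<in> fdom L" for R
      proof -
        obtain n where n: "opair R (von n) \<in> elts L" "ap L R = von n" using arity_ex[OF R(3)] by blast
        have un: "opair R (von m) \<in> elts L \<longleftrightarrow> m = n" for m using n arity_iff[of R] by auto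
        have "s \<in> {seq xs | xs. length xs = n \<and> set xs \<subseteq> elts X} \<longleftrightarrow> s \<in> elts FS \<and> dom_of s = von n" for s
          using dom_of_seq[OF elts_X_V] FS(2) by auto
        then show ?thesis using ap_app[OF I R(1)] R n(2) un by auto
      qed
      have "opair R (von n) \<in> elts L \<Longrightarrow> R \<in> fdom L" for R n by (auto simp: fdom_def)
      then show ?thesis unfolding J_def K_def dom elts_dom_of[OF L(1)] using * by blast
    qed
    have "I \<in> V" if "M \<in> V" "M = opair X I" for I using that by simp
    then have "M \<in> V \<and> (\<exists>I. M = opair X I \<and> J I) \<longleftrightarrow> M \<in> V \<and> (\<exists>I\<in>V. M = opair X I \<and> K I)"
      using JK by blast
    then show ?thesis unfolding Str_def J_def K_def by simp
  qed
  have B: "?B \<in> V" by (rule T_constD) (intro def_intros cst)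
  have V1: "mk {X} \<in> V" by (rule T_constD) (intro def_intros cst)
  have V2: "Pow_V (cprod (dom_of L) (Pow_V FS)) \<in> V" by (rule T_constD) (intro def_intros cst)
  have V3: "cprod (dom_of L) (Pow_V FS) \<in> V" by (rule T_constD) (intro def_intros cst)
  have V4: "Pow_V FS \<in> V" by (rule T_constD) (intro def_intros cst)
  have sub: "M \<in> elts ?B" if M: "M \<in> V" "?P M" for M
  proof -
    obtain I where I: "I \<in> V" "M = opair X I" "is_fun I" "dom_of I = dom_of L"
      "\<forall>R\<in>elts (dom_of L). \<forall>s\<in>elts (ap I R). s \<in> elts FS \<and> dom_of s = ap L R" using M(2) by blast
    have "z \<in> elts (cprod (dom_of L) (Pow_V FS))" if z: "z \<in> elts I" for z
    proof -
      obtain R y where Ry: "z = opair R y" using I(3) z unfolding is_fun_def by blast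
      have R: "R \<in> elts (dom_of L)"
        using z Ry elts_dom_of[OF I(1)] I(4) by (auto simp: fdom_def)
      have "y \<in> V" using V_elts[OF I(1) z] Ry by simp
      moreover have "ap I R = y" using ap_eq[OF I(1,3)] z Ry by simp
      ultimately have "y \<in> elts (Pow_V FS)" using I(5) R Pow_in_V(2)[OF FS(1)] by blast
      then show ?thesis unfolding elts_cprod[OF dom_of_in_V[OF L(1)] V4] using R Ry by blast
    qed
    then have "I \<in> elts (Pow_V (cprod (dom_of L) (Pow_V FS)))"
      unfolding Pow_in_V(2)[OF V3] using I(1) by blast
    then show ?thesis unfolding elts_cprod[OF V1 V2] using I(2) by simp
  qed
  have eq: "Str V L X = {M \<in> elts ?B. ?P M}"
    using Str sub V_elts[OF B] by blast
  have "mk {M \<in> elts ?B. ?P M} \<in> V"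
    by (rule T_constD) (intro def_intros cst)
  moreover have "elts (mk {M \<in> elts ?B. ?P M}) = {M \<in> elts ?B. ?P M}"
    by (rule elts_mk_subset) blast
  ultimately show "Sg \<in> V" "elts Sg = Str V L X" unfolding Sg_def eq by auto
qed

lemmas T_consts [def_intros] = T_const[OF X(1)] T_const[OF L(1)] T_const[OF kappa(1)]
  T_const[OF FS(1)] T_const[OF fin_seqs_omega(1)] T_const[OF Sg(1)]

lemma StrE:
  assumes "M \<in> elts Sg"
  obtains I where "M = opair X I" "I \<in> V" "is_fun I" "fdom I = fdom L"
    "\<And>R n. opair R (von n) \<in> elts L \<Longrightarrow>
      elts (app I R) \<subseteq> {seq xs | xs. length xs = n \<and> set xs \<subseteq> elts X}"
  using assms unfolding Sg(2) Str_def by auto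

subsection \<open>Literals\<close>

text \<open>A truth table with both truth values \<open>b\<close> recorded. This makes negation an
  exchange of the values, and makes the absence of rows tell apart sets that code no literal, or
  literals whose variables exceed the tuple.\<close>

definition lit_rel :: "'k hset \<Rightarrow> 'k hset \<Rightarrow> 'k hset \<Rightarrow> 'k hset \<Rightarrow> bool" where
  "lit_rel c b M s \<longleftrightarrow> (\<exists>l xs. c = literal_code l \<and> s = seq xs \<and> literal_in L l \<and> M \<in> elts Sg \<and>
     set xs \<subseteq> elts X \<and> (\<forall>v\<in>vars l. v < length xs) \<and> b = von (of_bool (literal_sat M xs l)))"

definition lit_graph :: "'k hset \<Rightarrow> 'k hset" where
  "lit_graph c = mk {opair b (opair M s) | b M s. lit_rel c b M s}"

definition seq_comp :: "'k hset \<Rightarrow> 'k hset \<Rightarrow> 'k hset" where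
  "seq_comp s v = mk ((\<lambda>i. opair i (ap s (ap v i))) ` elts (dom_of v))"

lemma T_seq_comp [def_intros]: "T t \<Longrightarrow> T u \<Longrightarrow> T (\<lambda>e. seq_comp (t e) (u e))"
proof (rule T_subst2[where h = seq_comp])
  show "T (\<lambda>e. seq_comp (e 0) (e 1))" unfolding seq_comp_def by (intro def_intros)
qed

lemma seq_comp:
  assumes "set xs \<subseteq> V" "\<And>v. v \<in> set vs \<Longrightarrow> v < length xs"
  shows "seq_comp (seq xs) (seq (map von vs)) = seq (map (\<lambda>v. xs ! v) vs)"
proof -
  have "elts (dom_of (seq (map von vs))) = von ` {..<length vs}"
    using dom_of_seq[OF von_vs_V] by (simp add: elts_von)
  moreover have "ap (seq xs) (ap (seq (map von vs)) (von i)) = xs ! (vs ! i)" if "i < length vs" for i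
    using ap_seq[OF von_vs_V, of i vs] ap_seq[OF assms(1), of "vs ! i"] assms(2)[of "vs ! i"] that by simp
  ultimately have "elts (seq_comp (seq xs) (seq (map von vs))) = elts (seq (map (\<lambda>v. xs ! v) vs))"
    unfolding seq_comp_def elts_mk_image elts_seq_image by (simp add: image_image)
  then show ?thesis by (simp only: elts_inject)
qed

text \<open>The recursion clause of \<open>lit_graph\<close>, one disjunct for each constructor;
  \<open>f\<close> supplies the table of the negated literal, whose rows are reused with the
  opposite truth value.\<close>

definition lit_step :: "'k hset \<Rightarrow> 'k hset \<Rightarrow> 'k hset \<Rightarrow> 'k hset \<Rightarrow> 'k hset \<Rightarrow> bool" where
  "lit_step c f b M s \<longleftrightarrow>
    (\<exists>R\<in>elts (dom_of L). \<exists>v\<in>elts (fin_seqs omega). c = opair (von 0) (opair R v) \<and>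
       dom_of v = ap L R \<and> (\<forall>i\<in>elts (dom_of v). ap v i \<in> elts (dom_of s)) \<and>
       (\<exists>I\<in>V. M = opair X I \<and> (b = von 1 \<longleftrightarrow> seq_comp s v \<in> elts (ap I R)))) \<or>
    (\<exists>i\<in>elts (dom_of s). \<exists>j\<in>elts (dom_of s). c = opair (von 1) (opair i j) \<and>
       (b = von 1 \<longleftrightarrow> ap s i = ap s j)) \<or>
    (\<exists>d\<in>V. c = opair (von 2) d \<and>
       opair (if b = von 0 then von 1 else von 0) (opair M s) \<in> elts (ap f d))"

lemma lit_bound: "lit_rel c b M s \<Longrightarrow> opair b (opair M s) \<in> elts (cprod (von 2) (cprod Sg FS))"
proof -
  assume "lit_rel c b M s"
  then have "b \<in> elts (von 2)" "M \<in> elts Sg" "s \<in> elts FS"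
    unfolding lit_rel_def FS(2) by (auto simp: elts_von)
  then show ?thesis
    by (simp add: elts_cprod[OF von_in_V cprod_in_V[OF Sg(1) FS(1)]] elts_cprod[OF Sg(1) FS(1)])
qed

lemma elts_lit_graph: "elts (lit_graph c) = {opair b (opair M s) | b M s. lit_rel c b M s}"
  unfolding lit_graph_def by (rule elts_mk_subset[of _ "cprod (von 2) (cprod Sg FS)"]) (use lit_bound in blast)

lemma lit_rel_iff:
  assumes "c \<in> V" and f: "\<And>d. c = opair (von 2) d \<Longrightarrow> ap f d = lit_graph d"
  shows "lit_rel c b M s \<longleftrightarrow> b \<in> elts (von 2) \<and> M \<in> elts Sg \<and> s \<in> elts FS \<and> lit_step c f b M s"
    (is "_ \<longleftrightarrow> ?rhs")
proof -
  have two: "elts (von 2) = {von 0, von 1 :: 'k hset}"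
    by (auto simp: elts_von lessThan_Suc numeral_2_eq_2 simp del: von.simps)
  have app_ap: "app (osnd M) R = ap I R" if "M \<in> elts Sg" "M = opair X I" "R \<in> fdom L" for I R
    using that ap_app by (elim StrE) auto
  show ?thesis
  proof
    assume "lit_rel c b M s"
    then obtain l xs where l: "c = literal_code l" "s = seq xs" "literal_in L l" "M \<in> elts Sg"
      "set xs \<subseteq> elts X" "\<forall>v\<in>vars l. v < length xs" and b: "b = von (of_bool (literal_sat M xs l))"
      unfolding lit_rel_def by blast
    have xsV: "set xs \<subseteq> V" by (rule elts_X_V[OF l(5)])
    have "lit_step c f b M s"
    proof (cases l)
      case (Rel R vs)
      have R: "R \<in> fdom L" "ap L R = von (length vs)" using l(3) Rel arity_iff by auto
      obtain I where I: "M = opair X I" "I \<in> V" using l(4) by (rule StrE)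
      have vs: "v < length xs" if "v \<in> set vs" for v using l(6) Rel that by simp
      have "ap (seq (map von vs)) i \<in> elts (dom_of s)" if i: "i \<in> elts (dom_of (seq (map von vs)))" for i
      proof -
        obtain k where k: "k < length vs" "i = von k"
          using i unfolding dom_of_seq[OF von_vs_V] by (auto simp: elts_von)
        then show ?thesis using ap_seq[OF von_vs_V, of k vs] vs[of "vs ! k"] dom_of_seq[OF xsV] l(2)
          by (simp add: elts_von)
      qed
      moreover have "b = von 1 \<longleftrightarrow> seq_comp s (seq (map von vs)) \<in> elts (ap I R)"
        using b Rel app_ap[OF l(4) I(1) R(1)] seq_comp[OF xsV vs] l(2) by (simp add: von_inject del: von.simps)
      moreover have "R \<in> elts (dom_of L)" "seq (map von vs) \<in> elts (fin_seqs omega)"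
        "c = opair (von 0) (opair R (seq (map von vs)))" "dom_of (seq (map von vs)) = ap L R"
        using R elts_dom_of[OF L(1)] fin_seqs_omega(2) l(1) Rel dom_of_seq[OF von_vs_V, of vs] by auto
      ultimately show ?thesis unfolding lit_step_def using I by blast
    next
      case (Equal i j)
      have "von i \<in> elts (dom_of s)" "von j \<in> elts (dom_of s)"
        using l(6) Equal dom_of_seq[OF xsV] l(2) by (auto simp: elts_von)
      moreover have "b = von 1 \<longleftrightarrow> ap s (von i) = ap s (von j)"
        using b Equal l(2,6) ap_seq[OF xsV] by (simp add: von_inject del: von.simps)
      moreover have "c = opair (von 1) (opair (von i) (von j))" using l(1) Equal by simp
      ultimately show ?thesis unfolding lit_step_def by blast
    next
      case (Neg l')
      have c: "c = opair (von 2) (literal_code l')" using l(1) Neg by simp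
      then have "literal_code l' \<in> V" using assms(1) by simp
      moreover have "lit_rel (literal_code l') (if b = von 0 then von 1 else von 0) M s"
        unfolding lit_rel_def using l Neg b
        by (intro exI[of _ l'] exI[of _ xs]) (auto simp: von_inject simp del: von.simps)
      then have "opair (if b = von 0 then von 1 else von 0) (opair M s) \<in> elts (ap f (literal_code l'))"
        unfolding f[OF c] elts_lit_graph by blast
      ultimately show ?thesis unfolding lit_step_def using c by blast
    qed
    then show ?rhs using l b by (auto simp: two FS(2) simp del: von.simps)
  next
    assume rhs: ?rhs
    then have b: "b = von 0 \<or> b = von 1" and M: "M \<in> elts Sg" and step: "lit_step c f b M s"
      by (auto simp: two)
    obtain xs where xs: "s = seq xs" "set xs \<subseteq> elts X" using rhs FS(2) by blast
    have xsV: "set xs \<subseteq> V" by (rule elts_X_V[OF xs(2)])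
    have dom_s: "elts (dom_of s) = von ` {..<length xs}" using dom_of_seq[OF xsV] xs(1) by (simp add: elts_von)
    have main: "lit_rel c b M s"
      if "c = literal_code l" "literal_in L l" "\<forall>v\<in>vars l. v < length xs" "b = von 1 \<longleftrightarrow> literal_sat M xs l" for l
    proof -
      have "b = von (of_bool (literal_sat M xs l))" using b that(4) by (auto simp del: von.simps)
      then show ?thesis unfolding lit_rel_def using that xs M by blast
    qed
    from step consider
      (Rel) R v I where "R \<in> elts (dom_of L)" "v \<in> elts (fin_seqs omega)" "c = opair (von 0) (opair R v)"
        "dom_of v = ap L R" "\<forall>i\<in>elts (dom_of v). ap v i \<in> elts (dom_of s)"
        "M = opair X I" "b = von 1 \<longleftrightarrow> seq_comp s v \<in> elts (ap I R)"
    | (Equal) i j where "i \<in> elts (dom_of s)" "j \<in> elts (dom_of s)" "c = opair (von 1) (opair i j)"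
       "b = von 1 \<longleftrightarrow> ap s i = ap s j"
    | (Neg) d where "c = opair (von 2) d" "opair (if b = von 0 then von 1 else von 0) (opair M s) \<in> elts (ap f d)"
      unfolding lit_step_def by blast
    then show "lit_rel c b M s"
    proof cases
      case Rel
      obtain vs where vs: "v = seq (map von vs)" using Rel(2) fin_seqs_omega(2) by blast
      have R: "R \<in> fdom L" using Rel(1) elts_dom_of[OF L(1)] by blast
      have len: "ap L R = von (length vs)" using Rel(4) dom_of_seq[OF von_vs_V, of vs] vs by simp
      have vl: "w < length xs" if w: "w \<in> set vs" for w
      proof -
        obtain k where k: "k < length vs" "w = vs ! k" using w by (auto simp: in_set_conv_nth)
        then have "von k \<in> elts (dom_of v)" using Rel(4) len by (simp add: elts_von)
        then have "ap v (von k) \<in> elts (dom_of s)" using Rel(5) by blast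
        then show ?thesis using ap_seq[OF von_vs_V, of k vs] vs k dom_s by (auto simp del: von.simps)
      qed
      show ?thesis
      proof (rule main[of "literal.Rel R vs"])
        show "c = literal_code (literal.Rel R vs)" using Rel(3) vs by simp
        show "literal_in L (literal.Rel R vs)" using arity_iff R len by simp
        show "\<forall>v\<in>vars (literal.Rel R vs). v < length xs" using vl by simp
        show "b = von 1 \<longleftrightarrow> literal_sat M xs (literal.Rel R vs)"
          using Rel(7) app_ap[OF M Rel(6) R] seq_comp[OF xsV vl] vs xs(1) by (simp del: von.simps)
      qed
    next
      case Equal
      then obtain p q where pq: "i = von p" "j = von q" "p < length xs" "q < length xs" using dom_s by auto
      show ?thesis
      proof (rule main[of "literal.Equal p q"])
        show "b = von 1 \<longleftrightarrow> literal_sat M xs (literal.Equal p q)"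
          using Equal(4) pq ap_seq[OF xsV] xs(1) by (simp del: von.simps)
      qed (use Equal pq in \<open>simp_all del: von.simps\<close>)
    next
      case Neg
      have "lit_rel d (if b = von 0 then von 1 else von 0) M s"
        using Neg(2) unfolding f[OF Neg(1)] elts_lit_graph by auto
      then obtain l where l: "d = literal_code l" "literal_in L l" "\<forall>v\<in>vars l. v < length xs"
         "(if b = von 0 then von 1 else von 0 :: 'k hset) = von (of_bool (literal_sat M xs l))"
        unfolding lit_rel_def xs(1) by (auto simp del: von.simps)
      show ?thesis
      proof (rule main[of "literal.Neg l"])
        show "b = von 1 \<longleftrightarrow> literal_sat M xs (literal.Neg l)"
          using l(4) b by (auto simp: von_inject simp del: von.simps split: if_splits)
      qed (use Neg(1) l in \<open>simp_all del: von.simps\<close>)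
    qed
  qed
qed

lemma T_lit_graph: "T (\<lambda>e. lit_graph (e 0))"
proof (rule T_rec)
  let ?Phi = "\<lambda>c f. mk {t \<in> elts (cprod (von 2) (cprod Sg FS)).
    \<exists>b\<in>elts (von 2). \<exists>M\<in>elts Sg. \<exists>s\<in>elts FS. t = opair b (opair M s) \<and> lit_step c f b M s}"
  show "T (\<lambda>e. ?Phi (e 0) (e 1))" unfolding lit_step_def by (intro def_intros)
  fix c f :: "'k hset"
  assume c: "c \<in> V" and "f \<in> V"
    and IH: "\<And>z. (z, c) \<in> {(x, y). x \<in> elts y}\<^sup>+ \<Longrightarrow> ap f z = lit_graph z"
  have "ap f d = lit_graph d" if "c = opair (von 2) d" for d
    unfolding that by (rule IH) (simp add: that opair_trancl(2) del: von.simps)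
  from lit_rel_iff[OF c this]
  have iff: "lit_rel c b M s \<longleftrightarrow> b \<in> elts (von 2) \<and> M \<in> elts Sg \<and> s \<in> elts FS \<and> lit_step c f b M s" for b M s
    by blast
  have "{opair b (opair M s) | b M s. lit_rel c b M s} =
    {t \<in> elts (cprod (von 2) (cprod Sg FS)).
    \<exists>b\<in>elts (von 2). \<exists>M\<in>elts Sg. \<exists>s\<in>elts FS. t = opair b (opair M s) \<and> lit_step c f b M s}"
    using lit_bound[of c] unfolding iff by blast
  then show "lit_graph c = ?Phi c f" unfolding lit_graph_def by simp
qed

lemmas T_lit_graph' [def_intros] = T_subst1[OF T_lit_graph]

end

lemma finite_vars: "finite (vars l)"
  by (induction l) simp_all

text \<open>Replaces \<open>LEAST\<close> by a bound and a minimality clause, which is the form that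
  can be expressed inside \<open>V\<close>.\<close>

lemma arity_eq_iff:
  "arity \<phi> = n \<longleftrightarrow> (\<forall>l\<in>set \<phi>. \<forall>v\<in>vars l. v < n) \<and> (\<forall>k<n. \<not> (\<forall>l\<in>set \<phi>. \<forall>v\<in>vars l. v < k))"
proof -
  let ?P = "\<lambda>n. \<forall>l\<in>set \<phi>. \<forall>v\<in>vars l. v < n"
  have "finite (\<Union>l\<in>set \<phi>. vars l)" by (simp add: finite_vars)
  then obtain m where "\<forall>v\<in>(\<Union>l\<in>set \<phi>. vars l). v < m"
    using finite_nat_set_iff_bounded by blast
  then have ex: "?P m" by blast
  show ?thesis
  proof
    assume "arity \<phi> = n"
    then have "n = (LEAST n. ?P n)" by (simp add: arity_def)
    then show "?P n \<and> (\<forall>k<n. \<not> ?P k)" using LeastI[of ?P, OF ex] not_less_Least[of _ ?P] by blast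
  next
    assume n: "?P n \<and> (\<forall>k<n. \<not> ?P k)"
    show "arity \<phi> = n" unfolding arity_def
    proof (rule Least_equality)
      show "?P n" using n by blast
      show "n \<le> y" if "?P y" for y using n that by (meson not_le)
    qed
  qed
qed

lemma image_eq_iff: "f ` A = B \<longleftrightarrow> (\<forall>i\<in>A. f i \<in> B) \<and> (\<forall>y\<in>B. \<exists>i\<in>A. f i = y)"
proof
  assume "(\<forall>i\<in>A. f i \<in> B) \<and> (\<forall>y\<in>B. \<exists>i\<in>A. f i = y)"
  then show "f ` A = B" by (intro equalityI image_subsetI subsetI) (blast, force)
qed (auto simp: image_iff)

context code_model
begin

subsection \<open>Basic codes\<close>

text \<open>Well-formedness read off the truth table: \<open>c\<close> codes a literal of the
  language with all variables below the length of \<open>s\<close> iff the table has some row at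
  \<open>s\<close>.\<close>

definition legal :: "'k hset \<Rightarrow> 'k hset \<Rightarrow> bool" where
  "legal c s \<longleftrightarrow> (\<exists>b\<in>elts (von 2). \<exists>M\<in>elts Sg. opair b (opair M s) \<in> elts (lit_graph c))"

text \<open>The last clause says that no shorter tuple suffices, which forces the length of
  \<open>s\<close> to be the arity of the conjunction.\<close>

definition basic_form :: "'k hset \<Rightarrow> 'k hset \<Rightarrow> bool" where
  "basic_form F s \<longleftrightarrow> is_fun F \<and> dom_of F \<in> elts omega \<and> s \<in> elts FS \<and>
    (\<forall>i\<in>elts (dom_of F). legal (ap F i) s) \<and>
    (\<forall>s'\<in>elts FS. dom_of s' \<in> elts (dom_of s) \<longrightarrow> \<not> (\<forall>i\<in>elts (dom_of F). legal (ap F i) s'))"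

lemma D_basic_form [def_intros]: "T t \<Longrightarrow> T u \<Longrightarrow> D (\<lambda>e. basic_form (t e) (u e))"
proof (rule D_subst2[where h = basic_form])
  show "D (\<lambda>e. basic_form (e 0) (e 1))" unfolding basic_form_def legal_def by (intro def_intros)
qed

lemma legal_iff:
  assumes xs: "set xs \<subseteq> elts X"
  shows "legal c (seq xs) \<longleftrightarrow>
    (\<exists>l. c = literal_code l \<and> literal_in L l \<and> (\<forall>v\<in>vars l. v < length xs))" (is "_ \<longleftrightarrow> ?r")
proof
  assume "legal c (seq xs)"
  then show ?r unfolding legal_def elts_lit_graph lit_rel_def by auto
next
  assume ?r
  then obtain l where l: "c = literal_code l" "literal_in L l" "\<forall>v\<in>vars l. v < length xs" by blast
  \<comment> \<open>Any structure serves as the witness of a row; that there is one at all is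
    \<open>Str_nonempty\<close>.\<close>
  obtain M where M: "M \<in> elts Sg" using Str_nonempty Sg(2) by blast
  let ?b = "von (of_bool (literal_sat M xs l)) :: 'k hset"
  have "lit_rel c ?b M (seq xs)" unfolding lit_rel_def using l M xs by blast
  then have "opair ?b (opair M (seq xs)) \<in> elts (lit_graph c)" unfolding elts_lit_graph by blast
  moreover have "?b \<in> elts (von 2)" by (simp add: elts_von)
  ultimately show "legal c (seq xs)" unfolding legal_def using M by blast
qed

lemma lit_graph_sat:
  assumes "set xs \<subseteq> elts X" "literal_in L l" "\<forall>v\<in>vars l. v < length xs" "M \<in> elts Sg"
  shows "opair (von 1) (opair M (seq xs)) \<in> elts (lit_graph (literal_code l)) \<longleftrightarrow> literal_sat M xs l"
  unfolding elts_lit_graph lit_rel_def using assms by (auto simp del: von.simps)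

lemma seq_V_D: "seq cs \<in> V \<Longrightarrow> set cs \<subseteq> V"
proof
  fix c assume "seq cs \<in> V" "c \<in> set cs"
  then obtain i where i: "i < length cs" "c = cs ! i" by (metis in_set_conv_nth)
  have "opair (von i) c \<in> elts (seq cs)" unfolding elts_seq using i by blast
  from V_elts[OF \<open>seq cs \<in> V\<close> this] show "c \<in> V" by simp
qed

lemma ball_dom_seq:
  assumes "seq cs \<in> V"
  shows "(\<forall>i\<in>elts (dom_of (seq cs)). P (ap (seq cs) i)) \<longleftrightarrow> (\<forall>c\<in>set cs. P c)"
proof -
  have V: "set cs \<subseteq> V" by (rule seq_V_D[OF assms])
  have "(\<forall>i\<in>elts (dom_of (seq cs)). P (ap (seq cs) i)) \<longleftrightarrow> (\<forall>i<length cs. P (cs ! i))"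
    unfolding dom_of_seq[OF V] elts_von using ap_seq[OF V] by auto
  then show ?thesis by (simp add: all_set_conv_all_nth)
qed

lemma literal_code_in_V: "literal_in L l \<Longrightarrow> literal_code l \<in> V"
proof (induction l)
  case (Rel R vs)
  then have "opair R (von (length vs)) \<in> elts L" by simp
  then have "opair R (von (length vs)) \<in> V" by (rule V_elts[OF L(1)])
  then show ?case using von_in_V seq_in_V[OF von_vs_V] by (simp del: von.simps)
qed (use von_in_V in \<open>simp_all del: von.simps\<close>)

lemma basic_form_iff:
  assumes F: "F \<in> V"
  shows "basic_form F s \<longleftrightarrow>
    (\<exists>\<phi> xs. F = seq (map literal_code \<phi>) \<and> s = seq xs \<and> conj_instance L X \<phi> xs)"
proof -
  have conj: "basic_form (seq (map literal_code \<phi>)) (seq xs) \<longleftrightarrow> conj_instance L X \<phi> xs"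
    if FV: "seq (map literal_code \<phi>) \<in> V" and xs: "set xs \<subseteq> elts X" for \<phi> xs
  proof -
    have legal: "(\<forall>i\<in>elts (dom_of (seq (map literal_code \<phi>))). legal (ap (seq (map literal_code \<phi>)) i) (seq ys)) \<longleftrightarrow>
      (\<forall>l\<in>set \<phi>. literal_in L l) \<and> (\<forall>l\<in>set \<phi>. \<forall>v\<in>vars l. v < length ys)" if "set ys \<subseteq> elts X" for ys
      unfolding ball_dom_seq[OF FV, where P = "\<lambda>c. legal c (seq ys)"]
      by (auto simp: legal_iff[OF that])
    have dom: "dom_of (seq ys) = von (length ys)" if "set ys \<subseteq> elts X" for ys
      by (rule dom_of_seq[OF elts_X_V[OF that]])
    have "is_fun (seq (map literal_code \<phi>))" "dom_of (seq (map literal_code \<phi>)) \<in> elts omega" "seq xs \<in> elts FS"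
      using seq_fun(1) dom_of_seq[OF seq_V_D[OF FV]] FS(2) xs by (auto simp: elts_omega)
    moreover have "(\<forall>s'\<in>elts FS. dom_of s' \<in> elts (dom_of (seq xs)) \<longrightarrow>
        \<not> (\<forall>i\<in>elts (dom_of (seq (map literal_code \<phi>))). legal (ap (seq (map literal_code \<phi>)) i) s')) \<longleftrightarrow>
      (\<forall>k<length xs. \<not> ((\<forall>l\<in>set \<phi>. literal_in L l) \<and> (\<forall>l\<in>set \<phi>. \<forall>v\<in>vars l. v < k)))" (is "?l \<longleftrightarrow> ?r")
    proof
      assume l: ?l
      show ?r
      proof (intro allI impI)
        fix k assume k: "k < length xs"
        \<comment> \<open>Prefixes of \<open>xs\<close> realise every smaller length, so quantifying
          over shorter tuples is the same as quantifying over smaller numbers.\<close>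
        have ys: "set (take k xs) \<subseteq> elts X" using xs by (meson set_take_subset subset_trans)
        have "seq (take k xs) \<in> elts FS" using ys FS(2) by blast
        moreover have "dom_of (seq (take k xs)) \<in> elts (dom_of (seq xs))"
          unfolding dom[OF ys] dom[OF xs] elts_von using k by simp
        ultimately have "\<not> (\<forall>i\<in>elts (dom_of (seq (map literal_code \<phi>))).
            legal (ap (seq (map literal_code \<phi>)) i) (seq (take k xs)))" using l by blast
        then show "\<not> ((\<forall>l\<in>set \<phi>. literal_in L l) \<and> (\<forall>l\<in>set \<phi>. \<forall>v\<in>vars l. v < k))"
          unfolding legal[OF ys] using k by simp
      qed
    next
      assume r: ?r
      show ?l
      proof (intro ballI impI)
        fix s' assume "s' \<in> elts FS" and d: "dom_of s' \<in> elts (dom_of (seq xs))"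
        then obtain ys where ys: "s' = seq ys" "set ys \<subseteq> elts X" unfolding FS(2) by blast
        have "length ys < length xs" using d unfolding ys(1) dom[OF ys(2)] dom[OF xs] elts_von by auto
        then show "\<not> (\<forall>i\<in>elts (dom_of (seq (map literal_code \<phi>))). legal (ap (seq (map literal_code \<phi>)) i) s')"
          using r unfolding ys(1) legal[OF ys(2)] by blast
      qed
    qed
    ultimately show ?thesis
      unfolding basic_form_def conj_instance_def legal[OF xs] eq_commute[of "length xs"] arity_eq_iff
      using xs by blast
  qed
  show ?thesis
  proof
    assume b: "basic_form F s"
    then obtain xs where xs: "s = seq xs" "set xs \<subseteq> elts X" unfolding basic_form_def FS(2) by blast
    obtain n where n: "dom_of F = von n" using b unfolding basic_form_def by (auto simp: elts_omega)
    have isf: "is_fun F" using b by (simp add: basic_form_def)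
    have "\<exists>l. app F i = literal_code l" if i: "i \<in> fdom F" for i
    proof -
      have "legal (ap F i) s" using b i elts_dom_of[OF F] by (simp add: basic_form_def)
      then show ?thesis unfolding xs(1) legal_iff[OF xs(2)] using ap_app[OF F isf i] by auto
    qed
    then have "\<exists>cs. F = seq cs \<and> length cs = n \<and> (\<forall>c\<in>set cs. \<exists>l. c = literal_code l)"
      using n elts_dom_of[OF F] by (intro seq_exI[OF isf]) simp_all
    then obtain cs where cs: "F = seq cs" "\<exists>\<phi>. cs = map literal_code \<phi>"
      unfolding ex_map_conv by blast
    then obtain \<phi> where "F = seq (map literal_code \<phi>)" by blast
    then show "\<exists>\<phi> xs. F = seq (map literal_code \<phi>) \<and> s = seq xs \<and> conj_instance L X \<phi> xs"
      using conj[of \<phi> xs] b xs F by blast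
  next
    assume "\<exists>\<phi> xs. F = seq (map literal_code \<phi>) \<and> s = seq xs \<and> conj_instance L X \<phi> xs"
    then obtain \<phi> xs where *: "F = seq (map literal_code \<phi>)" "s = seq xs" "conj_instance L X \<phi> xs" by blast
    then have "set xs \<subseteq> elts X" by (simp add: conj_instance_def)
    then show "basic_form F s" using conj[of \<phi> xs] * F by blast
  qed
qed

lemma conj_instance_vars:
  assumes "conj_instance L X \<phi> xs" "l \<in> set \<phi>"
  shows "\<forall>v\<in>vars l. v < length xs"
  using assms arity_eq_iff[of \<phi> "length xs"] by (auto simp: conj_instance_def)

lemma code_basic_in_V: "conj_instance L X \<phi> xs \<Longrightarrow> code_basic \<phi> xs \<in> V"
proof -
  assume c: "conj_instance L X \<phi> xs"
  have "seq (map literal_code \<phi>) \<in> V"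
    using c by (intro seq_in_V) (auto simp: conj_instance_def literal_code_in_V)
  moreover have "seq xs \<in> V" using c by (intro seq_in_V elts_X_V) (simp add: conj_instance_def)
  ultimately show ?thesis using von_in_V by (simp add: code_basic_def del: von.simps)
qed

lemma basic_codes_eq: "basic_codes V L X = {code_basic \<phi> xs | \<phi> xs. conj_instance L X \<phi> xs}"
  unfolding basic_codes_def using code_basic_in_V by blast

lemma basic_codes_iff:
  "\<gamma> \<in> basic_codes V L X \<longleftrightarrow> \<gamma> \<in> V \<and> (\<exists>F s. \<gamma> = opair (von 0) (opair F s) \<and> basic_form F s)"
proof
  assume "\<gamma> \<in> basic_codes V L X"
  then obtain \<phi> xs where *: "\<gamma> = code_basic \<phi> xs" "conj_instance L X \<phi> xs" "\<gamma> \<in> V"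
    unfolding basic_codes_def by blast
  then have "seq (map literal_code \<phi>) \<in> V" by (simp add: code_basic_def del: von.simps)
  from basic_form_iff[OF this] have "basic_form (seq (map literal_code \<phi>)) (seq xs)" using * by blast
  then show "\<gamma> \<in> V \<and> (\<exists>F s. \<gamma> = opair (von 0) (opair F s) \<and> basic_form F s)"
    using * unfolding code_basic_def by blast
next
  assume "\<gamma> \<in> V \<and> (\<exists>F s. \<gamma> = opair (von 0) (opair F s) \<and> basic_form F s)"
  then obtain F s where *: "\<gamma> \<in> V" "\<gamma> = opair (von 0) (opair F s)" "basic_form F s" by blast
  then have "F \<in> V" by simp
  from basic_form_iff[OF this] * obtain \<phi> xs
    where "F = seq (map literal_code \<phi>)" "s = seq xs" "conj_instance L X \<phi> xs" by blast
  moreover from this have "\<gamma> = code_basic \<phi> xs" unfolding code_basic_def using * by simp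
  ultimately show "\<gamma> \<in> basic_codes V L X" unfolding basic_codes_def using * by blast
qed

lemma interp_basic_form:
  assumes "F \<in> V" "basic_form F s"
  shows "interp V L X (opair (von 0) (opair F s)) =
    {M \<in> elts Sg. \<forall>i\<in>elts (dom_of F). opair (von 1) (opair M s) \<in> elts (lit_graph (ap F i))}"
proof -
  obtain \<phi> xs where *: "F = seq (map literal_code \<phi>)" "s = seq xs" "conj_instance L X \<phi> xs"
    using assms basic_form_iff by blast
  have "interp V L X (opair (von 0) (opair F s)) = {M \<in> elts Sg. conj_sat M xs \<phi>}"
    using interp_basic[of V L X \<phi> xs] unfolding code_basic_def *(1,2) Sg(2) .
  moreover have "(\<forall>i\<in>elts (dom_of F). opair (von 1) (opair M s) \<in> elts (lit_graph (ap F i))) \<longleftrightarrow> conj_sat M xs \<phi>"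
    if "M \<in> elts Sg" for M
  proof -
    have "seq (map literal_code \<phi>) \<in> V" using assms(1) *(1) by simp
    then show ?thesis
      using *(3) conj_instance_vars[OF *(3)] lit_graph_sat[of xs _ M] that
      unfolding *(1,2) ball_dom_seq[OF \<open>seq (map literal_code \<phi>) \<in> V\<close>, where P = "\<lambda>c. opair (von 1) (opair M (seq xs)) \<in> elts (lit_graph c)"]
      by (auto simp: conj_sat_def conj_instance_def simp del: von.simps)
  qed
  ultimately show ?thesis by auto
qed

subsection \<open>Borel codes\<close>

abbreviation codes :: "'k hset set" where "codes \<equiv> borel_codes V \<kappa> L X"

lemma codes_in_V: "\<gamma> \<in> codes \<Longrightarrow> \<gamma> \<in> V"
proof (induction rule: borel_codes.induct)
  case (basic \<gamma>)
  then show ?case by (simp add: basic_codes_def)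
qed (use von_in_V in \<open>simp_all add: code_defs del: von.simps\<close>)

lemma codes_iff:
  "opair (von 0) z \<in> codes \<longleftrightarrow> opair (von 0) z \<in> basic_codes V L X"
  "opair (von 1) \<delta> \<in> codes \<longleftrightarrow> \<delta> \<in> codes"
  "opair (von 2) \<Gamma> \<in> codes \<longleftrightarrow> \<Gamma> \<in> V \<and> indexed_by V \<kappa> \<Gamma> \<and> elts \<Gamma> \<subseteq> codes"
  "opair (von 3) \<Gamma> \<in> codes \<longleftrightarrow> \<Gamma> \<in> V \<and> indexed_by V \<kappa> \<Gamma> \<and> elts \<Gamma> \<subseteq> codes"
proof -
  have b: "opair (von n) z \<in> basic_codes V L X \<Longrightarrow> n = 0" for n z
    by (auto simp: basic_codes_def code_basic_def simp del: von.simps)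
  show "opair (von 0) z \<in> codes \<longleftrightarrow> opair (von 0) z \<in> basic_codes V L X"
    by (subst borel_codes.simps) (auto simp: code_defs simp del: von.simps)
  show "opair (von 1) \<delta> \<in> codes \<longleftrightarrow> \<delta> \<in> codes"
    by (subst borel_codes.simps) (use b[of 1] in \<open>auto simp: code_defs simp del: von.simps\<close>)
  show "opair (von 2) \<Gamma> \<in> codes \<longleftrightarrow> \<Gamma> \<in> V \<and> indexed_by V \<kappa> \<Gamma> \<and> elts \<Gamma> \<subseteq> codes"
    by (subst borel_codes.simps) (use b[of 2] in \<open>auto simp: code_defs simp del: von.simps\<close>)
  show "opair (von 3) \<Gamma> \<in> codes \<longleftrightarrow> \<Gamma> \<in> V \<and> indexed_by V \<kappa> \<Gamma> \<and> elts \<Gamma> \<subseteq> codes"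
    by (subst borel_codes.simps) (use b[of 3] in \<open>auto simp: code_defs simp del: von.simps\<close>)
qed

lemma codes_cases:
  assumes "\<gamma> \<in> codes"
  obtains (basic) F s where "\<gamma> = opair (von 0) (opair F s)" "F \<in> V" "basic_form F s"
  | (neg) \<delta> where "\<gamma> = opair (von 1) \<delta>" "\<delta> \<in> codes"
  | (join) \<Gamma> where "\<gamma> = opair (von 2) \<Gamma>" "\<Gamma> \<in> V" "indexed_by V \<kappa> \<Gamma>" "elts \<Gamma> \<subseteq> codes"
  | (meet) \<Gamma> where "\<gamma> = opair (von 3) \<Gamma>" "\<Gamma> \<in> V" "indexed_by V \<kappa> \<Gamma>" "elts \<Gamma> \<subseteq> codes"
  using assms
proof (cases rule: borel_codes.cases)
  case basic
  then obtain F s where "\<gamma> \<in> V" "\<gamma> = opair (von 0) (opair F s)" "basic_form F s"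
    unfolding basic_codes_iff by blast
  then show ?thesis using that(1) by simp
qed (use that(2-4) in \<open>auto simp: code_defs subset_iff simp del: von.simps\<close>)

lemma interp_tag:
  "interp V L X (opair (von 1) \<delta>) = elts Sg - interp V L X \<delta>"
  "interp V L X (opair (von 2) \<Gamma>) = (\<Union>\<gamma>\<in>elts \<Gamma>. interp V L X \<gamma>)"
  "interp V L X (opair (von 3) \<Gamma>) = elts Sg \<inter> (\<Inter>\<gamma>\<in>elts \<Gamma>. interp V L X \<gamma>)"
  using interp_neg[of V L X \<delta>] interp_join[of V L X \<Gamma>] interp_meet[of V L X \<Gamma>]
  unfolding code_defs Sg(2) by simp_all

lemma interp_subset: "\<gamma> \<in> codes \<Longrightarrow> interp V L X \<gamma> \<subseteq> elts Sg"
proof (induction rule: borel_codes.induct)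
  case (basic \<gamma>)
  then show ?case by (auto simp: basic_codes_def interp_basic Sg(2))
qed (auto simp: interp_neg interp_join interp_meet Sg(2))

lemma elts_mk_interp: "\<gamma> \<in> codes \<Longrightarrow> elts (mk (interp V L X \<gamma>)) = interp V L X \<gamma>"
  by (rule elts_mk_subset[OF interp_subset])

lemma D_indexed [def_intros]:
  assumes t: "T t"
  shows "D (\<lambda>e. indexed_by V \<kappa> (t e))"
proof (rule D_subst1[where Q = "indexed_by V \<kappa>", OF _ t])
  show "D (\<lambda>e. indexed_by V \<kappa> (e 0))"
  proof (rule D_cong)
    show "D (\<lambda>e. \<exists>f\<in>V. is_fun f \<and> dom_of f = \<kappa> \<and>
        (\<forall>i\<in>elts \<kappa>. ap f i \<in> elts (e 0)) \<and> (\<forall>y\<in>elts (e 0). \<exists>i\<in>elts \<kappa>. ap f i = y))"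
      by (intro def_intros)
    fix e :: "nat \<Rightarrow> 'k hset"
    have "is_fun f \<and> fdom f = elts \<kappa> \<and> app f ` elts \<kappa> = elts (e 0) \<longleftrightarrow> is_fun f \<and> dom_of f = \<kappa> \<and>
        (\<forall>i\<in>elts \<kappa>. ap f i \<in> elts (e 0)) \<and> (\<forall>y\<in>elts (e 0). \<exists>i\<in>elts \<kappa>. ap f i = y)" if f: "f \<in> V" for f
    proof -
      have "dom_of f = \<kappa> \<longleftrightarrow> fdom f = elts \<kappa>" using elts_dom_of[OF f] by (metis mk_elts)
      moreover have "app f ` elts \<kappa> = elts (e 0) \<longleftrightarrow>
          (\<forall>i\<in>elts \<kappa>. app f i \<in> elts (e 0)) \<and> (\<forall>y\<in>elts (e 0). \<exists>i\<in>elts \<kappa>. app f i = y)"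
        by (rule image_eq_iff)
      moreover have "ap f i = app f i" if "is_fun f" "fdom f = elts \<kappa>" "i \<in> elts \<kappa>" for i
        using ap_app[OF f] that by simp
      ultimately show ?thesis by auto
    qed
    then show "indexed_by V \<kappa> (e 0) \<longleftrightarrow> (\<exists>f\<in>V. is_fun f \<and> dom_of f = \<kappa> \<and>
        (\<forall>i\<in>elts \<kappa>. ap f i \<in> elts (e 0)) \<and> (\<forall>y\<in>elts (e 0). \<exists>i\<in>elts \<kappa>. ap f i = y))"
      unfolding indexed_by_def by blast
  qed
qed

text \<open>Recursion on codes with the empty set marking non-codes makes \<open>borel_codes\<close> and \<open>interp\<close>
  definable at the same time.\<close>

definition cint :: "'k hset \<Rightarrow> 'k hset" where
  "cint \<gamma> = (if \<gamma> \<in> codes then mk {mk (interp V L X \<gamma>)} else mk {})"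

definition code_step :: "'k hset \<Rightarrow> 'k hset \<Rightarrow> bool" where
  "code_step \<gamma> f \<longleftrightarrow>
    (\<exists>F\<in>V. \<exists>s\<in>V. \<gamma> = opair (von 0) (opair F s) \<and> basic_form F s) \<or>
    (\<exists>\<delta>\<in>V. \<gamma> = opair (von 1) \<delta> \<and> ap f \<delta> \<noteq> mk {}) \<or>
    (\<exists>\<Gamma>\<in>V. (\<gamma> = opair (von 2) \<Gamma> \<or> \<gamma> = opair (von 3) \<Gamma>) \<and> indexed_by V \<kappa> \<Gamma> \<and>
       (\<forall>\<delta>\<in>elts \<Gamma>. ap f \<delta> \<noteq> mk {}))"

text \<open>At a code \<open>\<delta>\<close> the value \<open>ap f \<delta>\<close> is a singleton,
  so the quantifiers over \<open>B\<close> merely unpack the interpretation. At non-codes the value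
  is empty, but \<open>code_step\<close> has excluded these before this clause is consulted.\<close>

definition int_step :: "'k hset \<Rightarrow> 'k hset \<Rightarrow> 'k hset \<Rightarrow> bool" where
  "int_step \<gamma> f M \<longleftrightarrow>
    (\<exists>F\<in>V. \<exists>s\<in>V. \<gamma> = opair (von 0) (opair F s) \<and>
       (\<forall>i\<in>elts (dom_of F). opair (von 1) (opair M s) \<in> elts (lit_graph (ap F i)))) \<or>
    (\<exists>\<delta>\<in>V. \<gamma> = opair (von 1) \<delta> \<and> (\<forall>B\<in>elts (ap f \<delta>). M \<notin> elts B)) \<or>
    (\<exists>\<Gamma>\<in>V. \<gamma> = opair (von 2) \<Gamma> \<and> (\<exists>\<delta>\<in>elts \<Gamma>. \<exists>B\<in>elts (ap f \<delta>). M \<in> elts B)) \<or>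
    (\<exists>\<Gamma>\<in>V. \<gamma> = opair (von 3) \<Gamma> \<and> (\<forall>\<delta>\<in>elts \<Gamma>. \<forall>B\<in>elts (ap f \<delta>). M \<in> elts B))"

lemma cint_code: "\<gamma> \<in> codes \<Longrightarrow> elts (cint \<gamma>) = {mk (interp V L X \<gamma>)}"
  by (simp add: cint_def)

lemma cint_empty_iff: "cint \<gamma> = mk {} \<longleftrightarrow> \<gamma> \<notin> codes"
proof -
  have "elts (cint \<gamma>) = {} \<longleftrightarrow> \<gamma> \<notin> codes" by (simp add: cint_def)
  then show ?thesis by (simp only: elts_empty_iff)
qed

lemma T_cint: "T (\<lambda>e. cint (e 0))"
proof (rule T_rec)
  let ?Phi = "\<lambda>\<gamma> f. if code_step \<gamma> f then mk {mk {M \<in> elts Sg. int_step \<gamma> f M}} else mk {}"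
  show "T (\<lambda>e. ?Phi (e 0) (e 1))" unfolding code_step_def int_step_def by (intro def_intros)
  fix \<gamma> f :: "'k hset"
  assume g: "\<gamma> \<in> V" and "f \<in> V"
    and IH: "\<And>z. (z, \<gamma>) \<in> {(x, y). x \<in> elts y}\<^sup>+ \<Longrightarrow> ap f z = cint z"
  have ap_neg: "ap f \<delta> = cint \<delta>" if "\<gamma> = opair (von 1) \<delta>" for \<delta>
    unfolding that by (rule IH) (simp add: that opair_trancl(2) del: von.simps)
  have ap_fam: "ap f \<delta> = cint \<delta>" if "\<gamma> = opair (von n) \<Gamma>" "\<delta> \<in> elts \<Gamma>" for \<delta> \<Gamma> n
    by (rule IH) (simp add: that opair_trancl_elts del: von.simps)
  have code: "code_step \<gamma> f \<longleftrightarrow> \<gamma> \<in> codes"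
  proof
    assume "code_step \<gamma> f"
    then consider
      (basic) F s where "\<gamma> = opair (von 0) (opair F s)" "basic_form F s"
    | (neg) \<delta> where "\<gamma> = opair (von 1) \<delta>" "ap f \<delta> \<noteq> mk {}"
    | (fam) n \<Gamma> where "\<gamma> = opair (von n) \<Gamma>" "n = 2 \<or> n = 3" "\<Gamma> \<in> V" "indexed_by V \<kappa> \<Gamma>"
         "\<forall>\<delta>\<in>elts \<Gamma>. ap f \<delta> \<noteq> mk {}"
      unfolding code_step_def by blast
    then show "\<gamma> \<in> codes"
    proof cases
      case basic
      then have "\<gamma> \<in> basic_codes V L X" unfolding basic_codes_iff using g by blast
      then show ?thesis by (rule borel_codes.basic)
    next
      case (neg \<delta>)
      then show ?thesis using ap_neg cint_empty_iff codes_iff(2) by simp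
    next
      case (fam n \<Gamma>)
      have "elts \<Gamma> \<subseteq> codes"
        using fam(5) ap_fam[OF fam(1)]
          cint_empty_iff by auto
      then show ?thesis using fam(1-4) codes_iff(3,4) by auto
    qed
  next
    assume "\<gamma> \<in> codes"
    then show "code_step \<gamma> f"
    proof (cases rule: codes_cases)
      case (basic F s)
      then have "s \<in> V" using g by simp
      then show ?thesis unfolding code_step_def using basic by blast
    next
      case (neg \<delta>)
      then have "\<delta> \<in> V" using g by simp
      moreover have "ap f \<delta> \<noteq> mk {}"
        using ap_neg[OF neg(1)] neg(2) cint_empty_iff by simp
      ultimately show ?thesis unfolding code_step_def using neg(1) by blast
    next
      case (join \<Gamma>)
      have "\<forall>\<delta>\<in>elts \<Gamma>. ap f \<delta> \<noteq> mk {}" using ap_fam[OF join(1)] join(4) cint_empty_iff by auto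
      then show ?thesis unfolding code_step_def using join by blast
    next
      case (meet \<Gamma>)
      have "\<forall>\<delta>\<in>elts \<Gamma>. ap f \<delta> \<noteq> mk {}" using ap_fam[OF meet(1)] meet(4) cint_empty_iff by auto
      then show ?thesis unfolding code_step_def using meet by blast
    qed
  qed
  have int: "interp V L X \<gamma> = {M \<in> elts Sg. int_step \<gamma> f M}" if "\<gamma> \<in> codes"
    using that
  proof (cases rule: codes_cases)
    case (basic F s)
    then have "s \<in> V" using g by simp
    then have "int_step \<gamma> f M \<longleftrightarrow>
        (\<forall>i\<in>elts (dom_of F). opair (von 1) (opair M s) \<in> elts (lit_graph (ap F i)))" for M
      unfolding int_step_def basic(1) using basic(2) by (simp del: von.simps)
    then show ?thesis using interp_basic_form[OF basic(2,3)] basic(1) by simp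
  next
    case (neg \<delta>)
    then have "\<delta> \<in> V" using g by simp
    have "ap f \<delta> = cint \<delta>" by (rule ap_neg[OF neg(1)])
    then have "int_step \<gamma> f M \<longleftrightarrow> M \<notin> interp V L X \<delta>" for M
      unfolding int_step_def neg(1) using \<open>\<delta> \<in> V\<close> elts_mk_interp[OF neg(2)] cint_code[OF neg(2)]
      by (simp del: von.simps)
    then show ?thesis unfolding neg(1) interp_tag by auto
  next
    case (join \<Gamma>)
    have "int_step \<gamma> f M \<longleftrightarrow> (\<exists>\<delta>\<in>elts \<Gamma>. \<exists>B\<in>elts (ap f \<delta>). M \<in> elts B)" for M
      unfolding int_step_def join(1) using join(2) by (simp del: von.simps)
    moreover have "(\<exists>B\<in>elts (ap f \<delta>). M \<in> elts B) \<longleftrightarrow> M \<in> interp V L X \<delta>" if d: "\<delta> \<in> elts \<Gamma>" for M \<delta>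
    proof -
      have "\<delta> \<in> codes" using d join(4) by blast
      then show ?thesis using ap_fam[OF join(1) d] cint_code elts_mk_interp by simp
    qed
    moreover have "M \<in> elts Sg" if "\<delta> \<in> elts \<Gamma>" "M \<in> interp V L X \<delta>" for \<delta> M
      using that interp_subset join(4) by blast
    ultimately show ?thesis unfolding join(1) interp_tag by auto
  next
    case (meet \<Gamma>)
    have "int_step \<gamma> f M \<longleftrightarrow> (\<forall>\<delta>\<in>elts \<Gamma>. \<forall>B\<in>elts (ap f \<delta>). M \<in> elts B)" for M
      unfolding int_step_def meet(1) using meet(2) by (simp del: von.simps)
    moreover have "(\<forall>B\<in>elts (ap f \<delta>). M \<in> elts B) \<longleftrightarrow> M \<in> interp V L X \<delta>" if d: "\<delta> \<in> elts \<Gamma>" for M \<delta>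
    proof -
      have "\<delta> \<in> codes" using d meet(4) by blast
      then show ?thesis using ap_fam[OF meet(1) d] cint_code elts_mk_interp by simp
    qed
    ultimately show ?thesis unfolding meet(1) interp_tag by auto
  qed
  show "cint \<gamma> = ?Phi \<gamma> f" unfolding cint_def code using int by simp
qed

text \<open>Strips the singleton off \<open>cint\<close>. Non-codes are sent to the empty set, so
  this is a total definable operation on \<open>V\<close>.\<close>

definition Intp :: "'k hset \<Rightarrow> 'k hset" where
  "Intp \<gamma> = mk (\<Union> (elts ` elts (cint \<gamma>)))"

lemma T_Intp [def_intros]: "T t \<Longrightarrow> T (\<lambda>e. Intp (t e))"
  unfolding Intp_def by (intro def_intros T_subst1[OF T_cint])

lemma D_codes [def_intros]: "T t \<Longrightarrow> D (\<lambda>e. t e \<in> codes)"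
proof -
  assume t: "T t"
  have "D (\<lambda>e. \<not> cint (t e) = mk {})" by (intro def_intros T_subst1[OF T_cint] t)
  then show ?thesis by (simp add: cint_empty_iff)
qed

lemma elts_Intp: "\<gamma> \<in> codes \<Longrightarrow> elts (Intp \<gamma>) = interp V L X \<gamma>"
  unfolding Intp_def by (simp add: cint_code elts_mk_interp)

lemma Intp_in_V: "\<gamma> \<in> V \<Longrightarrow> Intp \<gamma> \<in> V"
  by (rule T_in_V1[where h = Intp, OF T_Intp[OF T_var]])

lemma Intp_mk: "\<gamma> \<in> codes \<Longrightarrow> Intp \<gamma> = mk (interp V L X \<gamma>)"
  using elts_Intp by (metis mk_elts)

end

section \<open>The ideal of null sets\<close>

text \<open>\<open>ordinal\<close> states only transitivity of the set and of its members.
  Trichotomy follows by a double induction: two incomparable members would have the same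
  elements.\<close>

lemma ordinal_linear:
  assumes "ordinal x"
  shows "i \<in> elts x \<Longrightarrow> j \<in> elts x \<Longrightarrow> i \<in> elts j \<or> i = j \<or> j \<in> elts i"
proof (induction i arbitrary: j rule: wf_induct[OF wf_elts])
  case (1 i)
  note IHi = 1(1) and i = 1(2)
  have sub: "elts k \<subseteq> elts x" if "k \<in> elts x" for k
    using assms that unfolding ordinal_def by blast
  have tr: "elts l \<subseteq> elts k" if "k \<in> elts x" "l \<in> elts k" for k l
    using assms that unfolding ordinal_def by blast
  show ?case using 1(3)
  proof (induction j rule: wf_induct[OF wf_elts])
    case (1 j)
    show ?case
    proof (rule ccontr)
      assume not: "\<not> (i \<in> elts j \<or> i = j \<or> j \<in> elts i)"
      have "elts j \<subseteq> elts i"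
      proof
        fix j' assume j': "j' \<in> elts j"
        then have "i \<in> elts j' \<or> i = j' \<or> j' \<in> elts i" using 1 sub by blast
        then show "j' \<in> elts i" using not tr[OF 1(2) j'] j' by blast
      qed
      moreover have "elts i \<subseteq> elts j"
      proof
        fix i' assume i': "i' \<in> elts i"
        then have "i' \<in> elts j \<or> i' = j \<or> j \<in> elts i'" using IHi 1(2) i sub by blast
        then show "i' \<in> elts j" using not tr[OF i i'] i' by blast
      qed
      ultimately have "i = j" by (metis elts_inject subset_antisym)
      then show False using not by blast
    qed
  qed
qed

lemma elts_minimal:
  assumes "i \<in> A"
  obtains i where "i \<in> A" "\<forall>j\<in>elts i. j \<notin> A"
proof -
  obtain i where "i \<in> A" "\<And>j. (j, i) \<in> {(x, y). x \<in> elts y} \<Longrightarrow> j \<notin> A"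
    using wfE_min[OF wf_elts assms] by blast
  then show thesis using that by simp
qed

lemma literal_sat_cong:
  "(\<And>v. v \<in> vars l \<Longrightarrow> xs ! v = ys ! v) \<Longrightarrow> literal_sat M xs l \<longleftrightarrow> literal_sat M ys l"
proof (induction l)
  case (Rel R vs)
  then have "map ((!) xs) vs = map ((!) ys) vs" by simp
  then show ?case by (simp only: literal_sat.simps)
qed simp_all

locale measure_model = code_model V \<kappa> L X for V :: "'k hset set" and \<kappa> L X +
  fixes \<mu> :: "'k hset"
  assumes mu: "\<mu> \<in> V" "prob_kappa_measure V \<kappa> L X \<mu>"
begin

section \<open>Closure properties of the measurable sets\<close>

abbreviation sig :: "'k hset set" where "sig \<equiv> sigma_alg V \<kappa> L X"

lemma mu_fun: "is_fun \<mu>" "fdom \<mu> = sig"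
  using mu(2) by (auto simp: prob_kappa_measure_def)

lemma sig_set: "dom_of \<mu> \<in> V" "elts (dom_of \<mu>) = sig"
  using dom_of_in_V[OF mu(1)] elts_dom_of[OF mu(1)] mu_fun(2) by auto

lemma sig_in_V: "A \<in> sig \<Longrightarrow> A \<in> V"
  using V_elts[OF sig_set(1)] sig_set(2) by blast

lemma sig_subset: "A \<in> sig \<Longrightarrow> elts A \<subseteq> elts Sg"
proof (induction rule: sigma_alg.induct)
  case (basic l xs)
  have "elts (mk {M \<in> Str V L X. literal_sat M xs l}) = {M \<in> Str V L X. literal_sat M xs l}"
    by (rule elts_mk_subset[of _ Sg]) (auto simp: Sg(2))
  then show ?case by (auto simp: Sg(2))
next
  case (compl A)
  have "elts (mk (Str V L X - elts A)) = Str V L X - elts A"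
    by (rule elts_mk_subset[of _ Sg]) (auto simp: Sg(2))
  then show ?case by (auto simp: Sg(2))
next
  case (union C)
  then have sub: "\<Union> (elts ` elts C) \<subseteq> elts Sg" by blast
  then show ?case by (simp only: elts_mk_subset[OF sub])
qed

lemma sig_compl: "A \<in> sig \<Longrightarrow> mk (elts Sg - elts A) \<in> sig"
  using sigma_alg.compl[of A V \<kappa> L X] by (simp only: Sg(2))

lemma kappa_V: "i \<in> elts \<kappa> \<Longrightarrow> i \<in> V"
  using V_elts[OF kappa(1)] by blast

text \<open>\<open>sigma_alg\<close> asks for an injection of the family into
  \<open>\<kappa>\<close> that lies in \<open>V\<close>, whereas here an enumeration is given.
  Sending each member to its least index inverts the enumeration without choice, as
  \<open>\<kappa>\<close> is an ordinal.\<close>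

lemma sig_UN:
  assumes F: "T (\<lambda>e. F (e 0))" and d: "d \<in> V" "elts d \<subseteq> elts \<kappa>"
    and sig: "\<And>i. i \<in> elts d \<Longrightarrow> F i \<in> sig"
  shows "mk (\<Union>i\<in>elts d. elts (F i)) \<in> sig"
proof -
  define C where "C = mk (F ` elts d)"
  have C: "elts C = F ` elts d" unfolding C_def by (rule elts_mk_image)
  have CV: "C \<in> V" unfolding C_def
    by (rule T_in_V1[where h = "\<lambda>d. mk (F ` elts d)", OF _ d(1)]) (intro def_intros F)
  \<comment> \<open>The set of least indices of \<open>A\<close> is a singleton, and the union of a
    singleton is its element.\<close>
  define g where "g A = mk (\<Union> (elts ` elts (mk {j \<in> elts d. F j = A \<and> (\<forall>k\<in>elts j. k \<in> elts d \<longrightarrow> F k \<noteq> A)})))" for A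
  have T_g: "T (\<lambda>e. g (e 0))"
    unfolding g_def by (intro def_intros T_subst1[OF F] T_const[OF d(1)])
  have g: "g A \<in> elts d \<and> F (g A) = A" if A: "A \<in> elts C" for A
  proof -
    obtain j0 where "j0 \<in> {j \<in> elts d. F j = A}" using A unfolding C by auto
    then obtain j where j: "j \<in> {j \<in> elts d. F j = A}" "\<forall>k\<in>elts j. k \<notin> {j \<in> elts d. F j = A}"
      by (rule elts_minimal)
    have "k = j" if k: "k \<in> elts d" "F k = A" "\<forall>l\<in>elts k. l \<in> elts d \<longrightarrow> F l \<noteq> A" for k
      using ordinal_linear[OF kappa(2), of j k] j k d(2) by blast
    then have "{j \<in> elts d. F j = A \<and> (\<forall>k\<in>elts j. k \<in> elts d \<longrightarrow> F k \<noteq> A)} = {j}"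
      using j by blast
    then have "g A = j" unfolding g_def by simp
    then show ?thesis using j by simp
  qed
  have "card_le V C \<kappa>" unfolding card_le_def
  proof (intro bexI conjI)
    show "graph g C \<in> V" by (rule graph_in_V[OF T_g CV])
    show "is_fun (graph g C)" "fdom (graph g C) = elts C" by (rule graph_fun)+
    show "app (graph g C) ` elts C \<subseteq> elts \<kappa>" using g d(2) by (auto simp: app_graph)
    show "inj_on (app (graph g C)) (elts C)" 
    proof (rule inj_onI)
      fix A B assume *: "A \<in> elts C" "B \<in> elts C" "app (graph g C) A = app (graph g C) B"
      then have "F (g A) = F (g B)" by (simp add: app_graph)
      then show "A = B" using g *(1,2) by simp
    qed
  qed
  moreover have "\<forall>A\<in>elts C. A \<in> sig" by (simp add: C sig)
  ultimately have "mk (\<Union> (elts ` elts C)) \<in> sig" by (intro sigma_alg.union CV)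
  then show ?thesis unfolding C image_image .
qed

text \<open>Binary unions and meets are written as families indexed by \<open>\<kappa>\<close> with
  one value at \<open>k0\<close> and another elsewhere; for both to occur two distinct indices must
  exist.\<close>

lemma two_indices: obtains k0 k1 where "k0 \<in> elts \<kappa>" "k1 \<in> elts \<kappa>" "k0 \<noteq> k1"
proof -
  obtain k0 where k0: "k0 \<in> elts \<kappa>" using kappa(3) by (metis finite.emptyI equals0I)
  have "infinite (elts \<kappa> - {k0})" using kappa(3) by simp
  then obtain k1 where "k1 \<in> elts \<kappa> - {k0}" by (metis finite.emptyI equals0I)
  then show thesis using k0 that by blast
qed

lemma T_two:
  assumes "k0 \<in> V" "A \<in> V" "B \<in> V"
  shows "T (\<lambda>e. if e 0 = k0 then A else B)"
  by (intro def_intros T_const assms)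

lemma sig_empty: "mk {} \<in> sig"
proof -
  have "mk (\<Union>i\<in>elts (mk {} :: 'k hset). elts (mk {})) \<in> sig"
    by (rule sig_UN[where F = "\<lambda>_. mk {}", OF T_empty empty_in_V]) simp_all
  then show ?thesis by simp
qed

lemma sig_Un:
  assumes "A \<in> sig" "B \<in> sig"
  shows "mk (elts A \<union> elts B) \<in> sig"
proof -
  obtain k0 k1 where k: "k0 \<in> elts \<kappa>" "k1 \<in> elts \<kappa>" "k0 \<noteq> k1" by (rule two_indices)
  have "mk (\<Union>i\<in>elts \<kappa>. elts (if i = k0 then A else B)) \<in> sig"
    by (rule sig_UN[where F = "\<lambda>i. if i = k0 then A else B", OF T_two[OF kappa_V[OF k(1)] sig_in_V sig_in_V]])
      (use assms kappa in simp_all)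
  moreover have "(\<Union>i\<in>elts \<kappa>. elts (if i = k0 then A else B)) = elts A \<union> elts B"
    using k by (auto split: if_splits)
  ultimately show ?thesis by simp
qed

lemma elts_sig_diff: "A \<in> sig \<Longrightarrow> elts (mk (elts A - S)) = elts A - S"
  by (rule elts_mk_subset[of _ A]) blast

lemma sig_Un_elts: "A \<in> sig \<Longrightarrow> B \<in> sig \<Longrightarrow> elts (mk (elts A \<union> elts B)) = elts A \<union> elts B"
  by (intro elts_mk_Un sig_in_V)

lemma elts_Sg_diff: "elts (mk (elts Sg - S)) = elts Sg - S"
  by (rule elts_mk_subset[of _ Sg]) blast

lemma sig_diff:
  assumes "A \<in> sig" "B \<in> sig"
  shows "mk (elts A - elts B) \<in> sig"
proof -
  have "mk (elts Sg - elts (mk (elts (mk (elts Sg - elts A)) \<union> elts B))) \<in> sig"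
    by (intro sig_compl sig_Un assms)
  moreover have "elts (mk (elts (mk (elts Sg - elts A)) \<union> elts B)) = (elts Sg - elts A) \<union> elts B"
    using sig_Un_elts[OF sig_compl[OF assms(1)] assms(2)] unfolding elts_Sg_diff .
  then have "elts Sg - elts (mk (elts (mk (elts Sg - elts A)) \<union> elts B)) = elts A - elts B"
    using sig_subset[OF assms(1)] by blast
  ultimately show ?thesis by simp
qed

lemma sig_Int:
  assumes "A \<in> sig" "B \<in> sig"
  shows "mk (elts A \<inter> elts B) \<in> sig"
proof -
  have "mk (elts A - elts (mk (elts A - elts B))) \<in> sig" by (intro sig_diff assms)
  moreover have "elts A - elts (mk (elts A - elts B)) = elts A \<inter> elts B"
    unfolding elts_sig_diff[OF assms(1)] by blast
  ultimately show ?thesis by simp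
qed

section \<open>The measure and its null sets\<close>

definition m :: "'k hset \<Rightarrow> real" where "m A = measure_of_set \<mu> (elts A)"

text \<open>The left cut that codes 0 is the empty set, so being null is definable over
  \<open>V\<close> without any arithmetic of real numbers there.\<close>

definition null :: "'k hset \<Rightarrow> bool" where "null A \<longleftrightarrow> ap \<mu> A = mk {}"

lemma D_null [def_intros]: "T t \<Longrightarrow> D (\<lambda>e. null (t e))"
  unfolding null_def by (intro def_intros T_const mu)

lemma m_code: assumes "A \<in> sig" shows "0 \<le> m A \<and> app \<mu> A = real_code (m A)"
proof -
  obtain r where r: "0 \<le> r" "app \<mu> A = real_code r"
    using mu(2) assms unfolding prob_kappa_measure_def by blast
  have "m A = r" unfolding m_def measure_of_set_def
    by (rule the_equality) (use r real_code_inject in auto)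
  then show ?thesis using r by simp
qed

lemma real_code_empty_iff: "0 \<le> r \<Longrightarrow> real_code r = (mk {} :: 'k hset) \<longleftrightarrow> r = 0"
proof -
  assume r: "0 \<le> r"
  have "elts (real_code 0) = ({} :: 'k hset set)" by (auto simp: elts_real_code not_less)
  then have "real_code 0 = (mk {} :: 'k hset)" by (simp only: elts_empty_iff)
  from real_code_inject[OF r order_refl, where 'a = 'k, unfolded this]
  show ?thesis .
qed

lemma null_iff: "A \<in> sig \<Longrightarrow> null A \<longleftrightarrow> m A = 0"
  using m_code real_code_empty_iff ap_app[OF mu(1) mu_fun(1)] mu_fun(2) unfolding null_def by simp

lemma m_empty: "m (mk {}) = 0"
  using mu(2) by (simp add: prob_kappa_measure_def m_def)

text \<open>Additivity is given for families that are functions in \<open>V\<close>; a definable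
  operation becomes one by restricting it to \<open>\<kappa>\<close>.\<close>

lemma additive:
  assumes F: "T (\<lambda>e. F (e 0))" and sig: "\<And>i. i \<in> elts \<kappa> \<Longrightarrow> F i \<in> sig"
    and disj: "disjoint_family_on (\<lambda>i. elts (F i)) (elts \<kappa>)"
  shows "((\<lambda>i. m (F i)) has_sum m (mk (\<Union>i\<in>elts \<kappa>. elts (F i)))) (elts \<kappa>)"
proof -
  have app: "app (graph F \<kappa>) i = F i" if "i \<in> elts \<kappa>" for i using that by (rule app_graph)
  have disj': "disjoint_family_on (\<lambda>i. elts (app (graph F \<kappa>) i)) (elts \<kappa>)"
    using disj app by (simp add: disjoint_family_on_def)
  have "model_additive V sig \<kappa> \<mu>" using mu(2) by (simp add: prob_kappa_measure_def)
  moreover have "is_fun (graph F \<kappa>) \<and> fdom (graph F \<kappa>) = elts \<kappa> \<and>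
      (\<forall>i\<in>elts \<kappa>. app (graph F \<kappa>) i \<in> sig) \<and>
      disjoint_family_on (\<lambda>i. elts (app (graph F \<kappa>) i)) (elts \<kappa>)"
    using graph_fun[of F \<kappa>] disj' sig app by simp
  ultimately have "((\<lambda>i. measure_of_set \<mu> (elts (app (graph F \<kappa>) i))) has_sum
         measure_of_set \<mu> (\<Union>i\<in>elts \<kappa>. elts (app (graph F \<kappa>) i))) (elts \<kappa>)"
    unfolding model_additive_def using graph_in_V[OF F kappa(1)] by blast
  moreover have "(\<Union>i\<in>elts \<kappa>. elts (app (graph F \<kappa>) i)) = (\<Union>i\<in>elts \<kappa>. elts (F i))"
    using app by simp
  ultimately have "((\<lambda>i. measure_of_set \<mu> (elts (app (graph F \<kappa>) i))) has_sum
         measure_of_set \<mu> (\<Union>i\<in>elts \<kappa>. elts (F i))) (elts \<kappa>)" by (simp only:)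
  then have "((\<lambda>i. m (F i)) has_sum measure_of_set \<mu> (\<Union>i\<in>elts \<kappa>. elts (F i))) (elts \<kappa>)"
    by (rule iffD1[OF has_sum_cong, rotated]) (simp add: m_def app)
  then show ?thesis unfolding m_def elts_mk_UN[OF kappa(1) F] .
qed

text \<open>Both sets are placed at two indices of a \<open>\<kappa>\<close>-family and the empty
  set at all others, so all other terms of the sum vanish.\<close>

lemma m_Un_disjoint:
  assumes "A \<in> sig" "B \<in> sig" "elts A \<inter> elts B = {}"
  shows "m (mk (elts A \<union> elts B)) = m A + m B"
proof -
  obtain k0 k1 where k: "k0 \<in> elts \<kappa>" "k1 \<in> elts \<kappa>" "k0 \<noteq> k1" by (rule two_indices)
  let ?F = "\<lambda>i. if i = k0 then A else if i = k1 then B else mk {}"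
  have T: "T (\<lambda>e. ?F (e 0))"
    by (intro def_intros T_const assms(1,2)[THEN sig_in_V] k(1,2)[THEN kappa_V])
  have h1: "((\<lambda>i. m (?F i)) has_sum m (mk (\<Union>i\<in>elts \<kappa>. elts (?F i)))) (elts \<kappa>)"
  proof (rule additive[OF T])
    show "?F i \<in> sig" for i using assms sig_empty by simp
    show "disjoint_family_on (\<lambda>i. elts (?F i)) (elts \<kappa>)"
      unfolding disjoint_family_on_def using assms(3) by auto
  qed
  have e: "(\<Union>i\<in>elts \<kappa>. elts (?F i)) = elts A \<union> elts B"
  proof -
    have "(\<Union>i\<in>elts \<kappa>. elts (?F i)) \<subseteq> elts A \<union> elts B" by (auto split: if_splits)
    moreover have "elts (?F k0) \<subseteq> (\<Union>i\<in>elts \<kappa>. elts (?F i))" "elts (?F k1) \<subseteq> (\<Union>i\<in>elts \<kappa>. elts (?F i))"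
      using k by blast+
    ultimately show ?thesis using k(3) by auto
  qed
  have h2: "((\<lambda>i. m (?F i)) has_sum (m A + m B)) (elts \<kappa>)"
  proof -
    have "((\<lambda>i. m (?F i)) has_sum (\<Sum>i\<in>{k0, k1}. m (?F i))) {k0, k1}" by simp
    also have "(\<Sum>i\<in>{k0, k1}. m (?F i)) = m A + m B" using k(3) by simp
    also have "((\<lambda>i. m (?F i)) has_sum (m A + m B)) {k0, k1} \<longleftrightarrow> ((\<lambda>i. m (?F i)) has_sum (m A + m B)) (elts \<kappa>)"
      by (rule has_sum_cong_neutral) (use k m_empty in auto)
    finally show ?thesis .
  qed
  show ?thesis using has_sum_unique[OF h1 h2] unfolding e .
qed

lemma null_mono:
  assumes "A \<in> sig" "B \<in> sig" "elts A \<subseteq> elts B" "null B"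
  shows "null A"
proof -
  have "mk (elts A \<union> elts (mk (elts B - elts A))) = B"
    unfolding elts_sig_diff[OF assms(2)] using assms(3) by (metis Un_Diff_cancel mk_elts subset_Un_eq)
  moreover have "m (mk (elts A \<union> elts (mk (elts B - elts A)))) = m A + m (mk (elts B - elts A))"
    by (rule m_Un_disjoint[OF assms(1) sig_diff[OF assms(2,1)]]) (auto simp: elts_sig_diff[OF assms(2)])
  ultimately have "m B = m A + m (mk (elts B - elts A))" by simp
  then show ?thesis
    using null_iff assms m_code[OF assms(1)] m_code[OF sig_diff[OF assms(2,1)]] by auto
qed

text \<open>Additivity speaks about disjoint families only, so the family is first made disjoint
  along the well-order of \<open>\<kappa>\<close>; the pieces are null as subsets of null sets, and
  the sum of zeros is 0.\<close>

lemma null_UN: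
  assumes F: "T (\<lambda>e. F (e 0))" and sig: "\<And>i. i \<in> elts \<kappa> \<Longrightarrow> F i \<in> sig"
    and null: "\<And>i. i \<in> elts \<kappa> \<Longrightarrow> null (F i)"
  shows "null (mk (\<Union>i\<in>elts \<kappa>. elts (F i)))"
proof -
  \<comment> \<open>What \<open>F i\<close> adds to the earlier members. Each point of the union
    survives at its least index, and trichotomy makes the pieces disjoint.\<close>
  define H where "H i = mk (elts (F i) - elts (mk (\<Union>j\<in>elts i. elts (F j))))" for i
  have "T (\<lambda>e. mk {x \<in> elts (F (e 0)). x \<notin> elts (mk (\<Union>j\<in>elts (e 0). elts (F j)))})"
    by (intro def_intros F T_subst1[OF F])
  then have T_H: "T (\<lambda>e. H (e 0))" unfolding H_def set_diff_eq .
  have sub: "elts i \<subseteq> elts \<kappa>" if "i \<in> elts \<kappa>" for i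
    using kappa(2) that unfolding ordinal_def by blast
  have H_sig: "H i \<in> sig" if i: "i \<in> elts \<kappa>" for i
    unfolding H_def
    by (intro sig_diff sig[OF i] sig_UN[OF F kappa_V[OF i] sub[OF i]] sig) (use sub[OF i] in blast)
  have elts_H: "elts (H i) = elts (F i) - (\<Union>j\<in>elts i. elts (F j))" if i: "i \<in> elts \<kappa>" for i
    unfolding H_def elts_sig_diff[OF sig[OF i]] elts_mk_UN[OF kappa_V[OF i] F] ..
  have "null (H i)" if i: "i \<in> elts \<kappa>" for i
    by (rule null_mono[OF H_sig[OF i] sig[OF i] _ null[OF i]]) (auto simp: elts_H[OF i])
  then have m0: "m (H i) = 0" if "i \<in> elts \<kappa>" for i using null_iff H_sig that by blast
  have disj: "disjoint_family_on (\<lambda>i. elts (H i)) (elts \<kappa>)"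
    unfolding disjoint_family_on_def
  proof (intro ballI impI)
    fix i j assume ij: "i \<in> elts \<kappa>" "j \<in> elts \<kappa>" "i \<noteq> j"
    then consider "i \<in> elts j" | "j \<in> elts i" using ordinal_linear[OF kappa(2)] by blast
    then show "elts (H i) \<inter> elts (H j) = {}"
      unfolding elts_H[OF ij(1)] elts_H[OF ij(2)] by cases blast+
  qed
  have "(\<Union>i\<in>elts \<kappa>. elts (H i)) = (\<Union>i\<in>elts \<kappa>. elts (F i))"
  proof (intro equalityI subsetI)
    fix x assume "x \<in> (\<Union>i\<in>elts \<kappa>. elts (F i))"
    then obtain i0 where "i0 \<in> {i \<in> elts \<kappa>. x \<in> elts (F i)}" by blast
    then obtain i where i: "i \<in> {i \<in> elts \<kappa>. x \<in> elts (F i)}"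
      "\<forall>j\<in>elts i. j \<notin> {i \<in> elts \<kappa>. x \<in> elts (F i)}" by (rule elts_minimal)
    then have "x \<in> elts (H i)" using elts_H[of i] sub[of i] by blast
    then show "x \<in> (\<Union>i\<in>elts \<kappa>. elts (H i))" using i by blast
  qed (use elts_H in blast)
  then have "((\<lambda>i. m (H i)) has_sum m (mk (\<Union>i\<in>elts \<kappa>. elts (F i)))) (elts \<kappa>)"
    using additive[OF T_H H_sig disj] by simp
  moreover have "((\<lambda>i. m (H i)) has_sum 0) (elts \<kappa>)" by (rule has_sum_0) (rule m0)
  ultimately have "m (mk (\<Union>i\<in>elts \<kappa>. elts (F i))) = 0" by (rule has_sum_unique)
  then show ?thesis using null_iff[OF sig_UN[OF F kappa(1) _ sig]] by blast
qed

lemma null_empty: "null (mk {})"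
  using null_iff[OF sig_empty] m_empty by simp

lemma Sg_sig: "Sg \<in> sig"
  using sig_compl[OF sig_empty] by simp

lemma null_Un:
  assumes "A \<in> sig" "B \<in> sig" "null A" "null B"
  shows "null (mk (elts A \<union> elts B))"
proof -
  obtain k0 k1 where k: "k0 \<in> elts \<kappa>" "k1 \<in> elts \<kappa>" "k0 \<noteq> k1" by (rule two_indices)
  have "null (mk (\<Union>i\<in>elts \<kappa>. elts (if i = k0 then A else B)))"
    by (rule null_UN[where F = "\<lambda>i. if i = k0 then A else B", OF T_two[OF kappa_V[OF k(1)] sig_in_V sig_in_V]])
      (use assms in simp_all)
  moreover have "(\<Union>i\<in>elts \<kappa>. elts (if i = k0 then A else B)) = elts A \<union> elts B"
    using k by (auto split: if_splits)
  ultimately show ?thesis by simp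
qed

subsection \<open>Interpretations of codes are measurable\<close>

text \<open>Generators and basic codes require tuples whose length is exactly the arity. A literal
  evaluated at a longer tuple, such as one of a conjunction, depends only on this prefix.\<close>

lemma literal_take:
  assumes "literal_in L l" "\<forall>v\<in>vars l. v < length xs" "set xs \<subseteq> elts X"
  shows "conj_instance L X [l] (take (arity [l]) xs)"
    and "literal_sat M (take (arity [l]) xs) l \<longleftrightarrow> literal_sat M xs l"
proof -
  let ?n = "arity [l]"
  have n: "\<forall>v\<in>vars l. v < ?n" "\<And>k. k < ?n \<Longrightarrow> \<not> (\<forall>v\<in>vars l. v < k)"
    using arity_eq_iff[of "[l]" ?n] by auto
  have le: "?n \<le> length xs" using n(2)[of "length xs"] assms(2) by (meson not_le)
  show "conj_instance L X [l] (take ?n xs)"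
    unfolding conj_instance_def using assms le by (auto dest: in_set_takeD)
  show "literal_sat M (take ?n xs) l \<longleftrightarrow> literal_sat M xs l"
    by (rule literal_sat_cong) (use n(1) in simp)
qed

lemma literal_sig:
  assumes "literal_in L l" "\<forall>v\<in>vars l. v < length xs" "set xs \<subseteq> elts X"
  shows "mk {M \<in> elts Sg. literal_sat M xs l} \<in> sig"
  using sigma_alg.basic[OF literal_take(1)[OF assms], of V \<kappa>]
  by (simp add: literal_take(2)[OF assms] Sg(2))

lemma conj_sig:
  assumes "\<forall>l\<in>set \<phi>. literal_in L l \<and> (\<forall>v\<in>vars l. v < length xs)" "set xs \<subseteq> elts X"
  shows "mk {M \<in> elts Sg. conj_sat M xs \<phi>} \<in> sig"
  using assms(1)
proof (induction \<phi>)
  case Nil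
  then show ?case using Sg_sig by (simp add: conj_sat_def)
next
  case (Cons l \<phi>)
  have e: "elts (mk {M \<in> elts Sg. P M}) = {M \<in> elts Sg. P M}" for P
    by (rule elts_mk_subset[of _ Sg]) blast
  have "mk (elts (mk {M \<in> elts Sg. literal_sat M xs l}) \<inter> elts (mk {M \<in> elts Sg. conj_sat M xs \<phi>})) \<in> sig"
    using Cons assms(2) by (intro sig_Int literal_sig) auto
  moreover have "{M \<in> elts Sg. literal_sat M xs l} \<inter> {M \<in> elts Sg. conj_sat M xs \<phi>} =
     {M \<in> elts Sg. conj_sat M xs (l # \<phi>)}" by (auto simp: conj_sat_def)
  ultimately show ?case unfolding e by simp
qed

lemma indexed_byE:
  assumes "indexed_by V \<kappa> \<Gamma>"
  obtains f where "f \<in> V" "ap f ` elts \<kappa> = elts \<Gamma>"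
proof -
  obtain f where f: "f \<in> V" "is_fun f" "fdom f = elts \<kappa>" "app f ` elts \<kappa> = elts \<Gamma>"
    using assms unfolding indexed_by_def by blast
  have "ap f ` elts \<kappa> = elts \<Gamma>" using ap_app[OF f(1,2)] f(3,4) by simp
  then show thesis using that f(1) by blast
qed

lemma T_Intp_ap: "f \<in> V \<Longrightarrow> T (\<lambda>e. Intp (ap f (e 0)))"
  by (intro def_intros T_const)

lemma Intp_sig: "\<gamma> \<in> codes \<Longrightarrow> Intp \<gamma> \<in> sig"
proof (induction rule: borel_codes.induct)
  case (basic \<gamma>)
  then obtain \<phi> xs where *: "\<gamma> = code_basic \<phi> xs" "conj_instance L X \<phi> xs"
    unfolding basic_codes_def by blast
  have "mk {M \<in> elts Sg. conj_sat M xs \<phi>} \<in> sig"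
    using *(2) conj_instance_vars[OF *(2)] by (intro conj_sig) (auto simp: conj_instance_def)
  moreover have "Intp \<gamma> = mk {M \<in> elts Sg. conj_sat M xs \<phi>}"
    using Intp_mk[OF borel_codes.basic[OF basic]] unfolding *(1) interp_basic Sg(2) .
  ultimately show ?case by simp
next
  case (neg \<gamma>)
  have "mk (elts Sg - elts (Intp \<gamma>)) \<in> sig" by (rule sig_compl[OF neg(2)])
  then show ?case unfolding Intp_mk[OF borel_codes.neg[OF neg(1)]] interp_neg elts_Intp[OF neg(1)] Sg(2) .
next
  case (join \<Gamma>)
  obtain f where f: "f \<in> V" "ap f ` elts \<kappa> = elts \<Gamma>" using join(2) by (rule indexed_byE)
  have "mk (\<Union>i\<in>elts \<kappa>. elts (Intp (ap f i))) \<in> sig"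
    by (rule sig_UN[OF T_Intp_ap[OF f(1)] kappa(1)]) (use join(3) f(2) in auto)
  moreover have "(\<Union>i\<in>elts \<kappa>. elts (Intp (ap f i))) = interp V L X (code_join \<Gamma>)"
    unfolding interp_join f(2)[symmetric] using elts_Intp join(3) f(2) by fastforce
  moreover have "code_join \<Gamma> \<in> codes" using join by (intro borel_codes.join) auto
  ultimately show ?case by (simp add: Intp_mk)
next
  case (meet \<Gamma>)
  obtain f where f: "f \<in> V" "ap f ` elts \<kappa> = elts \<Gamma>" using meet(2) by (rule indexed_byE)
  \<comment> \<open>A meet is treated as the complement of the union of the complements.\<close>
  have T: "T (\<lambda>e. mk {x \<in> elts Sg. x \<notin> elts (Intp (ap f (e 0)))})"
    by (intro def_intros T_const f)
  have "mk (elts Sg - elts (mk (\<Union>i\<in>elts \<kappa>. elts (mk {x \<in> elts Sg. x \<notin> elts (Intp (ap f i))})))) \<in> sig"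
    by (rule sig_compl, rule sig_UN[OF T kappa(1)])
      (use meet(3) f(2) sig_compl in \<open>auto simp: set_diff_eq\<close>)
  moreover have "elts Sg - (\<Union>i\<in>elts \<kappa>. elts (mk {x \<in> elts Sg. x \<notin> elts (Intp (ap f i))})) =
      interp V L X (code_meet \<Gamma>)"
    unfolding interp_meet f(2)[symmetric] Sg(2)[symmetric] set_diff_eq[symmetric] elts_Sg_diff
    using elts_Intp meet(3) f(2) by fastforce
  moreover have "code_meet \<Gamma> \<in> codes" using meet by (intro borel_codes.meet) auto
  ultimately show ?case by (simp add: Intp_mk elts_mk_UN[OF kappa(1) T])
qed

subsection \<open>The forcing order\<close>

abbreviation P :: "'k hset set" where "P \<equiv> O_plus V \<kappa> L X \<mu>"

lemma code_measure_eq: "\<gamma> \<in> codes \<Longrightarrow> code_measure V L X \<mu> \<gamma> = m (Intp \<gamma>)"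
  by (simp add: code_measure_def m_def elts_Intp)

lemma P_iff: "\<gamma> \<in> P \<longleftrightarrow> \<gamma> \<in> codes \<and> \<not> null (Intp \<gamma>)"
proof (cases "\<gamma> \<in> codes")
  case True
  then have "null (Intp \<gamma>) \<longleftrightarrow> m (Intp \<gamma>) = 0" "0 \<le> m (Intp \<gamma>)"
    using null_iff m_code Intp_sig by blast+
  then show ?thesis using True by (auto simp: O_plus_def code_measure_eq)
qed (simp add: O_plus_def)

lemma interp_neg_code: "\<gamma> \<in> codes \<Longrightarrow> elts (Intp (code_neg \<gamma>)) = elts Sg - elts (Intp \<gamma>)"
  by (simp add: elts_Intp borel_codes.neg interp_neg Sg(2))

lemma forcing_le_iff:
  assumes "\<gamma> \<in> codes" "\<zeta> \<in> codes"
  shows "forcing_le V L X \<mu> \<gamma> \<zeta> \<longleftrightarrow> null (mk (elts (Intp \<gamma>) - elts (Intp \<zeta>)))"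
proof -
  have "interp V L X (code_meet (mk {\<gamma>, code_neg \<zeta>})) = elts (Intp \<gamma>) - elts (Intp \<zeta>)"
    using interp_subset[OF assms(1)]
    unfolding interp_meet elts_mk_pair elts_Intp[OF assms(1)] elts_Intp[OF assms(2)] Sg(2)
    by (auto simp: interp_neg)
  also have "\<dots> = elts (mk (elts (Intp \<gamma>) - elts (Intp \<zeta>)))"
    by (rule elts_sig_diff[symmetric, OF Intp_sig[OF assms(1)]])
  finally show ?thesis unfolding forcing_le_def code_measure_def
    using null_iff[OF sig_diff[OF Intp_sig Intp_sig]] assms by (simp add: m_def)
qed

lemma pair_code:
  assumes "p \<in> codes" "q \<in> codes"
  shows "code_meet (mk {p, q}) \<in> codes" "elts (Intp (code_meet (mk {p, q}))) = elts (Intp p) \<inter> elts (Intp q)"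
proof -
  obtain k0 k1 where k: "k0 \<in> elts \<kappa>" "k1 \<in> elts \<kappa>" "k0 \<noteq> k1" by (rule two_indices)
  let ?g = "graph (\<lambda>i. if i = k0 then p else q) \<kappa>"
  have "?g \<in> V"
    by (rule graph_in_V[where F = "\<lambda>i. if i = k0 then p else q", OF T_two kappa(1)])
      (use k kappa_V assms codes_in_V in blast)+
  moreover have "app ?g ` elts \<kappa> = {p, q}"
    using k by (auto simp: app_graph image_iff)
  ultimately have "indexed_by V \<kappa> (mk {p, q})" unfolding indexed_by_def
    using graph_fun[of _ \<kappa>] by (intro bexI[of _ ?g]) auto
  then show c: "code_meet (mk {p, q}) \<in> codes"
    using assms codes_in_V by (intro borel_codes.meet pair_in_V) auto
  show "elts (Intp (code_meet (mk {p, q}))) = elts (Intp p) \<inter> elts (Intp q)"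
    unfolding elts_Intp[OF c] elts_Intp[OF assms(1)] elts_Intp[OF assms(2)] interp_meet elts_mk_pair
    using interp_subset[OF assms(1)] Sg(2) by auto
qed

text \<open>\<open>borel_codes\<close> need not be shown to be a set of the model: one code for each measurable set is
  enough to make up a dense set.\<close>

lemma dense_codes:
  obtains D0 where "D0 \<in> V" "elts D0 \<subseteq> P" "\<forall>p\<in>P. \<exists>d\<in>elts D0. Intp d = Intp p"
proof -
  \<comment> \<open>The measurable sets form a set of \<open>V\<close>, being the domain of
    \<open>\<mu>\<close>; collection over it bounds the search for codes.\<close>
  have "D (\<lambda>e. e 1 \<in> codes \<and> Intp (e 1) = e 0)" by (intro def_intros)
  then obtain b where b: "b \<in> V"
    "\<forall>A\<in>elts (dom_of \<mu>). (\<exists>\<gamma>\<in>V. \<gamma> \<in> codes \<and> Intp \<gamma> = A) \<longrightarrow> (\<exists>\<gamma>\<in>elts b. \<gamma> \<in> codes \<and> Intp \<gamma> = A)"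
    using collection[where Q = "\<lambda>A \<gamma>. \<gamma> \<in> codes \<and> Intp \<gamma> = A", OF _ sig_set(1)] by blast
  let ?D0 = "mk {\<gamma> \<in> elts b. \<gamma> \<in> codes \<and> \<not> null (Intp \<gamma>)}"
  have e: "elts ?D0 = {\<gamma> \<in> elts b. \<gamma> \<in> codes \<and> \<not> null (Intp \<gamma>)}" by (rule elts_mk_subset) blast
  show thesis
  proof (rule that)
    show "?D0 \<in> V"
      by (rule T_in_V1[where h = "\<lambda>b. mk {\<gamma> \<in> elts b. \<gamma> \<in> codes \<and> \<not> null (Intp \<gamma>)}", OF _ b(1)])
        (intro def_intros)
    show "elts ?D0 \<subseteq> P" unfolding e using P_iff by blast
    show "\<forall>p\<in>P. \<exists>d\<in>elts ?D0. Intp d = Intp p"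
    proof
      fix p assume p: "p \<in> P"
      then have "p \<in> codes" using P_iff by blast
      then have "Intp p \<in> elts (dom_of \<mu>)" "p \<in> V" using Intp_sig sig_set(2) codes_in_V by auto
      then obtain \<gamma> where "\<gamma> \<in> elts b" "\<gamma> \<in> codes" "Intp \<gamma> = Intp p" using b(2) \<open>p \<in> codes\<close> by blast
      then show "\<exists>d\<in>elts ?D0. Intp d = Intp p" unfolding e using p P_iff by auto
    qed
  qed
qed

end

section \<open>The generic structure\<close>

lemma arity_Nil: "arity [] = 0"
  by (simp add: arity_eq_iff)

lemma arity_Rel_upt: "arity [Rel R [0..<n]] = n"
  unfolding arity_eq_iff by auto

locale generic_model = measure_model V \<kappa> L X \<mu> for V :: "'k hset set" and \<kappa> L X \<mu> +
  fixes G :: "'k hset set"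
  assumes generic: "random_generic V \<kappa> L X \<mu> G"
begin

section \<open>The filter modulo null sets, and density arguments\<close>

lemma G_sub: "G \<subseteq> P" and G_nonempty: "G \<noteq> {}"
  and G_upward: "p \<in> G \<Longrightarrow> q \<in> P \<Longrightarrow> forcing_le V L X \<mu> p q \<Longrightarrow> q \<in> G"
  and G_directed: "p \<in> G \<Longrightarrow> q \<in> G \<Longrightarrow> \<exists>r\<in>G. forcing_le V L X \<mu> r p \<and> forcing_le V L X \<mu> r q"
  and G_generic: "D1 \<in> V \<Longrightarrow> dense_in P (forcing_le V L X \<mu>) (elts D1) \<Longrightarrow> G \<inter> elts D1 \<noteq> {}"
  using generic unfolding random_generic_def generic_filter_def filter_on_def by blast+

lemma G_code: "p \<in> G \<Longrightarrow> p \<in> codes" and G_not_null: "p \<in> G \<Longrightarrow> \<not> null (Intp p)"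
  using G_sub P_iff by blast+

lemma not_null_diff:
  assumes "A \<in> sig" "B \<in> sig" "null (mk (elts A - elts B))" "\<not> null A"
  shows "\<not> null B"
proof
  assume "null B"
  have "null (mk (elts (mk (elts A - elts B)) \<union> elts B))"
    by (rule null_Un[OF sig_diff[OF assms(1,2)] assms(2,3) \<open>null B\<close>])
  then have "null A"
    by (rule null_mono[rotated 3]) (use assms sig_Un sig_diff in
      \<open>auto simp: sig_Un_elts elts_sig_diff\<close>)
  then show False using assms(4) by simp
qed

text \<open>That \<open>q\<close> is a condition at all need not be assumed: a set that covers a set
  of positive measure up to a null set has positive measure.\<close>

lemma G_up_null:
  assumes "p \<in> G" "q \<in> codes" "null (mk (elts (Intp p) - elts (Intp q)))"
  shows "q \<in> G"
proof -
  have "\<not> null (Intp q)"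
    by (rule not_null_diff[OF Intp_sig Intp_sig assms(3)]) (use assms G_code G_not_null in auto)
  then have "q \<in> P" using assms(2) P_iff by blast
  then show ?thesis using G_upward assms forcing_le_iff G_code by blast
qed

lemma G_up:
  assumes "p \<in> G" "q \<in> codes" "elts (Intp p) \<subseteq> elts (Intp q)"
  shows "q \<in> G"
proof (rule G_up_null[OF assms(1,2)])
  have eq: "elts (Intp p) - elts (Intp q) = {}" using assms(3) by blast
  show "null (mk (elts (Intp p) - elts (Intp q)))" unfolding eq by (rule null_empty)
qed

lemma G_equiv: "\<gamma> \<in> codes \<Longrightarrow> \<zeta> \<in> codes \<Longrightarrow> elts (Intp \<gamma>) = elts (Intp \<zeta>) \<Longrightarrow> \<gamma> \<in> G \<longleftrightarrow> \<zeta> \<in> G"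
  using G_up by blast

text \<open>A common lower bound in \<open>G\<close> is contained in the meet up to the union of two
  null sets, so upward closure applies.\<close>

lemma G_meet2:
  assumes "p \<in> G" "q \<in> G"
  shows "code_meet (mk {p, q}) \<in> G"
proof -
  have c: "p \<in> codes" "q \<in> codes" using assms G_code by auto
  obtain r where r: "r \<in> G" "forcing_le V L X \<mu> r p" "forcing_le V L X \<mu> r q"
    using G_directed assms by blast
  have rc: "r \<in> codes" by (rule G_code[OF r(1)])
  note s = Intp_sig[OF rc] Intp_sig[OF c(1)] Intp_sig[OF c(2)]
  have "null (mk (elts (mk (elts (Intp r) - elts (Intp p))) \<union> elts (mk (elts (Intp r) - elts (Intp q)))))"
    using r(2,3) c rc s by (intro null_Un sig_diff) (auto simp: forcing_le_iff)
  moreover have "elts (mk (elts (Intp r) - elts (Intp p))) \<union> elts (mk (elts (Intp r) - elts (Intp q))) =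
      elts (Intp r) - elts (Intp (code_meet (mk {p, q})))"
    unfolding elts_sig_diff[OF s(1)] pair_code(2)[OF c] by blast
  ultimately show ?thesis using G_up_null[OF r(1) pair_code(1)[OF c]] by simp
qed

text \<open>The single access to genericity. Since \<open>Q\<close> sees only interpretations, any
  condition may be exchanged for one with the same interpretation from the set given by
  \<open>dense_codes\<close>; definability of \<open>Q\<close> then places the resulting dense set
  in \<open>V\<close>.\<close>

lemma G_decides:
  assumes Q: "D (\<lambda>e. Q (e 0))"
    and dense: "\<And>p. p \<in> P \<Longrightarrow> \<exists>q\<in>P. elts (Intp q) \<subseteq> elts (Intp p) \<and> Q (Intp q)"
  shows "\<exists>g\<in>G. Q (Intp g)"
proof -
  obtain D0 where D0: "D0 \<in> V" "elts D0 \<subseteq> P" "\<forall>p\<in>P. \<exists>d\<in>elts D0. Intp d = Intp p"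
    by (rule dense_codes)
  let ?D = "mk {d \<in> elts D0. Q (Intp d)}"
  have e: "elts ?D = {d \<in> elts D0. Q (Intp d)}" by (rule elts_mk_subset) blast
  have "?D \<in> V"
    by (rule T_in_V1[where h = "\<lambda>b. mk {d \<in> elts b. Q (Intp d)}", OF _ D0(1)])
      (intro def_intros D_subst1[OF Q])
  moreover have "dense_in P (forcing_le V L X \<mu>) (elts ?D)"
    unfolding dense_in_def
  proof (intro conjI ballI)
    show "elts ?D \<subseteq> P" using D0(2) e by blast
    fix p assume p: "p \<in> P"
    then obtain q where q: "q \<in> P" "elts (Intp q) \<subseteq> elts (Intp p)" "Q (Intp q)" using dense by blast
    then obtain d where d: "d \<in> elts D0" "Intp d = Intp q" using D0(3) by blast
    have eq: "elts (Intp d) - elts (Intp p) = {}" using d q by auto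
    have c: "d \<in> codes" "p \<in> codes" using d(1) D0(2) p P_iff by blast+
    have "forcing_le V L X \<mu> d p" unfolding forcing_le_iff[OF c] eq by (rule null_empty)
    then show "\<exists>d\<in>elts ?D. forcing_le V L X \<mu> d p" using d q(3) e by auto
  qed
  ultimately show ?thesis using G_generic e by blast
qed

text \<open>Supplies the conditions for density arguments: a half that is not null comes from a meet
  with a code or with its negation, and since \<open>Intp p\<close> is the union of both halves, at
  least one of them is available.\<close>

lemma split_P:
  assumes "p \<in> P" "\<gamma> \<in> codes"
  shows "\<not> null (mk (elts (Intp p) \<inter> elts (Intp \<gamma>))) \<Longrightarrow> \<exists>q\<in>P. elts (Intp q) = elts (Intp p) \<inter> elts (Intp \<gamma>)"
    and "\<not> null (mk (elts (Intp p) - elts (Intp \<gamma>))) \<Longrightarrow> \<exists>q\<in>P. elts (Intp q) = elts (Intp p) - elts (Intp \<gamma>)"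
    and "null (mk (elts (Intp p) \<inter> elts (Intp \<gamma>))) \<Longrightarrow> null (mk (elts (Intp p) - elts (Intp \<gamma>))) \<Longrightarrow> False"
proof -
  have p: "p \<in> codes" "\<not> null (Intp p)" using assms(1) P_iff by auto
  note s = Intp_sig[OF p(1)] Intp_sig[OF assms(2)]
  have *: "\<exists>q\<in>P. elts (Intp q) = elts (Intp p) \<inter> elts (Intp \<zeta>)"
    if "\<not> null (mk (elts (Intp p) \<inter> elts (Intp \<zeta>)))" "\<zeta> \<in> codes" for \<zeta>
  proof (rule bexI)
    show e: "elts (Intp (code_meet (mk {p, \<zeta>}))) = elts (Intp p) \<inter> elts (Intp \<zeta>)"
      by (rule pair_code(2)[OF p(1) that(2)])
    then have "Intp (code_meet (mk {p, \<zeta>})) = mk (elts (Intp p) \<inter> elts (Intp \<zeta>))" by (metis mk_elts)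
    then show "code_meet (mk {p, \<zeta>}) \<in> P" using pair_code(1)[OF p(1) that(2)] that(1) P_iff by simp
  qed
  show "\<not> null (mk (elts (Intp p) \<inter> elts (Intp \<gamma>))) \<Longrightarrow> \<exists>q\<in>P. elts (Intp q) = elts (Intp p) \<inter> elts (Intp \<gamma>)"
    using * assms(2) by blast
  have "elts (Intp p) \<inter> elts (Intp (code_neg \<gamma>)) = elts (Intp p) - elts (Intp \<gamma>)"
    unfolding interp_neg_code[OF assms(2)] using sig_subset[OF s(1)] by blast
  then show "\<not> null (mk (elts (Intp p) - elts (Intp \<gamma>))) \<Longrightarrow> \<exists>q\<in>P. elts (Intp q) = elts (Intp p) - elts (Intp \<gamma>)"
    using *[of "code_neg \<gamma>"] borel_codes.neg[OF assms(2)] by simp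
  assume n: "null (mk (elts (Intp p) \<inter> elts (Intp \<gamma>)))" "null (mk (elts (Intp p) - elts (Intp \<gamma>)))"
  have "elts (mk (elts (Intp p) \<inter> elts (Intp \<gamma>))) = elts (Intp p) \<inter> elts (Intp \<gamma>)"
    by (rule elts_mk_subset) blast
  then have "mk (elts (mk (elts (Intp p) \<inter> elts (Intp \<gamma>))) \<union> elts (mk (elts (Intp p) - elts (Intp \<gamma>)))) = Intp p"
    unfolding elts_sig_diff[OF s(1)] by (simp add: Int_Diff_Un)
  then show False using null_Un[OF sig_Int[OF s] sig_diff[OF s] n] p(2) by simp
qed

lemma G_neg: assumes "\<gamma> \<in> codes" shows "code_neg \<gamma> \<in> G \<longleftrightarrow> \<gamma> \<notin> G"
proof
  assume n: "code_neg \<gamma> \<in> G"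
  show "\<gamma> \<notin> G"
  proof
    assume "\<gamma> \<in> G"
    then have "code_meet (mk {\<gamma>, code_neg \<gamma>}) \<in> G" using n by (rule G_meet2)
    moreover have "elts (Intp (code_meet (mk {\<gamma>, code_neg \<gamma>}))) = {}"
      unfolding pair_code(2)[OF assms borel_codes.neg[OF assms]] interp_neg_code[OF assms] by blast
    then have "Intp (code_meet (mk {\<gamma>, code_neg \<gamma>})) = mk {}" by (simp only: elts_empty_iff)
    ultimately show False using G_not_null null_empty by metis
  qed
next
  assume g: "\<gamma> \<notin> G"
  \<comment> \<open>Conditions contained in \<open>\<gamma>\<close> or disjoint from it are dense.
    The filter thus contains one; the first kind would put \<open>\<gamma>\<close> into
    \<open>G\<close>, so it is of the second kind and lies below the negation.\<close>
  have "\<exists>g\<in>G. elts (Intp g) \<subseteq> elts (Intp \<gamma>) \<or> (\<forall>x\<in>elts (Intp g). x \<notin> elts (Intp \<gamma>))"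
  proof (rule G_decides[where Q = "\<lambda>A. elts A \<subseteq> elts (Intp \<gamma>) \<or> (\<forall>x\<in>elts A. x \<notin> elts (Intp \<gamma>))"])
    show "D (\<lambda>e. elts (e 0) \<subseteq> elts (Intp \<gamma>) \<or> (\<forall>x\<in>elts (e 0). x \<notin> elts (Intp \<gamma>)))"
      by (intro def_intros T_const Intp_in_V codes_in_V assms)
    fix p assume p: "p \<in> P"
    show "\<exists>q\<in>P. elts (Intp q) \<subseteq> elts (Intp p) \<and>
        (elts (Intp q) \<subseteq> elts (Intp \<gamma>) \<or> (\<forall>x\<in>elts (Intp q). x \<notin> elts (Intp \<gamma>)))"
    proof (cases "null (mk (elts (Intp p) \<inter> elts (Intp \<gamma>)))")
      case False
      then obtain q where "q \<in> P" "elts (Intp q) = elts (Intp p) \<inter> elts (Intp \<gamma>)"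
        using split_P(1)[OF p assms] by blast
      then show ?thesis by blast
    next
      case True
      then obtain q where "q \<in> P" "elts (Intp q) = elts (Intp p) - elts (Intp \<gamma>)"
        using split_P(2,3)[OF p assms] by blast
      then show ?thesis by blast
    qed
  qed
  then obtain q where q: "q \<in> G" "elts (Intp q) \<subseteq> elts (Intp \<gamma>) \<or> (\<forall>x\<in>elts (Intp q). x \<notin> elts (Intp \<gamma>))"
    by blast
  then have "\<forall>x\<in>elts (Intp q). x \<notin> elts (Intp \<gamma>)" using G_up[OF q(1) assms] g by blast
  then have "elts (Intp q) \<subseteq> elts (Intp (code_neg \<gamma>))"
    unfolding interp_neg_code[OF assms] using interp_subset[OF G_code[OF q(1)]] elts_Intp[OF G_code[OF q(1)]] by auto
  then show "code_neg \<gamma> \<in> G" by (rule G_up[OF q(1) borel_codes.neg[OF assms]])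
qed

lemma null_family:
  assumes H: "T (\<lambda>e. H (e 0))" and ind: "indexed_by V \<kappa> \<Gamma>"
    and sig: "\<And>\<delta>. \<delta> \<in> elts \<Gamma> \<Longrightarrow> H \<delta> \<in> sig" and null: "\<And>\<delta>. \<delta> \<in> elts \<Gamma> \<Longrightarrow> null (H \<delta>)"
  shows "null (mk (\<Union>\<delta>\<in>elts \<Gamma>. elts (H \<delta>)))"
proof -
  obtain f where f: "f \<in> V" "ap f ` elts \<kappa> = elts \<Gamma>" using ind by (rule indexed_byE)
  have "T (\<lambda>e. H (ap f (e 0)))" by (rule T_subst1[OF H]) (intro def_intros T_const f)
  then have "null (mk (\<Union>i\<in>elts \<kappa>. elts (H (ap f i))))"
    by (rule null_UN) (use sig null f(2) in auto)
  then show ?thesis unfolding f(2)[symmetric] image_image .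
qed

lemma G_join:
  assumes Gam: "\<Gamma> \<in> V" "indexed_by V \<kappa> \<Gamma>" "elts \<Gamma> \<subseteq> codes"
  shows "code_join \<Gamma> \<in> G \<longleftrightarrow> (\<exists>\<delta>\<in>elts \<Gamma>. \<delta> \<in> G)"
proof
  have c: "code_join \<Gamma> \<in> codes" using Gam by (intro borel_codes.join) auto
  have e: "elts (Intp (code_join \<Gamma>)) = (\<Union>\<delta>\<in>elts \<Gamma>. elts (Intp \<delta>))"
    unfolding elts_Intp[OF c] interp_join using Gam(3) elts_Intp by auto
  show "code_join \<Gamma> \<in> G" if "\<exists>\<delta>\<in>elts \<Gamma>. \<delta> \<in> G"
    using that G_up[OF _ c] e by blast
  assume G: "code_join \<Gamma> \<in> G"
  \<comment> \<open>The dense alternatives are to lie inside a single member of the family or to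
    miss the join; the second contradicts the join being in \<open>G\<close>.\<close>
  let ?Q = "\<lambda>A. (\<exists>\<delta>\<in>elts \<Gamma>. elts A \<subseteq> elts (Intp \<delta>)) \<or> (\<forall>x\<in>elts A. x \<notin> elts (Intp (code_join \<Gamma>)))"
  have "\<exists>g\<in>G. ?Q (Intp g)"
  proof (rule G_decides)
    show "D (\<lambda>e. ?Q (e 0))"
      by (intro def_intros T_const[OF Gam(1)] T_const[OF codes_in_V[OF c]])
    fix p assume p: "p \<in> P"
    show "\<exists>q\<in>P. elts (Intp q) \<subseteq> elts (Intp p) \<and> ?Q (Intp q)"
    proof (cases "\<exists>\<delta>\<in>elts \<Gamma>. \<not> null (mk (elts (Intp p) \<inter> elts (Intp \<delta>)))")
      case True
      then obtain \<delta> where d: "\<delta> \<in> elts \<Gamma>" "\<not> null (mk (elts (Intp p) \<inter> elts (Intp \<delta>)))" by blast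
      then obtain q where "q \<in> P" "elts (Intp q) = elts (Intp p) \<inter> elts (Intp \<delta>)"
        using split_P(1)[OF p] Gam(3) by blast
      then show ?thesis using d(1) by blast
    next
      case False
      have pc: "p \<in> codes" using p P_iff by blast
      have eI: "elts (mk (elts (Intp p) \<inter> S)) = elts (Intp p) \<inter> S" for S
        by (rule elts_mk_subset[of _ "Intp p"]) blast
      have "T (\<lambda>e. mk {x \<in> elts (Intp p). x \<in> elts (Intp (e 0))})"
        by (intro def_intros T_const[OF codes_in_V[OF pc]])
      then have T: "T (\<lambda>e. mk (elts (Intp p) \<inter> elts (Intp (e 0))))" by (simp only: Int_def)
      \<comment> \<open>Here additivity over \<open>\<kappa>\<close> enters: if \<open>p\<close>
        meets every member of \<open>\<Gamma>\<close> in a null set, it meets the join in a null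
        set, and the rest of \<open>p\<close> is a condition that misses the join.\<close>
      have "null (mk (\<Union>\<delta>\<in>elts \<Gamma>. elts (mk (elts (Intp p) \<inter> elts (Intp \<delta>)))))"
        by (rule null_family[OF T Gam(2)]) (use False Gam(3) sig_Int Intp_sig pc in blast)+
      also have "(\<Union>\<delta>\<in>elts \<Gamma>. elts (mk (elts (Intp p) \<inter> elts (Intp \<delta>)))) =
          elts (Intp p) \<inter> elts (Intp (code_join \<Gamma>))" unfolding eI e by blast
      finally obtain q where "q \<in> P" "elts (Intp q) = elts (Intp p) - elts (Intp (code_join \<Gamma>))"
        using split_P(2,3)[OF p c] by blast
      then show ?thesis by blast
    qed
  qed
  then obtain g where g: "g \<in> G" "?Q (Intp g)" by blast
  show "\<exists>\<delta>\<in>elts \<Gamma>. \<delta> \<in> G"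
  proof (cases "\<exists>\<delta>\<in>elts \<Gamma>. elts (Intp g) \<subseteq> elts (Intp \<delta>)")
    case True
    then show ?thesis using G_up[OF g(1)] Gam(3) by blast
  next
    case False
    then have "elts (Intp g) \<subseteq> elts (Intp (code_neg (code_join \<Gamma>)))"
      unfolding interp_neg_code[OF c] using g(2) interp_subset[OF G_code[OF g(1)]] elts_Intp[OF G_code[OF g(1)]] by auto
    then have "code_neg (code_join \<Gamma>) \<in> G" by (rule G_up[OF g(1) borel_codes.neg[OF c]])
    then show ?thesis using G_neg[OF c] G by blast
  qed
qed

lemma G_meet:
  assumes Gam: "\<Gamma> \<in> V" "indexed_by V \<kappa> \<Gamma>" "elts \<Gamma> \<subseteq> codes"
  shows "code_meet \<Gamma> \<in> G \<longleftrightarrow> (\<forall>\<delta>\<in>elts \<Gamma>. \<delta> \<in> G)"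
proof
  have c: "code_meet \<Gamma> \<in> codes" using Gam by (intro borel_codes.meet) auto
  have e: "elts (Intp (code_meet \<Gamma>)) = elts Sg \<inter> (\<Inter>\<delta>\<in>elts \<Gamma>. elts (Intp \<delta>))"
    unfolding elts_Intp[OF c] interp_meet Sg(2) using Gam(3) elts_Intp by auto
  show "\<forall>\<delta>\<in>elts \<Gamma>. \<delta> \<in> G" if "code_meet \<Gamma> \<in> G"
    using G_up[OF that] e Gam(3) by blast
  assume G: "\<forall>\<delta>\<in>elts \<Gamma>. \<delta> \<in> G"
  \<comment> \<open>The dual dense set: conditions that miss some member of the family, or lie
    inside the meet. The first kind would put the negation of a member into
    \<open>G\<close>.\<close>
  let ?Q = "\<lambda>A. (\<exists>\<delta>\<in>elts \<Gamma>. \<forall>x\<in>elts A. x \<notin> elts (Intp \<delta>)) \<or> elts A \<subseteq> elts (Intp (code_meet \<Gamma>))"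
  have "\<exists>g\<in>G. ?Q (Intp g)"
  proof (rule G_decides)
    show "D (\<lambda>e. ?Q (e 0))"
      by (intro def_intros T_const[OF Gam(1)] T_const[OF codes_in_V[OF c]])
    fix p assume p: "p \<in> P"
    show "\<exists>q\<in>P. elts (Intp q) \<subseteq> elts (Intp p) \<and> ?Q (Intp q)"
    proof (cases "\<exists>\<delta>\<in>elts \<Gamma>. \<not> null (mk (elts (Intp p) - elts (Intp \<delta>)))")
      case True
      then obtain \<delta> where d: "\<delta> \<in> elts \<Gamma>" "\<not> null (mk (elts (Intp p) - elts (Intp \<delta>)))" by blast
      then obtain q where "q \<in> P" "elts (Intp q) = elts (Intp p) - elts (Intp \<delta>)"
        using split_P(2)[OF p] Gam(3) by blast
      then show ?thesis using d(1) by blast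
    next
      case False
      have pc: "p \<in> codes" using p P_iff by blast
      have pS: "elts (Intp p) \<subseteq> elts Sg" by (rule sig_subset[OF Intp_sig[OF pc]])
      have "T (\<lambda>e. mk {x \<in> elts (Intp p). x \<notin> elts (Intp (e 0))})"
        by (intro def_intros T_const[OF codes_in_V[OF pc]])
      then have T: "T (\<lambda>e. mk (elts (Intp p) - elts (Intp (e 0))))" by (simp only: set_diff_eq)
      \<comment> \<open>Dually, if \<open>p\<close> exceeds each member only by a null set, it
        exceeds the meet by a union of these null sets.\<close>
      have "null (mk (\<Union>\<delta>\<in>elts \<Gamma>. elts (mk (elts (Intp p) - elts (Intp \<delta>)))))"
        by (rule null_family[OF T Gam(2)]) (use False Gam(3) sig_diff Intp_sig pc in blast)+
      also have "(\<Union>\<delta>\<in>elts \<Gamma>. elts (mk (elts (Intp p) - elts (Intp \<delta>)))) =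
          elts (Intp p) - elts (Intp (code_meet \<Gamma>))"
        unfolding elts_sig_diff[OF Intp_sig[OF pc]] e using pS by blast
      finally obtain q where "q \<in> P" "elts (Intp q) = elts (Intp p) \<inter> elts (Intp (code_meet \<Gamma>))"
        using split_P(1,3)[OF p c] by blast
      then show ?thesis by blast
    qed
  qed
  then obtain g where g: "g \<in> G" "?Q (Intp g)" by blast
  show "code_meet \<Gamma> \<in> G"
  proof (cases "elts (Intp g) \<subseteq> elts (Intp (code_meet \<Gamma>))")
    case True
    then show ?thesis by (rule G_up[OF g(1) c])
  next
    case False
    then obtain \<delta> where d: "\<delta> \<in> elts \<Gamma>" "\<forall>x\<in>elts (Intp g). x \<notin> elts (Intp \<delta>)" using g(2) by blast
    then have dc: "\<delta> \<in> codes" using Gam(3) by blast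
    have "elts (Intp g) \<subseteq> elts (Intp (code_neg \<delta>))"
      unfolding interp_neg_code[OF dc] using d(2) interp_subset[OF G_code[OF g(1)]] elts_Intp[OF G_code[OF g(1)]] by auto
    then have "code_neg \<delta> \<in> G" by (rule G_up[OF g(1) borel_codes.neg[OF dc]])
    then show ?thesis using G_neg[OF dc] G d(1) by blast
  qed
qed

subsection \<open>Literals decided by the generic filter\<close>

definition lit_code :: "'k literal \<Rightarrow> 'k hset list \<Rightarrow> 'k hset" where
  "lit_code l xs = code_basic [l] (take (arity [l]) xs)"

text \<open>The empty conjunction is interpreted as the whole space. It is the trivial condition
  used in names, and it is itself a basic code in \<open>G\<close>.\<close>

definition top_code :: "'k hset" where "top_code = code_basic [] []"

lemma conj_instance_code: "conj_instance L X \<phi> xs \<Longrightarrow> code_basic \<phi> xs \<in> basic_codes V L X"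
  unfolding basic_codes_eq by blast

lemma elts_Intp_basic:
  assumes "conj_instance L X \<phi> xs"
  shows "elts (Intp (code_basic \<phi> xs)) = {M \<in> elts Sg. conj_sat M xs \<phi>}"
  using elts_Intp[OF borel_codes.basic[OF conj_instance_code[OF assms]]] by (simp add: interp_basic Sg(2))

lemma lit_code:
  assumes "literal_in L l" "\<forall>v\<in>vars l. v < length xs" "set xs \<subseteq> elts X"
  shows "lit_code l xs \<in> basic_codes V L X" "lit_code l xs \<in> codes"
    and "elts (Intp (lit_code l xs)) = {M \<in> elts Sg. literal_sat M xs l}"
proof -
  show b: "lit_code l xs \<in> basic_codes V L X"
    unfolding lit_code_def by (rule conj_instance_code[OF literal_take(1)[OF assms]])
  then show "lit_code l xs \<in> codes" by (rule borel_codes.basic)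
  show "elts (Intp (lit_code l xs)) = {M \<in> elts Sg. literal_sat M xs l}"
    unfolding lit_code_def elts_Intp_basic[OF literal_take(1)[OF assms]]
    by (simp add: conj_sat_def literal_take(2)[OF assms])
qed

lemma top_code: "top_code \<in> basic_codes V L X" "top_code \<in> codes" "top_code \<in> G" "top_code \<in> P" "top_code \<in> V"
proof -
  have c: "conj_instance L X [] []" by (simp add: conj_instance_def arity_Nil)
  show b: "top_code \<in> basic_codes V L X" unfolding top_code_def by (rule conj_instance_code[OF c])
  show t: "top_code \<in> codes" by (rule borel_codes.basic[OF b])
  obtain p where p: "p \<in> G" using G_nonempty by blast
  have "elts (Intp top_code) = elts Sg" unfolding top_code_def elts_Intp_basic[OF c] by (simp add: conj_sat_def)
  then show "top_code \<in> G" using G_up[OF p t] sig_subset[OF Intp_sig[OF G_code[OF p]]] by simp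
  then show "top_code \<in> P" using G_sub by blast
  show "top_code \<in> V" by (rule codes_in_V[OF t])
qed

text \<open>A conjunction belongs to \<open>G\<close> as soon as its literals do because a filter is
  closed under finite meets; each literal gets its own code over a shortened tuple.\<close>

lemma G_basic:
  assumes c: "conj_instance L X \<phi> xs"
  shows "code_basic \<phi> xs \<in> G \<longleftrightarrow> (\<forall>l\<in>set \<phi>. lit_code l xs \<in> G)"
proof -
  have xs: "set xs \<subseteq> elts X" using c by (simp add: conj_instance_def)
  have l: "literal_in L l" "\<forall>v\<in>vars l. v < length xs" if "l \<in> set \<phi>" for l
    using c that conj_instance_vars[OF c that] by (auto simp: conj_instance_def)
  have code: "code_basic \<phi> xs \<in> codes" by (rule borel_codes.basic[OF conj_instance_code[OF c]])
  show ?thesis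
  proof
    assume g: "code_basic \<phi> xs \<in> G"
    show "\<forall>l\<in>set \<phi>. lit_code l xs \<in> G"
    proof
      fix l' assume l': "l' \<in> set \<phi>"
      show "lit_code l' xs \<in> G"
        by (rule G_up[OF g lit_code(2)[OF l[OF l'] xs]])
          (use l' in \<open>auto simp: lit_code(3)[OF l[OF l'] xs] elts_Intp_basic[OF c] conj_sat_def\<close>)
    qed
  next
    assume g: "\<forall>l\<in>set \<phi>. lit_code l xs \<in> G"
    \<comment> \<open>The induction runs over lists of literals from \<open>\<phi>\<close>,
      collecting them one by one into a single condition of \<open>G\<close>.\<close>
    have "\<exists>r\<in>G. \<forall>l\<in>set \<psi>. elts (Intp r) \<subseteq> elts (Intp (lit_code l xs))" if "set \<psi> \<subseteq> set \<phi>" for \<psi>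
      using that
    proof (induction \<psi>)
      case Nil
      then show ?case using G_nonempty by auto
    next
      case (Cons l' \<psi>)
      then obtain r where r: "r \<in> G" "\<forall>l\<in>set \<psi>. elts (Intp r) \<subseteq> elts (Intp (lit_code l xs))" by auto
      have l': "lit_code l' xs \<in> G" using g Cons(2) by simp
      have "elts (Intp (code_meet (mk {r, lit_code l' xs}))) = elts (Intp r) \<inter> elts (Intp (lit_code l' xs))"
        by (rule pair_code(2)[OF G_code[OF r(1)] G_code[OF l']])
      then show ?case using G_meet2[OF r(1) l'] r(2) by (intro bexI[of _ "code_meet (mk {r, lit_code l' xs})"]) auto
    qed
    then obtain r where r: "r \<in> G" "\<forall>l\<in>set \<phi>. elts (Intp r) \<subseteq> elts (Intp (lit_code l xs))" by blast
    show "code_basic \<phi> xs \<in> G"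
    proof (rule G_up[OF r(1) code], rule subsetI)
      fix M assume M: "M \<in> elts (Intp r)"
      then have "M \<in> elts Sg" using sig_subset[OF Intp_sig[OF G_code[OF r(1)]]] by blast
      moreover have "literal_sat M xs l'" if l': "l' \<in> set \<phi>" for l'
        using r(2) M l' lit_code(3)[OF l[OF l'] xs] by blast
      ultimately show "M \<in> elts (Intp (code_basic \<phi> xs))"
        unfolding elts_Intp_basic[OF c] conj_sat_def by blast
    qed
  qed
qed

abbreviation atom :: "'k hset \<Rightarrow> 'k hset list \<Rightarrow> 'k hset" where
  "atom R ys \<equiv> code_basic [Rel R [0..<length ys]] ys"

definition rel_G :: "'k hset \<Rightarrow> 'k hset" where
  "rel_G R = mk {s \<in> elts FS. \<exists>ys. s = seq ys \<and> opair R (von (length ys)) \<in> elts L \<and> atom R ys \<in> G}"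

definition M_G :: "'k hset" where "M_G = opair X (graph rel_G (dom_of L))"

lemma elts_rel_G: "elts (rel_G R) =
    {s \<in> elts FS. \<exists>ys. s = seq ys \<and> opair R (von (length ys)) \<in> elts L \<and> atom R ys \<in> G}"
  unfolding rel_G_def by (rule elts_mk_subset) blast

lemma seq_rel_G:
  assumes "set ys \<subseteq> elts X"
  shows "seq ys \<in> elts (rel_G R) \<longleftrightarrow> opair R (von (length ys)) \<in> elts L \<and> atom R ys \<in> G"
  unfolding elts_rel_G FS(2) using assms by auto

lemma osnd_M_G: "R \<in> fdom L \<Longrightarrow> app (osnd M_G) R = rel_G R"
  using app_graph[of R "dom_of L" rel_G] elts_dom_of[OF L(1)] by (simp add: M_G_def)

lemma lit_code_atom: "lit_code (Rel R [0..<length ys]) ys = atom R ys"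
  by (simp add: lit_code_def arity_Rel_upt)

lemma lit_truth:
  assumes xs: "set xs \<subseteq> elts X"
  shows "literal_in L l \<Longrightarrow> \<forall>v\<in>vars l. v < length xs \<Longrightarrow> lit_code l xs \<in> G \<longleftrightarrow> literal_sat M_G xs l"
proof (induction l)
  case (Rel R vs)
  \<comment> \<open>\<open>rel_G\<close> is defined from atoms in the variables
    \<open>0, 1, ...\<close> only. An atom with repeated or permuted variables \<open>vs\<close> at
    \<open>xs\<close> has the same interpretation as the standard atom at the tuple that
    \<open>vs\<close> selects.\<close>
  define ys where "ys = map ((!) xs) vs"
  have len: "length ys = length vs" by (simp add: ys_def)
  have R: "opair R (von (length ys)) \<in> elts L" "R \<in> fdom L" using Rel(1) len by (auto simp: fdom_def)
  have ysX: "set ys \<subseteq> elts X" using Rel(2) xs by (auto simp: ys_def)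
  have lit: "literal_in L (Rel R [0..<length ys])" "\<forall>v\<in>vars (Rel R [0..<length ys]). v < length ys"
    using R by simp_all
  have "elts (Intp (lit_code (Rel R vs) xs)) = elts (Intp (lit_code (Rel R [0..<length ys]) ys))"
    unfolding lit_code(3)[OF Rel(1,2) xs] lit_code(3)[OF lit ysX]
    by (simp add: map_nth ys_def[symmetric])
  then have "lit_code (Rel R vs) xs \<in> G \<longleftrightarrow> atom R ys \<in> G"
    unfolding lit_code_atom[symmetric]
    by (rule G_equiv[OF lit_code(2)[OF Rel(1,2) xs] lit_code(2)[OF lit ysX]])
  also have "\<dots> \<longleftrightarrow> seq ys \<in> elts (rel_G R)" using seq_rel_G[OF ysX] R by simp
  also have "\<dots> \<longleftrightarrow> literal_sat M_G xs (Rel R vs)" using osnd_M_G[OF R(2)] by (simp add: ys_def)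
  finally show ?case .
next
  case (Equal i j)
  \<comment> \<open>An equality between entries of \<open>xs\<close> holds in all structures or in
    none, so its code is interpreted as the whole space or as the empty set.\<close>
  have e: "elts (Intp (lit_code (Equal i j) xs)) = (if xs ! i = xs ! j then elts Sg else {})"
    unfolding lit_code(3)[OF Equal xs] by simp
  show ?case
  proof (cases "xs ! i = xs ! j")
    case True
    then have "lit_code (Equal i j) xs \<in> G"
      using e sig_subset[OF Intp_sig[OF top_code(2)]] by (intro G_up[OF top_code(3) lit_code(2)[OF Equal xs]]) simp
    then show ?thesis using True by simp
  next
    case False
    then have "elts (Intp (lit_code (Equal i j) xs)) = {}" using e by simp
    then have "Intp (lit_code (Equal i j) xs) = mk {}" by (simp only: elts_empty_iff)
    then have "lit_code (Equal i j) xs \<notin> G" using G_not_null null_empty by metis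
    then show ?thesis using False by simp
  qed
next
  case (Neg l)
  have l: "literal_in L l" "\<forall>v\<in>vars l. v < length xs" using Neg(2,3) by simp_all
  have "elts (Intp (lit_code (Neg l) xs)) = elts (Intp (code_neg (lit_code l xs)))"
    unfolding lit_code(3)[OF Neg(2,3) xs] interp_neg_code[OF lit_code(2)[OF l xs]] lit_code(3)[OF l xs]
    by auto
  then have "lit_code (Neg l) xs \<in> G \<longleftrightarrow> code_neg (lit_code l xs) \<in> G"
    by (rule G_equiv[OF lit_code(2)[OF Neg(2,3) xs] borel_codes.neg[OF lit_code(2)[OF l xs]]])
  then show ?case using G_neg[OF lit_code(2)[OF l xs]] Neg(1)[OF l] by simp
qed

subsection \<open>A name for the generic structure\<close>

text \<open>The canonical names of ground-model sets, with the trivial condition attached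
  hereditarily.\<close>

function check :: "'k hset \<Rightarrow> 'k hset" where
  "check x = mk ((\<lambda>y. opair (check y) top_code) ` elts x)"
  by pat_completeness auto
termination
  by (relation "{(x, y). x \<in> elts y}") (auto intro: wf_elts)

declare check.simps [simp del]

lemma elts_check: "elts (check x) = (\<lambda>y. opair (check y) top_code) ` elts x"
  by (subst check.simps) (rule elts_mk_image)

lemma T_check: "T (\<lambda>e. check (e 0))"
proof (rule T_rec)
  show "T (\<lambda>e. mk ((\<lambda>y. opair (ap (e 1) y) top_code) ` elts (e 0)))"
    by (intro def_intros T_const[OF top_code(5)])
  fix x f :: "'k hset"
  assume "\<And>z. (z, x) \<in> {(x, y). x \<in> elts y}\<^sup>+ \<Longrightarrow> ap f z = check z"
  then have "ap f z = check z" if "z \<in> elts x" for z using that by blast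
  then show "check x = mk ((\<lambda>y. opair (ap f y) top_code) ` elts x)" by (subst check.simps) simp
qed

lemma name_check: "name P (check x)"
proof (induction x rule: wf_induct[OF wf_elts])
  case (1 x)
  then show ?case using top_code(4) by (intro name.intros) (auto simp: elts_check)
qed

lemma val_check: "val G (check x) = x"
proof (induction x rule: wf_induct[OF wf_elts])
  case (1 x)
  have "{s. \<exists>p\<in>G. opair s p \<in> elts (check x)} = check ` elts x"
    using top_code(3) by (auto simp: elts_check)
  then have "elts (val G (check x)) = (\<lambda>y. val G (check y)) ` elts x"
    by (simp add: elts_val image_image)
  also have "\<dots> = elts x" using 1 by simp
  finally show ?case by (simp only: elts_inject)
qed

definition pair_name :: "'k hset \<Rightarrow> 'k hset \<Rightarrow> 'k hset" where
  "pair_name s t = mk {opair s top_code, opair t top_code}"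

definition opair_name :: "'k hset \<Rightarrow> 'k hset \<Rightarrow> 'k hset" where
  "opair_name s t = pair_name (pair_name s s) (pair_name s t)"

lemma name_pair: "name P s \<Longrightarrow> name P t \<Longrightarrow> name P (pair_name s t)"
  using top_code(4) by (intro name.intros) (auto simp: pair_name_def)

lemma val_pair: "val G (pair_name s t) = mk {val G s, val G t}"
proof -
  have "{u. \<exists>p\<in>G. opair u p \<in> elts (pair_name s t)} = {s, t}"
    using top_code(3) by (auto simp: pair_name_def)
  then have "elts (val G (pair_name s t)) = elts (mk {val G s, val G t})" by (simp add: elts_val)
  then show ?thesis by (simp only: elts_inject)
qed

lemma name_opair: "name P s \<Longrightarrow> name P t \<Longrightarrow> name P (opair_name s t)"
  unfolding opair_name_def by (intro name_pair)

lemma val_opair: "val G (opair_name s t) = opair (val G s) (val G t)"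
  by (simp add: opair_name_def val_pair opair_def)

text \<open>Rebuilds \<open>atom\<close> from the set \<open>s\<close> by operations of
  \<open>V\<close>: the identity function on the domain of \<open>s\<close> is the variable list
  \<open>[0..<n]\<close>, and the singleton around the literal is a conjunction of length
  one.\<close>

definition atom_code :: "'k hset \<Rightarrow> 'k hset \<Rightarrow> 'k hset" where
  "atom_code R s = opair (von 0) (opair (mk {opair (von 0)
     (opair (von 0) (opair R (mk ((\<lambda>i. opair i i) ` elts (dom_of s)))))}) s)"

lemma atom_code: "set ys \<subseteq> elts X \<Longrightarrow> atom_code R (seq ys) = atom R ys"
proof -
  assume "set ys \<subseteq> elts X"
  then have "elts (dom_of (seq ys)) = von ` {..<length ys}"
    using dom_of_seq[OF elts_X_V] by (simp add: elts_von)
  then have "elts (mk ((\<lambda>i. opair i i) ` elts (dom_of (seq ys)))) = elts (seq (map von [0..<length ys]))"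
    unfolding elts_mk_image elts_seq_image by (simp add: image_image)
  then have "mk ((\<lambda>i. opair i i) ` elts (dom_of (seq ys))) = seq (map von [0..<length ys])"
    by (simp only: elts_inject)
  moreover have "elts (seq [c]) = {opair (von 0) c}" for c :: "'k hset"
    unfolding elts_seq_image by (simp add: lessThan_Suc del: von.simps)
  then have "seq [c] = mk {opair (von 0) c}" for c :: "'k hset" by (metis mk_elts)
  ultimately show ?thesis by (simp add: atom_code_def code_basic_def del: von.simps)
qed

text \<open>Each tuple enters the relation under the condition that its atom belongs to
  \<open>G\<close>. Atoms of measure 0 are left out, as a name may only mention conditions; they are
  not in \<open>G\<close> either.\<close>

definition rel_name :: "'k hset \<Rightarrow> 'k hset" where
  "rel_name R = mk ((\<lambda>s. opair (check s) (atom_code R s)) ` elts (mk {s \<in> elts FS. dom_of s = ap L R \<and>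
     atom_code R s \<in> codes \<and> \<not> null (Intp (atom_code R s))}))"

definition name_G :: "'k hset" where
  "name_G = opair_name (check X)
     (mk ((\<lambda>R. opair (opair_name (check R) (rel_name R)) top_code) ` elts (dom_of L)))"

lemma elts_rel_name: "elts (rel_name R) = (\<lambda>s. opair (check s) (atom_code R s)) `
    {s \<in> elts FS. dom_of s = ap L R \<and> atom_code R s \<in> P}"
proof -
  have "elts (mk {s \<in> elts FS. dom_of s = ap L R \<and> atom_code R s \<in> codes \<and> \<not> null (Intp (atom_code R s))}) =
      {s \<in> elts FS. dom_of s = ap L R \<and> atom_code R s \<in> codes \<and> \<not> null (Intp (atom_code R s))}"
    by (rule elts_mk_subset) blast
  then show ?thesis unfolding rel_name_def elts_mk_image P_iff by simp
qed

lemma T_rel_name: "T (\<lambda>e. rel_name (e 0))"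
  unfolding rel_name_def atom_code_def by (intro def_intros T_subst1[OF T_check])

lemma name_G_in_V: "name_G \<in> V"
  unfolding name_G_def opair_name_def pair_name_def
  by (rule T_constD)
    (intro def_intros T_subst1[OF T_check] T_subst1[OF T_rel_name] T_const[OF top_code(5)])

lemma name_name_G: "name P name_G"
proof -
  have "name P (rel_name R)" for R
    using name_check by (intro name.intros) (auto simp: elts_rel_name)
  then have "name P (mk ((\<lambda>R. opair (opair_name (check R) (rel_name R)) top_code) ` elts (dom_of L)))"
    using top_code(4) name_opair[OF name_check] by (intro name.intros) (auto simp: elts_mk_image)
  then show ?thesis unfolding name_G_def by (intro name_opair name_check)
qed

lemma val_rel_name:
  assumes "R \<in> fdom L"
  shows "val G (rel_name R) = rel_G R"
proof -
  obtain n where n: "opair R (von n) \<in> elts L" "ap L R = von n" using arity_ex[OF assms] by blast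
  have "elts (val G (rel_name R)) = {s \<in> elts FS. dom_of s = ap L R \<and> atom_code R s \<in> G}"
  proof -
    have "{t. \<exists>p\<in>G. opair t p \<in> elts (rel_name R)} =
        check ` {s \<in> elts FS. dom_of s = ap L R \<and> atom_code R s \<in> G}"
      using G_sub by (auto simp: elts_rel_name)
    then show ?thesis by (simp add: elts_val image_image val_check)
  qed
  also have "\<dots> = elts (rel_G R)"
  proof (intro set_eqI)
    fix s
    show "s \<in> {s \<in> elts FS. dom_of s = ap L R \<and> atom_code R s \<in> G} \<longleftrightarrow> s \<in> elts (rel_G R)"
    proof (cases "s \<in> elts FS")
      case True
      then obtain ys where ys: "s = seq ys" "set ys \<subseteq> elts X" unfolding FS(2) by blast
      have "dom_of s = von (length ys)" using dom_of_seq[OF elts_X_V[OF ys(2)]] ys(1) by simp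
      moreover have "opair R (von (length ys)) \<in> elts L \<longleftrightarrow> length ys = n"
        using arity_iff[of R] n by auto
      ultimately show ?thesis using True ys atom_code[OF ys(2)] seq_rel_G[OF ys(2)] n(2) by simp
    qed (simp add: elts_rel_G)
  qed
  finally show ?thesis by (simp only: elts_inject)
qed

lemma val_name_G: "val G name_G = M_G"
proof -
  let ?t = "mk ((\<lambda>R. opair (opair_name (check R) (rel_name R)) top_code) ` elts (dom_of L))"
  have "{s. \<exists>p\<in>G. opair s p \<in> elts ?t} = (\<lambda>R. opair_name (check R) (rel_name R)) ` elts (dom_of L)"
    using top_code(3) by (auto simp: elts_mk_image)
  then have "elts (val G ?t) = (\<lambda>R. opair R (val G (rel_name R))) ` elts (dom_of L)"
    by (simp add: elts_val image_image val_opair val_check)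
  also have "\<dots> = elts (graph rel_G (dom_of L))"
    unfolding elts_graph using val_rel_name elts_dom_of[OF L(1)] by auto
  finally have "val G ?t = graph rel_G (dom_of L)" by (simp only: elts_inject)
  then show ?thesis by (simp add: name_G_def val_opair val_check M_G_def)
qed

abbreviation VG :: "'k hset set" where "VG \<equiv> random_extension V \<kappa> L X \<mu> G"

lemma M_G_in_VG: "M_G \<in> VG"
  unfolding random_extension_def generic_extension_def
  using name_G_in_V name_name_G val_name_G[symmetric] by blast

lemma M_G_Str: "M_G \<in> Str VG L X"
proof -
  have "elts (app (graph rel_G (dom_of L)) R) \<subseteq> {seq xs | xs. length xs = n \<and> set xs \<subseteq> elts X}"
    if R: "opair R (von n) \<in> elts L" for R n
  proof -
    have dom: "R \<in> elts (dom_of L)" using R elts_dom_of[OF L(1)] by (auto simp: fdom_def)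
    have "length ys = n" if "opair R (von (length ys)) \<in> elts L" for ys :: "'k hset list"
      using that R arity_iff[of R] by auto
    then show ?thesis unfolding app_graph[OF dom] elts_rel_G FS(2) by auto
  qed
  then show ?thesis unfolding Str_def
    using M_G_in_VG graph_fun[of rel_G "dom_of L"] elts_dom_of[OF L(1)] by (auto simp: M_G_def)
qed

subsection \<open>Truth in the generic structure\<close>

text \<open>The interpretation is computed in the extension, while membership in \<open>G\<close>
  refers to measures computed in \<open>V\<close>. The two sides meet at the literals, and the
  connectives are matched by the closure properties of \<open>G\<close>.\<close>

lemma truth: "\<gamma> \<in> codes \<Longrightarrow> M_G \<in> interp VG L X \<gamma> \<longleftrightarrow> \<gamma> \<in> G"
proof (induction rule: borel_codes.induct)
  case (basic \<gamma>)
  then obtain \<phi> xs where *: "\<gamma> = code_basic \<phi> xs" and c: "conj_instance L X \<phi> xs"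
    unfolding basic_codes_def by blast
  have xs: "set xs \<subseteq> elts X" using c by (simp add: conj_instance_def)
  have "lit_code l xs \<in> G \<longleftrightarrow> literal_sat M_G xs l" if "l \<in> set \<phi>" for l
    using lit_truth[OF xs _ conj_instance_vars[OF c that]] c that by (simp add: conj_instance_def)
  then have "code_basic \<phi> xs \<in> G \<longleftrightarrow> conj_sat M_G xs \<phi>" unfolding G_basic[OF c] conj_sat_def by blast
  then show ?case unfolding * interp_basic using M_G_Str by simp
next
  case (neg \<gamma>)
  then show ?case using M_G_Str by (simp add: interp_neg G_neg)
next
  case (join \<Gamma>)
  then have "elts \<Gamma> \<subseteq> codes" by blast
  then show ?case using join G_join[of \<Gamma>] by (simp add: interp_join)
next
  case (meet \<Gamma>)
  then have "elts \<Gamma> \<subseteq> codes" by blast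
  then show ?case using meet G_meet[of \<Gamma>] M_G_Str by (simp add: interp_meet)
qed

text \<open>Negated literals are basic codes too. Hence for each atom either it or its negation has
  a code in \<open>G\<close>, and a structure in the intersection must agree with \<open>M_G\<close>
  on it.\<close>

lemma M_G_unique:
  assumes "M \<in> (\<Inter>g\<in>G \<inter> basic_codes V L X. interp VG L X g)"
  shows "M = M_G"
proof -
  have M: "M \<in> interp VG L X g" if "g \<in> G" "g \<in> basic_codes V L X" for g using assms that by blast
  \<comment> \<open>The trivial code is one of the basic codes in \<open>G\<close>, so the
    intersection is not over an empty family and consists of structures of the extension.\<close>
  have "M \<in> Str VG L X" using M[OF top_code(3,1)] unfolding top_code_def interp_basic by blast
  then obtain I where I: "M = opair X I" "is_fun I" "fdom I = fdom L"
    "\<And>R n. opair R (von n) \<in> elts L \<Longrightarrow> elts (app I R) \<subseteq> {seq xs | xs. length xs = n \<and> set xs \<subseteq> elts X}"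
    unfolding Str_def by blast
  have "app I R = rel_G R" if R: "R \<in> fdom L" for R
  proof -
    obtain n where n: "opair R (von n) \<in> elts L" using arity_ex[OF R] by blast
    have rel: "seq ys \<in> elts (app I R) \<longleftrightarrow> seq ys \<in> elts (rel_G R)"
      if len: "length ys = n" and ys: "set ys \<subseteq> elts X" for ys
    proof -
      let ?l = "Rel R [0..<length ys]"
      have l: "literal_in L ?l" "\<forall>v\<in>vars ?l. v < length ys"
        and nl: "literal_in L (Neg ?l)" "\<forall>v\<in>vars (Neg ?l). v < length ys"
        using n len by simp_all
      have sat: "literal_sat M ys ?l \<longleftrightarrow> seq ys \<in> elts (app I R)" by (simp add: I(1) map_nth)
      have dec: "seq ys \<in> elts (rel_G R) \<longleftrightarrow> literal_sat M_G ys ?l"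
        using osnd_M_G[OF R] by (simp add: map_nth)
      have *: "literal_sat M ys l'" if "literal_in L l'" "\<forall>v\<in>vars l'. v < length ys" "literal_sat M_G ys l'" for l'
      proof -
        have "lit_code l' ys \<in> G" using lit_truth[OF ys that(1,2)] that(3) by simp
        then have "M \<in> interp VG L X (lit_code l' ys)" using M lit_code(1)[OF that(1,2) ys] by blast
        then show ?thesis
          unfolding lit_code_def interp_basic by (simp add: conj_sat_def literal_take(2)[OF that(1,2) ys])
      qed
      show ?thesis using *[OF l] *[OF nl] sat dec by auto
    qed
    have "elts (app I R) = elts (rel_G R)"
    proof (intro equalityI subsetI)
      fix s assume s: "s \<in> elts (app I R)"
      then obtain ys where "s = seq ys" "length ys = n" "set ys \<subseteq> elts X" using I(4)[OF n] by blast
      then show "s \<in> elts (rel_G R)" using rel s by simp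
    next
      fix s assume s: "s \<in> elts (rel_G R)"
      then obtain ys where ys: "s = seq ys" "set ys \<subseteq> elts X" "opair R (von (length ys)) \<in> elts L"
        unfolding elts_rel_G FS(2) by auto
      then have "length ys = n" using n arity_iff[of R] by auto
      then show "s \<in> elts (app I R)" using rel s ys by simp
    qed
    then show ?thesis by (simp only: elts_inject)
  qed
  moreover have "fdom I = fdom (graph rel_G (dom_of L))"
    by (simp only: I(3) graph_fun(2) elts_dom_of[OF L(1)])
  ultimately have "I = graph rel_G (dom_of L)"
    by (intro fun_eqI[OF I(2) graph_fun(1)]) (simp_all add: I(3) app_graph elts_dom_of[OF L(1)])
  then show ?thesis using I(1) by (simp add: M_G_def)
qed

lemma Inter_basic: "(\<Inter>g\<in>G \<inter> basic_codes V L X. interp VG L X g) = {M_G}"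
  using M_G_unique truth G_code by blast

text \<open>Intersecting over more codes can only shrink \<open>{M_G}\<close>, and
  \<open>M_G\<close> survives by \<open>truth\<close>.\<close>

lemma Inter_all: "(\<Inter>g\<in>G. interp VG L X g) = {M_G}"
  using Inter_basic truth G_code G_nonempty by blast

lemma G_eq: "G = {\<zeta> \<in> P. M_G \<in> interp VG L X \<zeta>}"
  using truth G_sub P_iff by blast

end

theorem theorem6p2:
  fixes V G :: "'k hset set" and \<kappa> X L \<mu> :: "'k hset"
  assumes "transitive_model V"
    and "\<kappa> \<in> V" and "ordinal \<kappa>" and "infinite (elts \<kappa>)"
    and "X \<in> V" and "infinite (elts X)"
    and "L \<in> V" and "relational_language L"
    and "\<mu> \<in> V" and "prob_kappa_measure V \<kappa> L X \<mu>"
    and "random_generic V \<kappa> L X \<mu> G"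
  shows "let VG = random_extension V \<kappa> L X \<mu> G;
             G\<^sub>b = G \<inter> basic_codes V L X
         in card (\<Inter>g\<in>G. interp VG L X g) = 1
          \<and> (\<Inter>g\<in>G. interp VG L X g) = (\<Inter>g\<in>G\<^sub>b. interp VG L X g)
          \<and> (\<forall>M\<in>VG. {M} = (\<Inter>g\<in>G\<^sub>b. interp VG L X g) \<longrightarrow>
                G = {\<zeta> \<in> O_plus V \<kappa> L X \<mu>. M \<in> interp VG L X \<zeta>})"
proof -
  \<comment> \<open>Without structures the whole space would be empty, and its measure would be both
    0 and 1.\<close>
  have "Str V L X \<noteq> {}"
    using assms(10) by (auto simp: prob_kappa_measure_def)
  then interpret generic_model V \<kappa> L X \<mu> G
    by unfold_locales (use assms in simp_all)
  show ?thesis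
    unfolding Let_def Inter_all Inter_basic using G_eq by simp
qed

end
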